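(* Let $d\ge2$ be an integer and let $N^N(z)$ be the number of eigenvalues (counted with multiplicity) not exceeding $z$ of the Neumann Laplacian on the hemisphere $\mathbb{S}^d_+$. For $z\geq0$ let $w\ge0$ be defined by $w(w+d-1)=z$. As $z\to\infty$, $$ \frac{N^N(z)}{L_{0,d}^{class}|\mathbb{S}_{+}^d|\,z^{\frac d2}}=1+\frac14\frac{L_{0,d-1}^{class}}{L_{0,d}^{class}}\frac{|\partial\mathbb{S}_{+}^d|}{|\mathbb{S}_{+}^d|}(1-2\psi(w))z^{-1/2}+\frac{d(d-1)}{2}\left(\left(\frac12-\psi(w)\right)^2+\frac{d-2}{6}\right)z^{-1}+O(z^{-3/2}), $$ or, equivalently, $$ \frac{N^N(z)}{L_{0,d}^{class}|\mathbb{S}_{+}^d|\,z^{\frac d2}}=1+\frac{d(1-2\psi(w))}{2}z^{-1/2}+\frac{d(d-1)}{2}\left(\left(\frac12-\psi(w)\right)^2+\frac{d-2}{6}\right)z^{-1}+O(z^{-3/2}). $$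
   Context: $\mathbb{S}^d$ is the round unit sphere in $\mathbb{R}^{d+1}$, $\mathbb{S}^d_+=\mathbb{S}^d\cap\{x_{d+1}>0\}$, and $|\partial\mathbb{S}^d_+|=|\mathbb{S}^{d-1}|$. The distinct eigenvalues (energy levels) of the Neumann Laplacian on $\mathbb{S}^d_+$ are $\lambda_{(l)}=l(l+d-1)$, $l\in\mathbb{N}=\{0,1,2,\dots\}$, with multiplicity $\binom{d+l-1}{d-1}$. The semiclassical constant is $L_{\gamma,d}^{class}=(4\pi)^{-d/2}\frac{\Gamma(\gamma+1)}{\Gamma(\gamma+1+d/2)}$, so $L_{0,d}^{class}|\mathbb{S}_+^d|=\frac{1}{d!}$. The fluctuation function is $\psi(\eta)=\eta-\lfloor\eta\rfloor-\frac12$, $\eta\ge0$. *)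

theory Defs
  imports "HOL-Analysis.Analysis" "HOL-Library.Landau_Symbols" "HOL-Library.Function_Algebras"
begin

text \<open>
  For \<open>d = CARD('n)\<close> the space \<open>\<real>\<^sup>d\<^sup>+\<^sup>1\<close> is \<open>(real ^ 'n) \<times> real\<close>, whose norm is the
  Euclidean one; the last coordinate \<open>x\<^sub>d\<^sub>+\<^sub>1\<close> is \<open>snd x\<close>.
\<close>

definition hemisphere :: "((real ^ 'n) \<times> real) set" where
  "hemisphere = {x \<in> sphere 0 1. snd x > 0}"

definition closed_hemisphere :: "((real ^ 'n) \<times> real) set" where
  "closed_hemisphere = {x \<in> sphere 0 1. snd x \<ge> 0}"

definition equator :: "((real ^ 'n) \<times> real) set" where
  "equator = {x \<in> sphere 0 1. snd x = 0}"

text \<open>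
  Surface measure of a subset of the unit sphere of an \<open>m\<close>-dimensional Euclidean space:
  \<open>m\<close> times the volume of the cone over it with apex \<open>0\<close>.
\<close>

definition sphere_area :: "'a::euclidean_space set \<Rightarrow> real" where
  "sphere_area A = real DIM('a) * measure lebesgue {r *\<^sub>R x | r x. 0 \<le> r \<and> r \<le> 1 \<and> x \<in> A}"

definition pderiv_dir :: "'a::euclidean_space \<Rightarrow> ('a \<Rightarrow> real) \<Rightarrow> 'a \<Rightarrow> real" where
  "pderiv_dir b f x = frechet_derivative f (at x) b"

text \<open>\<open>C\<^sup>k\<close> regularity; meant for open \<open>U\<close>.\<close>

primrec Ck_on :: "nat \<Rightarrow> ('a::euclidean_space \<Rightarrow> real) \<Rightarrow> 'a set \<Rightarrow> bool" where
  "Ck_on 0 f U \<longleftrightarrow> continuous_on U f"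
| "Ck_on (Suc k) f U \<longleftrightarrow> f differentiable_on U \<and> (\<forall>b\<in>Basis. Ck_on k (pderiv_dir b f) U)"

definition laplacian :: "('a::euclidean_space \<Rightarrow> real) \<Rightarrow> 'a \<Rightarrow> real" where
  "laplacian f x = (\<Sum>b\<in>Basis. pderiv_dir b (pderiv_dir b f) x)"

text \<open>
  Laplace-Beltrami operator of the unit sphere: the Euclidean Laplacian of the extension
  \<open>y \<mapsto> u (y / norm y)\<close> that is constant along rays.
\<close>

definition sphere_laplacian :: "('a::euclidean_space \<Rightarrow> real) \<Rightarrow> 'a \<Rightarrow> real" where
  "sphere_laplacian u x = laplacian (\<lambda>y. u (sgn y)) x"

text \<open>\<open>u\<close> is \<open>C\<^sup>2\<close> up to the boundary.\<close>

definition C2_closed_hemisphere :: "((real ^ 'n) \<times> real \<Rightarrow> real) \<Rightarrow> bool" where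
  "C2_closed_hemisphere u \<longleftrightarrow>
     (\<exists>U F. open U \<and> closed_hemisphere \<subseteq> U \<and> Ck_on 2 F U \<and> (\<forall>x\<in>closed_hemisphere. F x = u x))"

text \<open>
  At a point \<open>x\<close> of the boundary, \<open>t \<mapsto> cos t *\<^sub>R x + sin t *\<^sub>R (0, 1)\<close> with \<open>t \<ge> 0\<close> is the
  geodesic that enters the hemisphere in the direction of the inner unit normal \<open>(0, 1)\<close>.
\<close>

definition neumann_condition :: "((real ^ 'n) \<times> real \<Rightarrow> real) \<Rightarrow> bool" where
  "neumann_condition u \<longleftrightarrow>
     (\<forall>x\<in>equator.
        ((\<lambda>t. u (cos t *\<^sub>R x + sin t *\<^sub>R (0, 1))) has_real_derivative 0) (at_right 0))"

text \<open>
  Functions on the closed hemisphere are represented by total functions that vanish outside it,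
  so that distinct elements of the eigenspace differ on the closed hemisphere.
\<close>

definition neumann_eigenspace :: "real \<Rightarrow> ((real ^ 'n) \<times> real \<Rightarrow> real) set" where
  "neumann_eigenspace \<mu> =
     {u. (\<forall>x. x \<notin> closed_hemisphere \<longrightarrow> u x = 0) \<and> C2_closed_hemisphere u \<and>
         neumann_condition u \<and> (\<forall>x\<in>hemisphere. - sphere_laplacian u x = \<mu> * u x)}"

global_interpretation real_fun: vector_space "\<lambda>c (u :: 'a \<Rightarrow> real) x. c * u x"
  by unfold_locales (auto simp: fun_eq_iff algebra_simps)

definition neumann_eigenvalues :: "'n::finite itself \<Rightarrow> real set" where
  "neumann_eigenvalues _ =
     {\<mu>. \<exists>u \<in> (neumann_eigenspace \<mu> :: ((real ^ 'n) \<times> real \<Rightarrow> real) set). u \<noteq> 0}"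

definition neumann_multiplicity :: "'n::finite itself \<Rightarrow> real \<Rightarrow> nat" where
  "neumann_multiplicity _ \<mu> =
     real_fun.dim (neumann_eigenspace \<mu> :: ((real ^ 'n) \<times> real \<Rightarrow> real) set)"

definition neumann_counting :: "'n::finite itself \<Rightarrow> real \<Rightarrow> nat" where
  "neumann_counting T z = (\<Sum>\<mu> \<in> {\<mu> \<in> neumann_eigenvalues T. \<mu> \<le> z}. neumann_multiplicity T \<mu>)"

definition L_class :: "real \<Rightarrow> nat \<Rightarrow> real" where
  "L_class \<gamma> d = (4 * pi) powr (- real d / 2) * Gamma (\<gamma> + 1) / Gamma (\<gamma> + 1 + real d / 2)"

definition fluctuation :: "real \<Rightarrow> real" where
  "fluctuation \<eta> = \<eta> - of_int \<lfloor>\<eta>\<rfloor> - 1 / 2"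

end

theory Submission
  imports Defs "HOL-Real_Asymp.Real_Asymp"
begin

text \<open>
  Write \<open>d = CARD('n)\<close> and let a point of \<open>\<real>\<^sup>d\<^sup>+\<^sup>1\<close> be \<open>(x, t)\<close>. The spectrum is computed exactly:
  the eigenvalues are \<open>l (l + d - 1)\<close>, and the eigenspace of the \<open>l\<close>-th one consists of the
  restrictions of the harmonic polynomials that are even in \<open>t\<close> and homogeneous of degree \<open>l\<close>.
  Such a polynomial is determined by its values on \<open>t = 0\<close>, so the multiplicity is the number of
  monomials of degree \<open>l\<close> in \<open>d\<close> variables. Summing over the levels up to \<open>z\<close> gives
  \<open>N(z) = binomial (L + d) d\<close> with \<open>L = floor w\<close> (\<open>neumann_counting_eq\<close>), and what remains is
  an expansion of this product of \<open>d\<close> linear factors.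

  Eigenfunctions exist because every monomial \<open>x\<^sup>\<alpha>\<close> has the even harmonic extension
  \<open>\<Sum>k. (-1)\<^sup>k t\<^sup>2\<^sup>k / (2k)! \<Delta>\<^sup>k x\<^sup>\<alpha>\<close> (\<open>harm_ext\<close>); evenness in \<open>t\<close> gives the Neumann condition.

  That there are no others rests on Green's formula, which is carried out in the half-space \<open>t > 0\<close>
  instead of on the sphere. An eigenfunction extended to be constant along rays is a function \<open>f\<close>
  with \<open>\<Delta> f = - \<mu> f / \<bar>y\<bar>\<^sup>2\<close>. For two such functions and a radial cutoff \<open>\<rho>\<close> that lives in an
  annulus, the field \<open>\<rho> (f \<nabla>g - g \<nabla>f)\<close> has divergence \<open>(\<mu> - \<nu>) \<rho> f g / \<bar>y\<bar>\<^sup>2\<close>: the derivative of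
  \<open>\<rho>\<close> is radial and does not see \<open>\<nabla>f\<close> and \<open>\<nabla>g\<close>, which are tangential. The Neumann condition
  makes the flux through \<open>t = 0\<close> vanish, so eigenfunctions for different eigenvalues are orthogonal
  for \<open>hprod\<close>, which is a multiple of the \<open>L\<^sup>2\<close> product of the hemisphere (\<open>green_cone\<close>).

  Completeness is a count of dimensions. On the sphere \<open>t\<^sup>2 = 1 - \<bar>x\<bar>\<^sup>2\<close>, so the extensions of the
  monomials of degree at most \<open>m\<close> restrict to polynomials in \<open>x\<close> of degree at most \<open>m\<close>. They are
  linearly independent and there are as many of them as there are monomials, so they span all these
  polynomials (\<open>hemi_polys_eq_span_harm_fun\<close>), which are uniformly dense by Stone-Weierstrass.
  Hence an eigenfunction minus its projection to the known eigenspace is orthogonal to a dense set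
  and vanishes (\<open>neumann_eigenspace_eq_span\<close>).

  For the expansion put \<open>s = sqrt (z + (d - 1)\<^sup>2 / 4)\<close>, so that \<open>w = s - (d - 1) / 2\<close>. Then
  \<open>L + 1 + j = s + a\<^sub>j\<close>, where \<open>a\<^sub>j = 1/2 - \<psi>(w) + j - (d - 1) / 2\<close> is bounded, and the coefficients
  of \<open>z\<^sup>-\<^sup>1\<^sup>/\<^sup>2\<close> and \<open>z\<^sup>-\<^sup>1\<close> come from the first two elementary symmetric functions of the \<open>a\<^sub>j\<close>
  and from \<open>s / sqrt z\<close> (\<open>counting_asymptotics\<close>).
\<close>

section \<open>Calculus of \<open>C\<^sup>k\<close> functions\<close>

lemma pderiv_dir_eqI:
  assumes "(f has_derivative f') (at x)"
  shows "pderiv_dir b f x = f' b"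
  using frechet_derivative_at[OF assms] by (simp add: pderiv_dir_def)

lemma pderiv_dir_cong:
  assumes "open U" "x \<in> U" "\<And>y. y \<in> U \<Longrightarrow> f y = g y"
  shows "pderiv_dir b f x = pderiv_dir b g x"
proof -
  have "(f has_derivative f') (at x) \<longleftrightarrow> (g has_derivative f') (at x)" for f'
    using has_derivative_transform_within_open[OF _ assms(1,2), of f f' UNIV g]
      has_derivative_transform_within_open[OF _ assms(1,2), of g f' UNIV f] assms(3) by auto
  then show ?thesis by (simp add: pderiv_dir_def frechet_derivative_def)
qed

lemma frechet_derivative_pderiv_dir:
  fixes f :: "'a::euclidean_space \<Rightarrow> real"
  assumes "f differentiable (at x)"
  shows "frechet_derivative f (at x) h = (\<Sum>b\<in>Basis. (h \<bullet> b) * pderiv_dir b f x)"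
proof -
  interpret linear "frechet_derivative f (at x)"
    using assms by (simp add: linear_frechet_derivative)
  have "frechet_derivative f (at x) h = frechet_derivative f (at x) (\<Sum>b\<in>Basis. (h \<bullet> b) *\<^sub>R b)"
    by (simp add: euclidean_representation)
  also have "\<dots> = (\<Sum>b\<in>Basis. (h \<bullet> b) * pderiv_dir b f x)"
    by (simp add: sum scale pderiv_dir_def)
  finally show ?thesis .
qed

lemma has_derivative_pderiv_dir:
  fixes f :: "'a::euclidean_space \<Rightarrow> real"
  assumes "f differentiable (at x)"
  shows "(f has_derivative (\<lambda>h. \<Sum>b\<in>Basis. (h \<bullet> b) * pderiv_dir b f x)) (at x)"
proof -
  have "frechet_derivative f (at x) = (\<lambda>h. \<Sum>b\<in>Basis. (h \<bullet> b) * pderiv_dir b f x)"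
    using frechet_derivative_pderiv_dir[OF assms] by (simp add: fun_eq_iff)
  with assms show ?thesis by (metis frechet_derivative_works)
qed

lemma pderiv_dir_mult:
  assumes "f differentiable (at x)" "g differentiable (at x)"
  shows "pderiv_dir b (\<lambda>x. f x * g x) x = f x * pderiv_dir b g x + pderiv_dir b f x * g x"
  using pderiv_dir_eqI[OF has_derivative_mult[OF assms[unfolded frechet_derivative_works]]]
  by (simp add: pderiv_dir_def)

lemma pderiv_dir_add:
  assumes "f differentiable (at x)" "g differentiable (at x)"
  shows "pderiv_dir b (\<lambda>x. f x + g x) x = pderiv_dir b f x + pderiv_dir b g x"
  using pderiv_dir_eqI[OF has_derivative_add[OF assms[unfolded frechet_derivative_works]]]
  by (simp add: pderiv_dir_def)

lemma pderiv_dir_cmult: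
  assumes "f differentiable (at x)"
  shows "pderiv_dir b (\<lambda>x. c * f x) x = c * pderiv_dir b f x"
  using pderiv_dir_eqI[OF has_derivative_mult_right[OF assms[unfolded frechet_derivative_works]]]
  by (simp add: pderiv_dir_def)

lemma pderiv_dir_diff:
  assumes "f differentiable (at x)" "g differentiable (at x)"
  shows "pderiv_dir b (\<lambda>x. f x - g x) x = pderiv_dir b f x - pderiv_dir b g x"
  using pderiv_dir_eqI[OF has_derivative_diff[OF assms[unfolded frechet_derivative_works]]]
  by (simp add: pderiv_dir_def)

lemma pderiv_dir_const [simp]: "pderiv_dir b (\<lambda>x. c) x = 0"
  by (simp add: pderiv_dir_def)

lemma pderiv_dir_sum:
  assumes "finite I" "\<And>i. i \<in> I \<Longrightarrow> f i differentiable (at x)"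
  shows "pderiv_dir b (\<lambda>x. \<Sum>i\<in>I. f i x) x = (\<Sum>i\<in>I. pderiv_dir b (f i) x)"
proof -
  have "((\<lambda>x. \<Sum>i\<in>I. f i x) has_derivative (\<lambda>h. \<Sum>i\<in>I. frechet_derivative (f i) (at x) h)) (at x)"
    using assms(2) by (intro has_derivative_sum) (simp add: frechet_derivative_works)
  from pderiv_dir_eqI[OF this] show ?thesis by (simp add: pderiv_dir_def)
qed

lemma differentiable_on_eqI:
  assumes "f differentiable_on U" "\<And>y. y \<in> U \<Longrightarrow> f y = g y"
  shows "g differentiable_on U"
  unfolding differentiable_on_def
proof
  fix x assume x: "x \<in> U"
  then obtain D where "(f has_derivative D) (at x within U)"
    using assms(1) by (auto simp: differentiable_on_def differentiable_def)
  then have "(g has_derivative D) (at x within U)"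
    by (rule has_derivative_transform[OF x, rotated]) (use assms(2) in auto)
  then show "g differentiable (at x within U)" by (auto simp: differentiable_def)
qed

lemma Ck_on_cong:
  assumes "open U" "\<And>y. y \<in> U \<Longrightarrow> f y = g y" "Ck_on k f U"
  shows "Ck_on k g U"
  using assms(2,3)
proof (induction k arbitrary: f g)
  case 0
  then show ?case using continuous_on_cong[of U U f g] by simp
next
  case (Suc k)
  have "g differentiable_on U"
    using Suc.prems by (auto intro: differentiable_on_eqI)
  moreover have "Ck_on k (pderiv_dir b g) U" if "b \<in> Basis" for b
  proof (rule Suc.IH)
    show "pderiv_dir b f y = pderiv_dir b g y" if "y \<in> U" for y
      using assms(1) that Suc.prems(1) by (rule pderiv_dir_cong)
  qed (use Suc.prems that in simp)
  ultimately show ?case by simp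
qed

lemma Ck_on_subset: "Ck_on k f U \<Longrightarrow> V \<subseteq> U \<Longrightarrow> Ck_on k f V"
  by (induction k arbitrary: f) (auto intro: continuous_on_subset differentiable_on_subset)

lemma Ck_on_SucD: "Ck_on (Suc k) f U \<Longrightarrow> Ck_on k f U"
  by (induction k arbitrary: f) (auto intro: differentiable_imp_continuous_on)

lemma Ck_on_mono: "Ck_on k f U \<Longrightarrow> m \<le> k \<Longrightarrow> Ck_on m f U"
  by (induction k) (auto simp: le_Suc_eq dest: Ck_on_SucD simp del: Ck_on.simps)

lemma Ck_on_imp_continuous_on: "Ck_on k f U \<Longrightarrow> continuous_on U f"
  using Ck_on_mono[of k f U 0] by simp

lemma Ck_on_imp_differentiable: "Ck_on (Suc k) f U \<Longrightarrow> open U \<Longrightarrow> x \<in> U \<Longrightarrow> f differentiable (at x)"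
  by (simp add: differentiable_on_eq_differentiable_at)

lemma Ck_on_const: "Ck_on k (\<lambda>x. c) U"
proof (induction k arbitrary: c)
  case (Suc k)
  have "pderiv_dir b (\<lambda>x. c) = (\<lambda>x. 0)" for b :: 'a by (simp add: fun_eq_iff)
  then show ?case using Suc by simp
qed simp

lemma Ck_on_add:
  assumes "open U" "Ck_on k f U" "Ck_on k g U"
  shows "Ck_on k (\<lambda>x. f x + g x) U"
  using assms(2,3)
proof (induction k arbitrary: f g)
  case (Suc k)
  have "Ck_on k (pderiv_dir b (\<lambda>x. f x + g x)) U" if "b \<in> Basis" for b
  proof (rule Ck_on_cong[OF assms(1)])
    show "Ck_on k (\<lambda>x. pderiv_dir b f x + pderiv_dir b g x) U"
      using Suc that by simp
  qed (use Suc.prems assms(1) in \<open>simp add: pderiv_dir_add differentiable_on_eq_differentiable_at\<close>)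
  then show ?case using Suc.prems by (simp add: differentiable_on_add)
qed (simp add: continuous_on_add)

lemma Ck_on_mult:
  assumes "open U" "Ck_on k f U" "Ck_on k g U"
  shows "Ck_on k (\<lambda>x. f x * g x) U"
  using assms(2,3)
proof (induction k arbitrary: f g)
  case (Suc k)
  have "Ck_on k (pderiv_dir b (\<lambda>x. f x * g x)) U" if "b \<in> Basis" for b
  proof (rule Ck_on_cong[OF assms(1)])
    show "Ck_on k (\<lambda>x. f x * pderiv_dir b g x + pderiv_dir b f x * g x) U"
      using Suc that Ck_on_SucD[OF Suc.prems(1)] Ck_on_SucD[OF Suc.prems(2)]
      by (intro Ck_on_add assms) auto
  qed (use Suc.prems assms(1) in \<open>simp add: pderiv_dir_mult differentiable_on_eq_differentiable_at\<close>)
  then show ?case using Suc.prems by (simp add: differentiable_on_mult)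
qed (simp add: continuous_on_mult)

lemma Ck_on_minus: "open U \<Longrightarrow> Ck_on k f U \<Longrightarrow> Ck_on k (\<lambda>x. - f x) U"
  using Ck_on_mult[of U k "\<lambda>x. - 1" f] by (simp add: Ck_on_const)

lemma Ck_on_diff: "open U \<Longrightarrow> Ck_on k f U \<Longrightarrow> Ck_on k g U \<Longrightarrow> Ck_on k (\<lambda>x. f x - g x) U"
  using Ck_on_add[of U k f "\<lambda>x. - g x"] by (simp add: Ck_on_minus)

lemma Ck_on_sum:
  assumes "open U" "\<And>i. i \<in> I \<Longrightarrow> Ck_on k (f i) U"
  shows "Ck_on k (\<lambda>x. \<Sum>i\<in>I. f i x) U"
  using assms(2)
  by (induction I rule: infinite_finite_induct) (auto intro: Ck_on_const Ck_on_add assms(1))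

lemma Ck_on_power: "open U \<Longrightarrow> Ck_on k f U \<Longrightarrow> Ck_on k (\<lambda>x. f x ^ n) U"
  by (induction n) (auto intro: Ck_on_const Ck_on_mult)

lemma Ck_on_bounded_linear:
  assumes "bounded_linear f"
  shows "Ck_on k f U"
proof (cases k)
  case 0
  then show ?thesis using assms by (simp add: linear_continuous_on)
next
  case (Suc m)
  have "pderiv_dir b f = (\<lambda>x. f b)" for b
    using pderiv_dir_eqI[OF bounded_linear_imp_has_derivative[OF assms]] by (simp add: fun_eq_iff)
  then show ?thesis using Suc assms
    by (simp add: Ck_on_const bounded_linear_imp_differentiable_on)
qed

lemma Ck_on_Un:
  assumes "open U" "open V" "Ck_on k f U" "Ck_on k f V"
  shows "Ck_on k f (U \<union> V)"
  using assms(3,4)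
proof (induction k arbitrary: f)
  case 0
  then show ?case using assms(1,2) by (simp add: continuous_on_open_Un)
next
  case (Suc k)
  then show ?case using assms(1,2)
    by (auto simp: differentiable_on_eq_differentiable_at open_Un)
qed

text \<open>
  The chain rule writes a partial derivative of the composite as a sum of products
  \<open>(\<partial>\<^sub>c F \<circ> \<sigma>) \<sqdot> \<partial>\<^sub>b \<sigma>\<^sub>c\<close>, to which the induction hypothesis applies.
\<close>

lemma Ck_on_compose:
  fixes F :: "'b::euclidean_space \<Rightarrow> real" and \<sigma> :: "'a::euclidean_space \<Rightarrow> 'b"
  assumes "open U" "open V" "\<sigma> ` V \<subseteq> U"
    and "\<And>c. c \<in> Basis \<Longrightarrow> Ck_on k (\<lambda>x. \<sigma> x \<bullet> c) V" "Ck_on k F U"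
  shows "Ck_on k (\<lambda>x. F (\<sigma> x)) V"
  using assms(4,5)
proof (induction k arbitrary: F)
  case 0
  have "continuous_on V \<sigma>"
    using 0 by (subst continuous_on_componentwise) auto
  then show ?case using 0 assms(3) continuous_on_compose2[of U F V \<sigma>] by auto
next
  case (Suc k)
  have dF: "F differentiable (at y)" if "y \<in> U" for y
    using Suc.prems(2) assms(1) that by (rule Ck_on_imp_differentiable)
  have ds: "(\<sigma> has_derivative (\<lambda>h. \<Sum>c\<in>Basis. frechet_derivative (\<lambda>x. \<sigma> x \<bullet> c) (at x) h *\<^sub>R c)) (at x)"
    if "x \<in> V" for x
  proof (subst has_derivative_componentwise_within, rule ballI)
    fix c :: 'b assume c: "c \<in> Basis"
    have "(\<lambda>x. \<sigma> x \<bullet> c) differentiable (at x)"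
      using Suc.prems(1)[OF c] assms(2) that by (rule Ck_on_imp_differentiable)
    moreover have "(\<Sum>i\<in>Basis. frechet_derivative (\<lambda>x. \<sigma> x \<bullet> i) (at x) h *\<^sub>R i) \<bullet> c
        = frechet_derivative (\<lambda>x. \<sigma> x \<bullet> c) (at x) h" for h
      using c by (simp add: inner_sum_left inner_Basis if_distrib sum.delta cong: if_cong)
    ultimately show "((\<lambda>x. \<sigma> x \<bullet> c) has_derivative
        (\<lambda>x'. (\<Sum>i\<in>Basis. frechet_derivative (\<lambda>x. \<sigma> x \<bullet> i) (at x) x' *\<^sub>R i) \<bullet> c)) (at x)"
      by (simp add: frechet_derivative_works)
  qed
  have comp: "((\<lambda>x. F (\<sigma> x)) has_derivative (\<lambda>h. \<Sum>c\<in>Basis. frechet_derivative (\<lambda>x. \<sigma> x \<bullet> c) (at x) h * pderiv_dir c F (\<sigma> x))) (at x)"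
    if "x \<in> V" for x
  proof -
    have "\<sigma> x \<in> U" using that assms(3) by auto
    from has_derivative_compose[OF ds[OF that] has_derivative_pderiv_dir[OF dF[OF this]]]
    show ?thesis by (simp add: inner_sum_left inner_Basis if_distrib sum.delta cong: if_cong)
  qed
  have "Ck_on k (pderiv_dir b (\<lambda>x. F (\<sigma> x))) V" if b: "b \<in> Basis" for b
  proof (rule Ck_on_cong[OF assms(2)])
    show "Ck_on k (\<lambda>x. \<Sum>c\<in>Basis. pderiv_dir b (\<lambda>x. \<sigma> x \<bullet> c) x * pderiv_dir c F (\<sigma> x)) V"
    proof (intro Ck_on_sum Ck_on_mult assms(2))
      fix c :: 'b assume c: "c \<in> Basis"
      show "Ck_on k (pderiv_dir b (\<lambda>x. \<sigma> x \<bullet> c)) V" using Suc.prems(1)[OF c] b by simp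
      show "Ck_on k (\<lambda>x. pderiv_dir c F (\<sigma> x)) V"
      proof (rule Suc.IH)
        show "Ck_on k (\<lambda>x. \<sigma> x \<bullet> c) V" if "c \<in> Basis" for c
          using Suc.prems(1)[OF that] by (rule Ck_on_SucD)
        show "Ck_on k (pderiv_dir c F) U" using Suc.prems(2) c by simp
      qed
    qed
  next
    fix x assume "x \<in> V"
    from pderiv_dir_eqI[OF comp[OF this]]
    show "(\<Sum>c\<in>Basis. pderiv_dir b (\<lambda>x. \<sigma> x \<bullet> c) x * pderiv_dir c F (\<sigma> x)) = pderiv_dir b (\<lambda>x. F (\<sigma> x)) x"
      by (simp add: pderiv_dir_def)
  qed
  moreover have "(\<lambda>x. F (\<sigma> x)) differentiable_on V"
    using comp assms(2) by (auto simp: differentiable_on_eq_differentiable_at differentiable_def)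
  ultimately show ?case by simp
qed

lemma has_derivative_inverse_norm:
  fixes x :: "'a::euclidean_space"
  assumes "x \<noteq> 0"
  shows "((\<lambda>y. inverse (norm y)) has_derivative (\<lambda>h. - (x \<bullet> h) * inverse (norm x) ^ 3)) (at x)"
  using assms
  by (auto intro!: derivative_eq_intros has_derivative_norm simp: sgn_div_norm divide_simps power3_eq_cube power2_eq_square inner_commute)

text \<open>
  The partial derivatives of \<open>1 / \<bar>y\<bar>\<close> are polynomials in the coordinates and in \<open>1 / \<bar>y\<bar>\<close>
  itself, which is what makes the induction on \<open>k\<close> close.
\<close>

lemma Ck_on_inverse_norm:
  "Ck_on k (\<lambda>y::'a::euclidean_space. inverse (norm y)) (-{0})"
proof (induction k)
  case 0
  then show ?case by (auto intro!: continuous_intros)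
next
  case (Suc k)
  have "Ck_on k (pderiv_dir b (\<lambda>y::'a. inverse (norm y))) (-{0})" for b
  proof (rule Ck_on_cong)
    show "Ck_on k (\<lambda>y::'a. - (y \<bullet> b) * inverse (norm y) ^ 3) (-{0})"
      by (intro Ck_on_mult Ck_on_power Ck_on_minus Suc Ck_on_bounded_linear bounded_linear_inner_left) auto
  next
    fix y :: 'a assume "y \<in> -{0}"
    then show "- (y \<bullet> b) * inverse (norm y) ^ 3 = pderiv_dir b (\<lambda>y. inverse (norm y)) y"
      using pderiv_dir_eqI[OF has_derivative_inverse_norm[of y], of b] by simp
  qed auto
  moreover have "(\<lambda>y::'a. inverse (norm y)) differentiable_on (-{0})"
    using has_derivative_inverse_norm
    by (subst differentiable_on_eq_differentiable_at) (auto simp: differentiable_def)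
  ultimately show ?case by simp
qed

text \<open>
  The extension along rays of a \<open>C\<^sup>k\<close> function given near a subset of the unit sphere.
\<close>

lemma Ck_on_compose_sgn:
  fixes F :: "'a::euclidean_space \<Rightarrow> real"
  assumes "open U" "Ck_on k F U"
  shows "open {y. y \<noteq> 0 \<and> sgn y \<in> U}" "Ck_on k (\<lambda>y. F (sgn y)) {y. y \<noteq> 0 \<and> sgn y \<in> U}"
proof -
  have "continuous_on (-{0}) (sgn :: 'a \<Rightarrow> 'a)"
    by (auto intro!: continuous_on_sgn)
  moreover have "open (-{0::'a})" by auto
  ultimately have "open (-{0} \<inter> sgn -` U)"
    using assms(1) continuous_open_preimage by blast
  then
  show o: "open {y. y \<noteq> 0 \<and> sgn y \<in> U}"
    by (simp add: vimage_def Int_def)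
  have "Ck_on k (\<lambda>y::'a. (y \<bullet> c) * inverse (norm y)) (-{0})" for c
    by (intro Ck_on_mult Ck_on_inverse_norm Ck_on_bounded_linear bounded_linear_inner_left) auto
  then have "Ck_on k (\<lambda>y::'a. sgn y \<bullet> c) (-{0})" for c
    by (simp add: sgn_div_norm field_simps)
  then show "Ck_on k (\<lambda>y. F (sgn y)) {y. y \<noteq> 0 \<and> sgn y \<in> U}"
    by (intro Ck_on_compose[OF assms(1) o _ _ assms(2)]) (auto intro: Ck_on_subset[of _ _ "-{0}"])
qed

section \<open>Integration by parts on a half-space\<close>

text \<open>
  Lebesgue measure is invariant under translations, so every difference quotient of \<open>G\<close> has
  integral \<open>0\<close>. The Lipschitz bound and the bounded support dominate the quotients.
\<close>

lemma integral_difference_quotient_limit: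
  fixes G g :: "'a::euclidean_space \<Rightarrow> real"
  assumes G: "integrable lborel G" and g: "g \<in> borel_measurable borel"
    and supp: "\<And>y. norm y > R \<Longrightarrow> G y = 0"
    and Lip: "\<And>y s. s \<ge> 0 \<Longrightarrow> \<bar>G (y + s *\<^sub>R b) - G y\<bar> \<le> C * s"
    and lim: "AE y in lborel. ((\<lambda>s. (G (y + s *\<^sub>R b) - G y) / s) \<longlongrightarrow> g y) (at_right 0)"
  shows "integrable lborel g" "integral\<^sup>L lborel g = 0"
proof -
  define \<epsilon> where "\<epsilon> n = inverse (real (Suc n))" for n
  define q where "q n y = (G (y + \<epsilon> n *\<^sub>R b) - G y) / \<epsilon> n" for n y
  have \<epsilon>: "\<epsilon> n > 0" "\<epsilon> n \<le> 1" for n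
    by (auto simp: \<epsilon>_def inverse_le_1_iff)
  have \<epsilon>_lim: "filterlim \<epsilon> (at_right 0) sequentially"
    unfolding \<epsilon>_def by (rule tendsto_imp_filterlim_at_right[OF LIMSEQ_inverse_real_of_nat]) auto
  have C: "C \<ge> 0" using Lip[of 1 0] by (smt (verit) mult_cancel_left1)
  have meas [measurable]: "G \<in> borel_measurable borel" using G by auto
  have shift: "integrable lborel (\<lambda>y. G (y + c))" "(\<integral>y. G (y + c) \<partial>lborel) = integral\<^sup>L lborel G" for c
  proof -
    have d: "distr lborel borel ((+) c) = (lborel :: 'a measure)" by (rule lborel_distr_plus)
    have "integrable (distr lborel borel ((+) c)) G" using G d by simp
    then show "integrable lborel (\<lambda>y. G (y + c))"
      by (subst (asm) integrable_distr_eq) (auto simp: add.commute)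
    have "integral\<^sup>L (distr lborel borel ((+) c)) G = (\<integral>y. G (c + y) \<partial>lborel)"
      by (rule integral_distr) auto
    then show "(\<integral>y. G (y + c) \<partial>lborel) = integral\<^sup>L lborel G" using d by (simp add: add.commute)
  qed
  have q0: "integral\<^sup>L lborel (q n) = 0" for n
    unfolding q_def using shift G by simp
  have qm: "q n \<in> borel_measurable lborel" for n unfolding q_def by measurable
  let ?w = "\<lambda>y::'a. indicator (cball 0 (R + norm b)) y *\<^sub>R C"
  have w: "integrable lborel ?w"
    by (rule borel_integrable_compact) auto
  have bound: "norm (q n y) \<le> ?w y" for n y
  proof (cases "norm y \<le> R + norm b")
    case True
    have "\<bar>q n y\<bar> = \<bar>G (y + \<epsilon> n *\<^sub>R b) - G y\<bar> / \<epsilon> n" using \<epsilon>[of n] by (simp add: q_def abs_divide)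
    also have "\<dots> \<le> C" using Lip[of "\<epsilon> n" y] \<epsilon>[of n] by (simp add: divide_le_eq)
    finally show ?thesis using True by simp
  next
    case False
    have "\<epsilon> n * norm b \<le> norm b" using \<epsilon>[of n] by (simp add: mult_left_le_one_le)
    then have "norm (y + \<epsilon> n *\<^sub>R b) > R" using False norm_triangle_ineq4[of "y + \<epsilon> n *\<^sub>R b" "\<epsilon> n *\<^sub>R b"] \<epsilon>[of n]
      by simp
    moreover have "norm y > R" using False norm_ge_zero[of b] by linarith
    ultimately have "q n y = 0" by (simp add: q_def supp)
    then show ?thesis using C by (simp add: indicator_def)
  qed
  have lim': "AE y in lborel. (\<lambda>n. q n y) \<longlonglongrightarrow> g y"
    using lim by eventually_elim (auto simp: q_def intro: filterlim_compose[OF _ \<epsilon>_lim])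
  have gm: "g \<in> borel_measurable lborel" using g by simp
  show "integrable lborel g"
    by (rule integrable_dominated_convergence[OF gm qm w lim']) (use bound in auto)
  have "(\<lambda>n. integral\<^sup>L lborel (q n)) \<longlonglongrightarrow> integral\<^sup>L lborel g"
    by (rule integral_dominated_convergence[OF gm qm w lim']) (use bound in auto)
  then show "integral\<^sup>L lborel g = 0" by (simp add: q0 LIMSEQ_const_iff)
qed

text \<open>
  One component of the divergence theorem on a half-space. Extended by \<open>0\<close> below the boundary, \<open>W\<close>
  stays Lipschitz in the direction \<open>b\<close>: either \<open>b\<close> is parallel to the boundary, or \<open>W\<close> vanishes
  there. The extension can fail to be differentiable only on the boundary, which is a null set.
\<close>

lemma half_space_integral_pderiv_eq_0:
  fixes W :: "'a::euclidean_space \<times> real \<Rightarrow> real"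
  assumes "open \<Omega>" and sub: "{y. snd y \<ge> 0} \<subseteq> \<Omega>" and Ck: "Ck_on 1 W \<Omega>"
    and supp: "\<And>y. norm y > R \<Longrightarrow> W y = 0" and b: "b \<in> Basis"
    and bdry: "snd b = 0 \<or> (\<forall>y. snd y = 0 \<longrightarrow> W y = 0)"
  shows "integrable lborel (\<lambda>y. indicator {y. snd y > 0} y * pderiv_dir b W y)"
    and "(\<integral>y. indicator {y. snd y > 0} y * pderiv_dir b W y \<partial>lborel) = 0"
proof -
  define H where "H = {y::'a \<times> real. snd y > 0}"
  define K where "K = {y::'a \<times> real. snd y \<ge> 0} \<inter> cball 0 R"
  have oH: "open H" unfolding H_def by (intro open_Collect_less continuous_intros)
  have cK: "compact K" unfolding K_def
    by (intro closed_Int_compact closed_Collect_le continuous_intros compact_cball)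
  have H\<Omega>: "H \<subseteq> \<Omega>" and K\<Omega>: "K \<subseteq> \<Omega>" using sub by (auto simp: H_def K_def)
  have cW: "continuous_on \<Omega> W" using Ck by (rule Ck_on_imp_continuous_on)
  have cD: "continuous_on \<Omega> (pderiv_dir b W)" using Ck b by simp
  have dW: "W differentiable (at y)" if "y \<in> \<Omega>" for y
    using Ck_on_imp_differentiable[of 0 W \<Omega> y] Ck assms(1) that by simp
  have D0: "pderiv_dir b W y = 0" if "norm y > R" for y
  proof -
    have "open {y::'a \<times> real. norm y > R}" by (intro open_Collect_less continuous_intros)
    from pderiv_dir_cong[OF this, of y W "\<lambda>_. 0"] that supp show ?thesis by simp
  qed
  obtain C where C: "\<And>y. y \<in> K \<Longrightarrow> \<bar>pderiv_dir b W y\<bar> \<le> C" and C0: "C > 0"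
    using compact_imp_bounded[OF compact_continuous_image[OF continuous_on_subset[OF cD K\<Omega>] cK]]
    by (auto simp: bounded_pos)
  have DC: "\<bar>pderiv_dir b W y\<bar> \<le> C" if "snd y \<ge> 0" for y
    using C[of y] D0[of y] C0 that by (cases "norm y \<le> R") (auto simp: K_def)
  have sb: "snd b = 0 \<or> b = (0, 1)" "snd b \<ge> 0"
    using b by (auto simp: Basis_prod_def)
  have dline: "((\<lambda>\<tau>. W (y + \<tau> *\<^sub>R b)) has_field_derivative pderiv_dir b W (y + \<tau> *\<^sub>R b)) (at \<tau>)"
    if "y + \<tau> *\<^sub>R b \<in> \<Omega>" for y \<tau>
  proof -
    have 1: "((\<lambda>\<tau>. y + \<tau> *\<^sub>R b) has_derivative (\<lambda>h. h *\<^sub>R b)) (at \<tau>)"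
      by (auto intro!: derivative_eq_intros)
    have 2: "(W has_derivative frechet_derivative W (at (y + \<tau> *\<^sub>R b))) (at (y + \<tau> *\<^sub>R b))"
      using dW[OF that] by (simp add: frechet_derivative_works)
    have "linear (frechet_derivative W (at (y + \<tau> *\<^sub>R b)))" using dW[OF that] by (rule linear_frechet_derivative)
    then have "frechet_derivative W (at (y + \<tau> *\<^sub>R b)) (h *\<^sub>R b) = pderiv_dir b W (y + \<tau> *\<^sub>R b) * h" for h
      by (simp add: linear_cmul pderiv_dir_def)
    with has_derivative_compose[OF 1 2] show ?thesis
      by (simp add: has_field_derivative_def)
  qed
  have seg: "\<bar>W (y + s *\<^sub>R b) - W y\<bar> \<le> C * s" if "snd y \<ge> 0" "s \<ge> 0" for y s
  proof -
    have "norm (W (y + s *\<^sub>R b) - W (y + 0 *\<^sub>R b)) \<le> C * norm (s - 0)"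
    proof (rule field_differentiable_bound[where S = "{0..s}"])
      fix \<tau> assume "\<tau> \<in> {0..s}"
      then have "snd (y + \<tau> *\<^sub>R b) \<ge> 0" using sb(2) that by simp
      then show "norm (pderiv_dir b W (y + \<tau> *\<^sub>R b)) \<le> C" by (simp add: DC)
      from \<open>snd (y + \<tau> *\<^sub>R b) \<ge> 0\<close> have "y + \<tau> *\<^sub>R b \<in> \<Omega>" using sub by auto
      from dline[OF this] show "((\<lambda>\<tau>. W (y + \<tau> *\<^sub>R b)) has_field_derivative pderiv_dir b W (y + \<tau> *\<^sub>R b)) (at \<tau> within {0..s})"
        by (rule has_field_derivative_at_within)
    qed (use that in auto)
    then show ?thesis using that by simp
  qed
  define G where "G y = indicator H y * W y" for y
  define g where "g y = indicator H y * pderiv_dir b W y" for y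
  have gm: "g \<in> borel_measurable borel"
    using borel_measurable_continuous_on_indicator[OF _ continuous_on_subset[OF cD H\<Omega>]] oH
    by (simp add: g_def[abs_def])
  have "integrable lborel (\<lambda>y. indicator H y *\<^sub>R (indicator K y *\<^sub>R W y))"
    by (intro integrable_mult_indicator borel_integrable_compact cK continuous_on_subset[OF cW K\<Omega>]) (use oH in simp)
  moreover have "indicator H y *\<^sub>R (indicator K y *\<^sub>R W y) = G y" for y
    using supp[of y] by (auto simp: G_def K_def H_def indicator_def)
  ultimately have Gi: "integrable lborel G" by simp
  have Lip: "\<bar>G (y + s *\<^sub>R b) - G y\<bar> \<le> C * s" if s: "s \<ge> 0" for y s
  proof (cases "y \<in> H")
    case True
    then have "y + s *\<^sub>R b \<in> H" using s sb(2) by (auto simp: H_def intro: add_pos_nonneg)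
    then show ?thesis using seg[of y s] s True by (simp add: G_def H_def)
  next
    case False
    show ?thesis
    proof (cases "y + s *\<^sub>R b \<in> H")
      case T: True
      \<comment> \<open>The segment enters the half-space, so the estimate starts where it crosses the boundary.\<close>
      have bv: "b = (0, 1)" using sb(1) T False by (auto simp: H_def)
      let ?y0 = "(fst y, 0)" and ?s = "snd y + s"
      have "\<not> snd b = 0" using bv by simp
      then have W0: "W ?y0 = 0" using bdry by simp
      have eq: "y + s *\<^sub>R b = ?y0 + ?s *\<^sub>R b" using bv by (simp add: prod_eq_iff)
      have sp: "?s > 0" "snd y \<le> 0" using T False bv by (auto simp: H_def)
      have "\<bar>W (y + s *\<^sub>R b) - 0\<bar> \<le> C * ?s" unfolding eq using seg[of ?y0 ?s] sp W0 by simp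
      also have "\<dots> \<le> C * s" using sp C0 by (intro mult_left_mono) auto
      finally show ?thesis using T False by (simp add: G_def)
    qed (use False s C0 in \<open>simp add: G_def\<close>)
  qed
  have AE0: "AE y in lborel. snd (y::'a \<times> real) \<noteq> 0"
  proof -
    let ?N = "{y::'a \<times> real. (0, 1) \<bullet> y = 0}"
    have "negligible ?N" by (rule negligible_hyperplane) (simp add: prod_eq_iff)
    moreover have "?N \<in> sets lborel" by (simp add: closed_hyperplane)
    ultimately have "?N \<in> null_sets lborel"
      by (simp add: negligible_iff_null_sets null_sets_completion_iff)
    from AE_not_in[OF this] show ?thesis by (simp add: inner_prod_def)
  qed
  have lim: "AE y in lborel. ((\<lambda>s. (G (y + s *\<^sub>R b) - G y) / s) \<longlongrightarrow> g y) (at_right 0)"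
    using AE0
  proof eventually_elim
    fix y :: "'a \<times> real" assume y: "snd y \<noteq> 0"
    show "((\<lambda>s. (G (y + s *\<^sub>R b) - G y) / s) \<longlongrightarrow> g y) (at_right 0)"
    proof (cases "y \<in> H")
      case True
      have "((\<lambda>\<tau>. W (y + \<tau> *\<^sub>R b)) has_field_derivative pderiv_dir b W y) (at 0)"
        using dline[of y 0] True H\<Omega> by auto
      then have "((\<lambda>s. (W (y + s *\<^sub>R b) - W y) / s) \<longlongrightarrow> pderiv_dir b W y) (at 0)"
        by (simp add: has_field_derivative_iff)
      then have "((\<lambda>s. (W (y + s *\<^sub>R b) - W y) / s) \<longlongrightarrow> g y) (at_right 0)"
        using True by (simp add: g_def filterlim_at_split)
      then show ?thesis
      proof (rule Lim_transform_eventually)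
        show "\<forall>\<^sub>F s in at_right 0. (W (y + s *\<^sub>R b) - W y) / s = (G (y + s *\<^sub>R b) - G y) / s"
          using eventually_at_right_less[of 0]
        proof eventually_elim
          fix s :: real assume "0 < s"
          then have "y + s *\<^sub>R b \<in> H" using sb(2) True by (auto simp: H_def intro: add_pos_nonneg)
          then show "(W (y + s *\<^sub>R b) - W y) / s = (G (y + s *\<^sub>R b) - G y) / s"
            using True by (simp add: G_def)
        qed
      qed
    next
      case False
      then have neg: "snd y < 0" using y by (auto simp: H_def)
      have "\<forall>\<^sub>F s in at_right 0. s < - snd y"
        using neg by (intro eventually_at_rightI[of 0 "- snd y"]) auto
      then have "\<forall>\<^sub>F s in at_right 0. 0 = (G (y + s *\<^sub>R b) - G y) / s"
        using eventually_at_right_less[of 0]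
      proof eventually_elim
        fix s :: real assume "s < - snd y" "0 < s"
        then have "y + s *\<^sub>R b \<notin> H" using sb(1) neg by (auto simp: H_def)
        then show "0 = (G (y + s *\<^sub>R b) - G y) / s" using False by (simp add: G_def)
      qed
      then show ?thesis using False by (auto simp: g_def intro: Lim_transform_eventually)
    qed
  qed
  have "integrable lborel g" "integral\<^sup>L lborel g = 0"
    using integral_difference_quotient_limit[OF Gi gm _ Lip lim, of R] supp by (auto simp: G_def)
  then show "integrable lborel (\<lambda>y. indicator {y. snd y > 0} y * pderiv_dir b W y)"
    "(\<integral>y. indicator {y. snd y > 0} y * pderiv_dir b W y \<partial>lborel) = 0"
    by (simp_all add: g_def[abs_def] H_def)
qed

section \<open>Polynomials in several variables\<close>

lemma real_fun_span_zero: "(\<lambda>x. 0) \<in> real_fun.span S"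
  using real_fun.span_zero[of S] by (simp add: zero_fun_def)

lemma real_fun_span_add: "p \<in> real_fun.span S \<Longrightarrow> q \<in> real_fun.span S \<Longrightarrow> (\<lambda>x. p x + q x) \<in> real_fun.span S"
  using real_fun.span_add[of p S q] by (simp add: plus_fun_def)

lemma real_fun_span_scale: "p \<in> real_fun.span S \<Longrightarrow> (\<lambda>x. c * p x) \<in> real_fun.span S"
  by (rule real_fun.span_scale)

lemma real_fun_span_sum:
  assumes "\<And>i. i \<in> I \<Longrightarrow> p i \<in> real_fun.span S"
  shows "(\<lambda>x. \<Sum>i\<in>I. p i x) \<in> real_fun.span S"
  using assms by (induction I rule: infinite_finite_induct) (auto intro: real_fun_span_zero real_fun_span_add)

text \<open>
  Sums and multiples of functions appear pointwise here, the form in which the rules of calculus apply.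
\<close>

lemma real_fun_span_induct [consumes 1, case_names zero step]:
  assumes "p \<in> real_fun.span S" "P (\<lambda>x. 0)"
    and "\<And>c s q. s \<in> S \<Longrightarrow> q \<in> real_fun.span S \<Longrightarrow> P q \<Longrightarrow> P (\<lambda>x. c * s x + q x)"
  shows "P p"
proof -
  from assms(1) have "p \<in> real_fun.span S \<and> P p"
  proof (induction rule: real_fun.span_induct_alt)
    case base
    then show ?case using assms(2) by (simp add: zero_fun_def real_fun_span_zero)
  next
    case (step c s q)
    then have "(\<lambda>x. c * s x + q x) \<in> real_fun.span S" "P (\<lambda>x. c * s x + q x)"
      using assms(3) by (auto intro!: real_fun_span_add real_fun_span_scale intro: real_fun.span_base)
    then show ?case by (simp add: plus_fun_def)
  qed
  then show ?thesis by simp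
qed

definition mdeg :: "('n::finite \<Rightarrow> nat) \<Rightarrow> nat" where
  "mdeg \<alpha> = (\<Sum>i\<in>UNIV. \<alpha> i)"

definition monomial :: "('n::finite \<Rightarrow> nat) \<Rightarrow> real ^ 'n \<Rightarrow> real" where
  "monomial \<alpha> x = (\<Prod>i\<in>UNIV. x $ i ^ \<alpha> i)"

text \<open>
  Listing the index type turns multi-indices of a given degree into lists of naturals with a given
  sum, which are counted by stars and bars.
\<close>

lemma bij_betw_multi_index_list:
  fixes xs :: "'n::finite list"
  assumes "distinct xs" "set xs = UNIV"
  shows "bij_betw (\<lambda>\<alpha>. map \<alpha> xs) {\<alpha>. mdeg \<alpha> = m} {l. length l = CARD('n) \<and> sum_list l = m}"
proof (rule bij_betw_imageI)
  have len: "length xs = CARD('n)" using assms distinct_card by fastforce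
  have md: "mdeg \<alpha> = sum_list (map \<alpha> xs)" for \<alpha>
    unfolding mdeg_def using sum.distinct_set_conv_list[OF assms(1), of \<alpha>] assms(2) by simp
  show "inj_on (\<lambda>\<alpha>. map \<alpha> xs) {\<alpha>. mdeg \<alpha> = m}"
    using assms(2) by (auto simp: inj_on_def fun_eq_iff)
  show "(\<lambda>\<alpha>. map \<alpha> xs) ` {\<alpha>. mdeg \<alpha> = m} = {l. length l = CARD('n) \<and> sum_list l = m}"
  proof (intro equalityI subsetI)
    fix l assume l: "l \<in> {l. length l = CARD('n) \<and> sum_list l = m}"
    have "map (the \<circ> map_of (zip xs l)) xs = l"
      using l assms(1) len by (intro nth_equalityI) (auto simp: map_of_zip_nth)
    moreover from this have "mdeg (the \<circ> map_of (zip xs l)) = m" using l by (simp add: md)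
    ultimately show "l \<in> (\<lambda>\<alpha>. map \<alpha> xs) ` {\<alpha>. mdeg \<alpha> = m}" by (metis (mono_tags, lifting) imageI mem_Collect_eq)
  qed (use len md in auto)
qed

lemma card_multi_index_eq:
  "card {\<alpha>::'n::finite \<Rightarrow> nat. mdeg \<alpha> = m} = (m + CARD('n) - 1) choose m"
proof -
  obtain xs :: "'n list" where "distinct xs" "set xs = UNIV"
    using finite_distinct_list[of "UNIV :: 'n set"] by auto
  from bij_betw_same_card[OF bij_betw_multi_index_list[OF this, of m]]
  show ?thesis by (simp add: card_length_sum_list)
qed

lemma finite_multi_index_le: "finite {\<alpha>::'n::finite \<Rightarrow> nat. mdeg \<alpha> \<le> m}"
proof (rule finite_subset)
  show "{\<alpha>::'n \<Rightarrow> nat. mdeg \<alpha> \<le> m} \<subseteq> PiE UNIV (\<lambda>_. {..m})"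
  proof
    fix \<alpha> :: "'n \<Rightarrow> nat" assume "\<alpha> \<in> {\<alpha>. mdeg \<alpha> \<le> m}"
    then show "\<alpha> \<in> PiE UNIV (\<lambda>_. {..m})"
      using member_le_sum[of _ UNIV \<alpha>] by (auto simp: mdeg_def intro: order_trans)
  qed
  show "finite (PiE (UNIV::'n set) (\<lambda>_. {..m}))" by (intro finite_PiE) auto
qed

lemma finite_multi_index_eq: "finite {\<alpha>::'n::finite \<Rightarrow> nat. mdeg \<alpha> = m}"
  by (rule finite_subset[OF _ finite_multi_index_le[of m]]) auto

lemma sum_card_multi_index:
  "(\<Sum>l\<le>m. card {\<alpha>::'n::finite \<Rightarrow> nat. mdeg \<alpha> = l}) = (m + CARD('n)) choose CARD('n)"
proof -
  define r where "r = CARD('n) - 1"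
  have r: "CARD('n) = Suc r" by (simp add: r_def)
  have "(\<Sum>l\<le>m. card {\<alpha>::'n \<Rightarrow> nat. mdeg \<alpha> = l}) = (\<Sum>l\<le>m. (r + l) choose l)"
    by (simp add: card_multi_index_eq r add.commute)
  also have "\<dots> = Suc (r + m) choose m" by (rule sum_choose_lower)
  also have "\<dots> = (m + CARD('n)) choose m" by (simp add: r add.commute)
  also have "\<dots> = (m + CARD('n)) choose CARD('n)"
    using binomial_symmetric[of m "m + CARD('n)"] by simp
  finally show ?thesis .
qed

text \<open>
  Induction on the set \<open>A\<close> of variables: with the others fixed, the sum is a polynomial in the new
  variable \<open>x j\<close>, so its coefficients vanish, and these are sums of the same kind over \<open>A\<close>.
  Injectivity of the restriction to \<open>A\<close> says that distinct exponents stay distinct as monomials in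
  these variables.
\<close>

lemma monomials_independent_aux:
  fixes B :: "('n \<Rightarrow> nat) set" and c :: "('n \<Rightarrow> nat) \<Rightarrow> real"
  assumes "finite A" "finite B" "inj_on (\<lambda>\<beta>. restrict \<beta> A) B"
    and "\<And>x::'n \<Rightarrow> real. (\<Sum>\<beta>\<in>B. c \<beta> * (\<Prod>i\<in>A. x i ^ \<beta> i)) = 0"
  shows "\<forall>\<beta>\<in>B. c \<beta> = 0"
  using assms
proof (induction A arbitrary: B rule: finite_induct)
  case empty
  show ?case
  proof
    fix \<beta> assume \<beta>: "\<beta> \<in> B"
    have "B = {\<beta>}" using empty(2) \<beta> by (auto simp: inj_on_def)
    then show "c \<beta> = 0" using empty(3) by simp
  qed
next
  case (insert j A)
  define M where "M = Max ((\<lambda>\<beta>. \<beta> j) ` B)"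
  have coeff: "(\<Sum>\<beta>\<in>{\<beta>\<in>B. \<beta> j = k}. c \<beta> * (\<Prod>i\<in>A. x i ^ \<beta> i)) = 0" if "k \<le> M" for x k
  proof -
    have "(\<Sum>k\<le>M. (\<Sum>\<beta>\<in>{\<beta>\<in>B. \<beta> j = k}. c \<beta> * (\<Prod>i\<in>A. x i ^ \<beta> i)) * s ^ k) = 0" for s
    proof -
      have "(\<Sum>k\<le>M. (\<Sum>\<beta>\<in>{\<beta>\<in>B. \<beta> j = k}. c \<beta> * (\<Prod>i\<in>A. x i ^ \<beta> i)) * s ^ k)
          = (\<Sum>k\<le>M. \<Sum>\<beta>\<in>{\<beta>\<in>B. \<beta> j = k}. c \<beta> * (\<Prod>i\<in>A. x i ^ \<beta> i) * s ^ \<beta> j)"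
        by (simp add: sum_distrib_right)
      also have "\<dots> = (\<Sum>\<beta>\<in>B. c \<beta> * (\<Prod>i\<in>A. x i ^ \<beta> i) * s ^ \<beta> j)"
        by (rule sum.group) (use insert.prems(1) in \<open>auto simp: M_def\<close>)
      also have "\<dots> = (\<Sum>\<beta>\<in>B. c \<beta> * (\<Prod>i\<in>insert j A. (x(j := s)) i ^ \<beta> i))"
      proof (rule sum.cong[OF refl])
        fix \<beta>
        have "(\<Prod>i\<in>A. (x(j := s)) i ^ \<beta> i) = (\<Prod>i\<in>A. x i ^ \<beta> i)"
          using insert.hyps by (intro prod.cong) auto
        then show "c \<beta> * (\<Prod>i\<in>A. x i ^ \<beta> i) * s ^ \<beta> j = c \<beta> * (\<Prod>i\<in>insert j A. (x(j := s)) i ^ \<beta> i)"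
          using insert.hyps by simp
      qed
      also have "\<dots> = 0" by (rule insert.prems(3))
      finally show ?thesis .
    qed
    then show ?thesis
      by (rule zero_polynom_imp_zero_coeffs[where c = "\<lambda>k. \<Sum>\<beta>\<in>{\<beta>\<in>B. \<beta> j = k}. c \<beta> * (\<Prod>i\<in>A. x i ^ \<beta> i)"])
        (rule that)
  qed
  show ?case
  proof
    fix \<beta> assume \<beta>: "\<beta> \<in> B"
    have "\<forall>\<gamma>\<in>{\<gamma>\<in>B. \<gamma> j = \<beta> j}. c \<gamma> = 0"
    proof (rule insert.IH)
      show "inj_on (\<lambda>\<beta>. restrict \<beta> A) {\<gamma> \<in> B. \<gamma> j = \<beta> j}"
      proof (rule inj_onI)
        fix \<gamma> \<delta> assume a: "\<gamma> \<in> {\<gamma> \<in> B. \<gamma> j = \<beta> j}" "\<delta> \<in> {\<gamma> \<in> B. \<gamma> j = \<beta> j}" "restrict \<gamma> A = restrict \<delta> A"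
        have "restrict \<gamma> (insert j A) = restrict \<delta> (insert j A)"
          using a by (auto simp: restrict_def fun_eq_iff split: if_splits)
        then show "\<gamma> = \<delta>" by (rule inj_onD[OF insert.prems(2)]) (use a in auto)
      qed
      show "(\<Sum>\<beta>\<in>{\<gamma>\<in>B. \<gamma> j = \<beta> j}. c \<beta> * (\<Prod>i\<in>A. x i ^ \<beta> i)) = 0" for x
        by (rule coeff) (use \<beta> insert.prems(1) in \<open>simp add: M_def\<close>)
    qed (use insert.prems(1) in auto)
    then show "c \<beta> = 0" using \<beta> by simp
  qed
qed

lemma monomials_independent:
  fixes B :: "('n::finite \<Rightarrow> nat) set"
  assumes "finite B" "\<And>x. (\<Sum>\<beta>\<in>B. c \<beta> * monomial \<beta> x) = 0" "\<beta> \<in> B"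
  shows "c \<beta> = 0"
proof -
  have "(\<Sum>\<beta>\<in>B. c \<beta> * (\<Prod>i\<in>UNIV. x i ^ \<beta> i)) = 0" for x :: "'n \<Rightarrow> real"
    using assms(2)[of "\<chi> i. x i"] by (simp add: monomial_def)
  then have "\<forall>\<beta>\<in>B. c \<beta> = 0"
    using assms(1) by (intro monomials_independent_aux[of UNIV]) (auto simp: inj_on_def restrict_UNIV)
  with assms(3) show ?thesis by simp
qed

definition polys :: "nat \<Rightarrow> (real ^ 'n::finite \<Rightarrow> real) set" where
  "polys m = real_fun.span (monomial ` {\<beta>. mdeg \<beta> \<le> m})"

lemma polys_zero: "(\<lambda>x. 0) \<in> polys m"
  and polys_add: "p \<in> polys m \<Longrightarrow> q \<in> polys m \<Longrightarrow> (\<lambda>x. p x + q x) \<in> polys m"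
  and polys_scale: "p \<in> polys m \<Longrightarrow> (\<lambda>x. c * p x) \<in> polys m"
  and polys_sum: "(\<And>i. i \<in> I \<Longrightarrow> r i \<in> polys m) \<Longrightarrow> (\<lambda>x. \<Sum>i\<in>I. r i x) \<in> polys m"
  unfolding polys_def by (auto intro: real_fun_span_zero real_fun_span_add real_fun_span_scale real_fun_span_sum)

lemma monomial_in_polys: "mdeg \<beta> \<le> m \<Longrightarrow> monomial \<beta> \<in> polys m"
  unfolding polys_def by (auto intro: real_fun.span_base)

lemma polys_mono: "p \<in> polys m \<Longrightarrow> m \<le> k \<Longrightarrow> p \<in> polys k"
  unfolding polys_def by (erule subsetD[OF real_fun.span_mono, rotated]) auto

lemma polys_induct [consumes 1, case_names zero step]:
  assumes "p \<in> polys m" "P (\<lambda>x. 0)"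
    and "\<And>c \<beta> q. mdeg \<beta> \<le> m \<Longrightarrow> q \<in> polys m \<Longrightarrow> P q \<Longrightarrow> P (\<lambda>x. c * monomial \<beta> x + q x)"
  shows "P p"
  using assms(1) unfolding polys_def
  by (induction rule: real_fun_span_induct) (use assms(2,3) in \<open>auto simp: polys_def\<close>)

lemma monomial_mult: "monomial \<alpha> x * monomial \<beta> x = monomial (\<lambda>i. \<alpha> i + \<beta> i) x"
  by (simp add: monomial_def power_add prod.distrib)

lemma mdeg_add: "mdeg (\<lambda>i. \<alpha> i + \<beta> i) = mdeg \<alpha> + mdeg \<beta>"
  by (simp add: mdeg_def sum.distrib)

lemma polys_mult:
  assumes "p \<in> polys a" "q \<in> polys b"
  shows "(\<lambda>x. p x * q x) \<in> polys (a + b)"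
  using assms(1)
proof (induction rule: polys_induct)
  case zero
  then show ?case by (simp add: polys_zero)
next
  case (step c \<alpha> r)
  have "(\<lambda>x. monomial \<alpha> x * q x) \<in> polys (a + b)"
    using assms(2)
  proof (induction rule: polys_induct)
    case zero
    then show ?case by (simp add: polys_zero)
  next
    case (step d \<beta> s)
    have "monomial (\<lambda>i. \<alpha> i + \<beta> i) \<in> polys (a + b)"
      using step \<open>mdeg \<alpha> \<le> a\<close> by (intro monomial_in_polys) (simp add: mdeg_add)
    from polys_add[OF polys_scale[OF this, of d] step(3)] show ?case
      by (simp add: monomial_mult[symmetric] algebra_simps)
  qed
  from polys_add[OF polys_scale[OF this, of c] step(3)] show ?case
    by (simp add: algebra_simps)
qed

lemma monomial_0: "monomial (\<lambda>i. 0) x = 1"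
  by (simp add: monomial_def)

lemma monomial_mdeg_0:
  assumes "mdeg \<alpha> = 0"
  shows "monomial \<alpha> = (\<lambda>x. 1)"
  using assms by (simp add: monomial_def mdeg_def fun_eq_iff)

lemma mdeg_eq_0_iff: "mdeg \<alpha> = 0 \<longleftrightarrow> \<alpha> = (\<lambda>i. 0)"
  by (auto simp: mdeg_def fun_eq_iff)

lemma polys_const: "(\<lambda>x. c) \<in> polys m"
  using polys_scale[OF monomial_in_polys[of "\<lambda>i. 0" m], of c] by (simp add: monomial_0 mdeg_def)

lemma polys_0_const:
  assumes "p \<in> polys 0"
  shows "\<exists>c. p = (\<lambda>x. c)"
  using assms by (induction rule: polys_induct) (auto simp: mdeg_eq_0_iff monomial_0)

lemma monomial_single: "monomial (\<lambda>j. if j = i then 1 else 0) x = x $ i"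
proof -
  have "monomial (\<lambda>j. if j = i then 1 else 0) x = (\<Prod>j\<in>UNIV. if j = i then x $ j else 1)"
    unfolding monomial_def by (rule prod.cong) auto
  then show ?thesis by simp
qed

lemma polys_coord: "(\<lambda>x. x $ i) \<in> polys 1"
  using monomial_in_polys[of "\<lambda>j. if j = i then 1 else 0" 1] by (simp add: monomial_single[abs_def] mdeg_def)

lemma polys_power: "p \<in> polys a \<Longrightarrow> (\<lambda>x. p x ^ k) \<in> polys (a * k)"
proof (induction k)
  case (Suc k)
  then show ?case using polys_mult[of p a "\<lambda>x. p x ^ k" "a * k"] by simp
qed (simp add: polys_const)

text \<open>
  Splitting off one variable allows induction on the degree by the product rule.
\<close>

lemma monomial_Suc_cases:
  fixes \<alpha> :: "'n::finite \<Rightarrow> nat"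
  assumes "mdeg \<alpha> = Suc m"
  obtains i \<alpha>' where "mdeg \<alpha>' = m" "monomial \<alpha> = (\<lambda>x. x $ i * monomial \<alpha>' x)"
proof -
  from assms obtain i where i: "\<alpha> i > 0"
    by (metis gr0I mdeg_eq_0_iff nat.distinct(1) ext)
  define e where "e = (\<lambda>j. if j = i then 1 else 0 :: nat)"
  define \<alpha>' where "\<alpha>' = (\<lambda>j. \<alpha> j - e j)"
  have eq: "\<alpha> = (\<lambda>j. e j + \<alpha>' j)" using i by (auto simp: \<alpha>'_def e_def fun_eq_iff)
  have "monomial \<alpha> = (\<lambda>x. x $ i * monomial \<alpha>' x)"
    by (subst eq) (simp add: fun_eq_iff monomial_mult[symmetric] e_def monomial_single)
  moreover have "mdeg \<alpha>' = m" using assms arg_cong[OF eq, of mdeg]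
    by (simp add: mdeg_add) (simp add: mdeg_def e_def)
  ultimately show ?thesis using that by blast
qed

lemma Ck_on_monomial: "Ck_on k (monomial \<alpha>) UNIV"
proof (induction "mdeg \<alpha>" arbitrary: \<alpha>)
  case 0
  then have "monomial \<alpha> = (\<lambda>x. 1)" by (simp add: monomial_mdeg_0)
  then show ?case by (simp add: Ck_on_const)
next
  case (Suc m)
  from Suc(2) obtain i \<alpha>' where "mdeg \<alpha>' = m" "monomial \<alpha> = (\<lambda>x. x $ i * monomial \<alpha>' x)"
    by (metis monomial_Suc_cases)
  then show ?case using Suc(1)[of \<alpha>'] by (simp add: Ck_on_mult Ck_on_bounded_linear bounded_linear_vec_nth)
qed

lemma Ck_on_polys:
  assumes "p \<in> polys m"
  shows "Ck_on k p UNIV"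
  using assms by (induction rule: polys_induct) (auto intro!: Ck_on_const Ck_on_add Ck_on_mult Ck_on_monomial)

lemma polys_differentiable: "p \<in> polys m \<Longrightarrow> p differentiable (at x)"
  using Ck_on_polys[of p m 1] Ck_on_imp_differentiable[of 0 p UNIV x] by simp

lemma pderiv_dir_monomial_in_polys:
  fixes \<alpha> :: "'n::finite \<Rightarrow> nat"
  shows "pderiv_dir b (monomial \<alpha>) \<in> polys (mdeg \<alpha> - 1)"
proof (induction "mdeg \<alpha>" arbitrary: \<alpha>)
  case 0
  then have "pderiv_dir b (monomial \<alpha>) = (\<lambda>x. 0)" by (simp add: monomial_mdeg_0 fun_eq_iff)
  then show ?case by (simp add: polys_zero)
next
  case (Suc m)
  from Suc(2) obtain i \<alpha>' where a: "mdeg \<alpha>' = m" "monomial \<alpha> = (\<lambda>x. x $ i * monomial \<alpha>' x)"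
    by (metis monomial_Suc_cases)
  have "pderiv_dir b (monomial \<alpha>) x = x $ i * pderiv_dir b (monomial \<alpha>') x + b $ i * monomial \<alpha>' x" for x
  proof -
    have l: "bounded_linear (\<lambda>x::real^'n. x $ i)" by (rule bounded_linear_vec_nth)
    show ?thesis unfolding a(2)
      using pderiv_dir_eqI[OF bounded_linear_imp_has_derivative[OF l], of b x]
      by (subst pderiv_dir_mult) (auto intro: bounded_linear_imp_differentiable l
         polys_differentiable[OF monomial_in_polys[OF order_refl]])
  qed
  moreover have "(\<lambda>x. x $ i * pderiv_dir b (monomial \<alpha>') x) \<in> polys m"
  proof (cases m)
    case 0
    then have "pderiv_dir b (monomial \<alpha>') = (\<lambda>x. 0)" using a by (simp add: monomial_mdeg_0 fun_eq_iff)
    then show ?thesis by (simp add: polys_zero)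
  next
    case (Suc m')
    then show ?thesis using polys_mult[OF polys_coord Suc.hyps(1)[of \<alpha>']] a by simp
  qed
  moreover have "(\<lambda>x. b $ i * monomial \<alpha>' x) \<in> polys m"
    using a by (intro polys_scale monomial_in_polys) simp
  ultimately have "(\<lambda>x. pderiv_dir b (monomial \<alpha>) x) \<in> polys m"
    by (simp add: polys_add)
  then show ?case using Suc(2) by (metis diff_Suc_1)
qed

lemma polys_pderiv_dir:
  assumes "p \<in> polys m"
  shows "pderiv_dir b p \<in> polys (m - 1)"
  using assms
proof (induction rule: polys_induct)
  case zero
  have "pderiv_dir b (\<lambda>x. 0) = (\<lambda>x. 0)" by (simp add: fun_eq_iff)
  then show ?case by (simp add: polys_zero)
next
  case (step c \<beta> q)
  have dm: "monomial \<beta> differentiable (at x)" for x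
    by (rule polys_differentiable[OF monomial_in_polys[OF order_refl]])
  have "pderiv_dir b (\<lambda>x. c * monomial \<beta> x + q x) = (\<lambda>x. c * pderiv_dir b (monomial \<beta>) x + pderiv_dir b q x)"
    by (rule ext) (simp add: pderiv_dir_add pderiv_dir_cmult dm polys_differentiable[OF step(2)] differentiable_mult)
  moreover have "pderiv_dir b (monomial \<beta>) \<in> polys (m - 1)"
    using pderiv_dir_monomial_in_polys[of b \<beta>] step(1) by (elim polys_mono) auto
  ultimately show ?case using step(3) by (auto intro: polys_add polys_scale)
qed

lemma polys_laplacian:
  assumes "p \<in> polys m"
  shows "laplacian p \<in> polys (m - 2)"
proof -
  have "pderiv_dir b (pderiv_dir b p) \<in> polys (m - 2)" for b
    using polys_pderiv_dir[OF polys_pderiv_dir[OF assms, of b], of b] by (simp add: numeral_2_eq_2)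
  then show ?thesis using polys_sum[of Basis "\<lambda>b. pderiv_dir b (pderiv_dir b p)" "m - 2"]
    by (simp add: laplacian_def[abs_def])
qed

lemma real_polynomial_function_in_polys:
  fixes p :: "real ^ 'n::finite \<Rightarrow> real"
  assumes "real_polynomial_function p"
  shows "\<exists>m. p \<in> polys m"
  using assms
proof (induction rule: real_polynomial_function.induct)
  case (linear f)
  have "f x = (\<Sum>i\<in>UNIV. f (axis i 1) * x $ i)" for x
  proof -
    interpret linear f using linear by (rule bounded_linear.linear)
    have "f x = f (\<Sum>i\<in>UNIV. x $ i *\<^sub>R axis i 1)" using basis_expansion[of x] by (simp add: scalar_mult_eq_scaleR)
    then show ?thesis by (simp add: sum scale mult.commute)
  qed
  moreover have "(\<lambda>x::real^'n. \<Sum>i\<in>UNIV. f (axis i 1) * x $ i) \<in> polys 1"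
    by (intro polys_sum polys_scale polys_coord)
  ultimately show ?case by (metis (no_types, lifting) ext)
next
  case (const c)
  then show ?case using polys_const by blast
next
  case (add f g)
  then obtain a b where "f \<in> polys a" "g \<in> polys b" by auto
  then have "f \<in> polys (max a b)" "g \<in> polys (max a b)" by (auto elim: polys_mono)
  then show ?case using polys_add by blast
next
  case (mult f g)
  then show ?case using polys_mult by blast
qed

lemma monomial_scale: "monomial \<alpha> (c *\<^sub>R x) = c ^ mdeg \<alpha> * monomial \<alpha> x"
  by (simp add: monomial_def mdeg_def power_mult_distrib prod.distrib flip: power_sum)

section \<open>Even harmonic extensions of monomials\<close>

lemma pderiv_dir_scaleR_arg:
  fixes f :: "'a::euclidean_space \<Rightarrow> real"
  assumes "f differentiable (at (c *\<^sub>R x))"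
  shows "pderiv_dir b (\<lambda>x. f (c *\<^sub>R x)) x = c * pderiv_dir b f (c *\<^sub>R x)"
proof -
  have "((\<lambda>x. c *\<^sub>R x) has_derivative (\<lambda>h. c *\<^sub>R h)) (at x)" by (auto intro!: derivative_eq_intros)
  from has_derivative_compose[OF this] assms
  have "((\<lambda>x. f (c *\<^sub>R x)) has_derivative (\<lambda>h. frechet_derivative f (at (c *\<^sub>R x)) (c *\<^sub>R h))) (at x)"
    by (simp add: frechet_derivative_works)
  from pderiv_dir_eqI[OF this] show ?thesis
    using linear_cmul[OF linear_frechet_derivative[OF assms]] by (simp add: pderiv_dir_def)
qed

text \<open>
  A homogeneity law \<open>p (c x) = c\<^sup>l p x\<close>, written without negative exponents as
  \<open>p (c x) * a = e * p x\<close>, passes to derivatives with \<open>a\<close> replaced by \<open>a c\<close>.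
\<close>

lemma pderiv_dir_scaling:
  fixes p :: "'a::euclidean_space \<Rightarrow> real"
  assumes "\<And>x. p differentiable (at x)" "\<And>x. p (c *\<^sub>R x) * a = e * p x"
  shows "pderiv_dir b p (c *\<^sub>R x) * (a * c) = e * pderiv_dir b p x"
proof -
  have eq: "(\<lambda>x. a * p (c *\<^sub>R x)) = (\<lambda>x. e * p x)" using assms(2) by (simp add: mult.commute)
  have "(\<lambda>x. p (c *\<^sub>R x)) differentiable (at x)"
    using differentiable_compose[of p "\<lambda>x. c *\<^sub>R x" x UNIV] assms(1) by simp
  then have "pderiv_dir b (\<lambda>x. a * p (c *\<^sub>R x)) x = a * (c * pderiv_dir b p (c *\<^sub>R x))"
    by (simp add: pderiv_dir_cmult pderiv_dir_scaleR_arg assms(1))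
  moreover have "pderiv_dir b (\<lambda>x. e * p x) x = e * pderiv_dir b p x"
    by (simp add: pderiv_dir_cmult assms(1))
  ultimately show ?thesis by (simp add: eq mult_ac)
qed

lemma laplacian_polys_scaling:
  assumes p: "p \<in> polys m" and "\<And>x. p (c *\<^sub>R x) * a = e * p x"
  shows "laplacian p (c *\<^sub>R x) * (a * c\<^sup>2) = e * laplacian p x"
proof -
  have "pderiv_dir b (pderiv_dir b p) (c *\<^sub>R x) * ((a * c) * c) = e * pderiv_dir b (pderiv_dir b p) x" for b
    by (intro pderiv_dir_scaling polys_differentiable[OF p] polys_differentiable[OF polys_pderiv_dir[OF p]] assms(2))
  then show ?thesis
    by (simp add: laplacian_def sum_distrib_left sum_distrib_right power2_eq_square mult.assoc)
qed

definition lapl_iter :: "('n::finite \<Rightarrow> nat) \<Rightarrow> nat \<Rightarrow> real ^ 'n \<Rightarrow> real" where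
  "lapl_iter \<alpha> k = (laplacian ^^ k) (monomial \<alpha>)"

lemma lapl_iter_0: "lapl_iter \<alpha> 0 = monomial \<alpha>"
  and lapl_iter_Suc: "lapl_iter \<alpha> (Suc k) = laplacian (lapl_iter \<alpha> k)"
  by (simp_all add: lapl_iter_def)

lemma lapl_iter_in_polys: "lapl_iter \<alpha> k \<in> polys (mdeg \<alpha> - 2 * k)"
proof (induction k)
  case (Suc k)
  from polys_laplacian[OF this] show ?case by (simp add: lapl_iter_Suc)
qed (simp add: lapl_iter_0 monomial_in_polys)

lemma lapl_iter_scaling: "lapl_iter \<alpha> k (c *\<^sub>R x) * c ^ (2 * k) = c ^ mdeg \<alpha> * lapl_iter \<alpha> k x"
proof (induction k arbitrary: x)
  case (Suc k)
  from laplacian_polys_scaling[OF lapl_iter_in_polys Suc] show ?case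
    by (simp add: lapl_iter_Suc power2_eq_square mult_ac)
qed (simp add: lapl_iter_0 monomial_scale)

text \<open>
  Beyond half the degree the iterated Laplacian is a constant that scales with a nonzero power.
\<close>

lemma lapl_iter_eq_0:
  assumes "mdeg \<alpha> < 2 * k"
  shows "lapl_iter \<alpha> k = (\<lambda>x. 0)"
proof -
  have "lapl_iter \<alpha> k \<in> polys 0" using lapl_iter_in_polys[of \<alpha> k] assms by simp
  then obtain C where C: "lapl_iter \<alpha> k = (\<lambda>x. C)" using polys_0_const by blast
  have "C * 2 ^ (2 * k) = 2 ^ mdeg \<alpha> * C" using lapl_iter_scaling[of \<alpha> k 2] C by simp
  moreover have "(2::real) ^ mdeg \<alpha> \<noteq> 2 ^ (2 * k)" using assms by simp
  ultimately have "C = 0" by (metis mult.commute mult_cancel_left)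
  with C show ?thesis by simp
qed

text \<open>
  The solution of \<open>\<Delta> h = 0\<close>, \<open>h = x\<^sup>\<alpha>\<close> and \<open>\<partial>\<^sub>t h = 0\<close> on \<open>t = 0\<close>, as the power series
  \<open>cos (t sqrt \<Delta>) x\<^sup>\<alpha>\<close>. Its terms with \<open>2 k > \<bar>\<alpha>\<bar>\<close> vanish,
  so this is the whole series.
\<close>

definition harm_ext :: "('n::finite \<Rightarrow> nat) \<Rightarrow> (real ^ 'n) \<times> real \<Rightarrow> real" where
  "harm_ext \<alpha> y = (\<Sum>k\<le>mdeg \<alpha>. (- 1) ^ k / fact (2 * k) * (snd y ^ (2 * k) * lapl_iter \<alpha> k (fst y)))"

lemma Ck_on_snd_power_times_polys:
  assumes "q \<in> polys m"
  shows "Ck_on k (\<lambda>y::(real ^ 'n) \<times> real. snd y ^ j * q (fst y)) UNIV"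
proof (intro Ck_on_mult Ck_on_power open_UNIV)
  show "Ck_on k (\<lambda>y::(real ^ 'n) \<times> real. snd y) UNIV"
    by (rule Ck_on_bounded_linear[OF bounded_linear_snd])
  show "Ck_on k (\<lambda>y::(real ^ 'n) \<times> real. q (fst y)) UNIV"
  proof (rule Ck_on_compose[of UNIV UNIV fst])
    show "Ck_on k (\<lambda>x::(real ^ 'n) \<times> real. fst x \<bullet> c) UNIV" for c
      by (intro Ck_on_bounded_linear bounded_linear_compose[OF bounded_linear_inner_left bounded_linear_fst])
  qed (auto intro: Ck_on_polys[OF assms])
qed

lemma Ck_on_harm_ext: "Ck_on k (harm_ext \<alpha>) UNIV"
  unfolding harm_ext_def[abs_def]
  by (intro Ck_on_sum open_UNIV Ck_on_mult[OF _ Ck_on_const Ck_on_snd_power_times_polys[OF lapl_iter_in_polys]])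

lemma harm_ext_scale: "harm_ext \<alpha> (c *\<^sub>R y) = c ^ mdeg \<alpha> * harm_ext \<alpha> y"
proof -
  have "(c * s) ^ (2 * k) * lapl_iter \<alpha> k (c *\<^sub>R x) = c ^ mdeg \<alpha> * (s ^ (2 * k) * lapl_iter \<alpha> k x)" for s k x
    using lapl_iter_scaling[of \<alpha> k c x] by (simp add: power_mult_distrib mult_ac)
  then show ?thesis
    unfolding harm_ext_def sum_distrib_left
    by (intro sum.cong refl) (simp only: fst_scaleR snd_scaleR real_scaleR_def mult.left_commute)
qed

lemma harm_ext_equator: "harm_ext \<alpha> (x, 0) = monomial \<alpha> x"
proof -
  have "harm_ext \<alpha> (x, 0) = (\<Sum>k\<le>mdeg \<alpha>. if k = 0 then monomial \<alpha> x else 0)"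
    unfolding harm_ext_def by (intro sum.cong) (auto simp: lapl_iter_0 zero_power)
  then show ?thesis by simp
qed

lemma pderiv_dir_snd_power_times:
  assumes q: "q differentiable (at (fst y))"
  shows "pderiv_dir (v, c) (\<lambda>y. snd y ^ j * q (fst y)) y
    = snd y ^ j * pderiv_dir v q (fst y) + c * (real j * snd y ^ (j - 1) * q (fst y))"
proof -
  have 1: "((\<lambda>y. q (fst y)) has_derivative (\<lambda>h. frechet_derivative q (at (fst y)) (fst h))) (at y)"
    using has_derivative_compose[OF has_derivative_fst[OF has_derivative_ident], of q _ y UNIV] q
    by (simp add: frechet_derivative_works)
  have 2: "((\<lambda>y. snd y ^ j) has_derivative (\<lambda>h. real j * snd h * snd y ^ (j - 1))) (at y)"
    by (auto intro!: derivative_eq_intros)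
  from pderiv_dir_eqI[OF has_derivative_mult[OF 2 1], of "(v, c)"] show ?thesis
    by (simp add: pderiv_dir_def algebra_simps)
qed

text \<open>
  Truncated subtraction is harmless: the factor \<open>j (j - 1)\<close> is \<open>0\<close> when \<open>j < 2\<close>.
\<close>

lemma laplacian_snd_power_times:
  fixes q :: "real ^ 'n::finite \<Rightarrow> real"
  assumes q: "q \<in> polys m"
  shows "laplacian (\<lambda>y. snd y ^ j * q (fst y)) y
    = snd y ^ j * laplacian q (fst y) + real j * real (j - 1) * snd y ^ (j - 2) * q (fst y)"
proof -
  have d: "q differentiable (at x)" "pderiv_dir b q differentiable (at x)" for x b
    using polys_differentiable[OF q] polys_differentiable[OF polys_pderiv_dir[OF q]] by auto
  have h1: "pderiv_dir (b, 0) (\<lambda>y. snd y ^ j * q (fst y)) = (\<lambda>y. snd y ^ j * pderiv_dir b q (fst y))" for b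
    by (rule ext) (simp add: pderiv_dir_snd_power_times d)
  have h2: "pderiv_dir (b, 0) (\<lambda>y. snd y ^ j * pderiv_dir b q (fst y)) y
      = snd y ^ j * pderiv_dir b (pderiv_dir b q) (fst y)" for b
    by (simp add: pderiv_dir_snd_power_times d)
  have z: "pderiv_dir 0 q x = 0" for x
    using linear_0[OF linear_frechet_derivative[OF d(1)]] by (simp add: pderiv_dir_def)
  have v1: "pderiv_dir (0, 1) (\<lambda>y. snd y ^ j * q (fst y)) = (\<lambda>y. real j * (snd y ^ (j - 1) * q (fst y)))"
    by (rule ext) (simp add: pderiv_dir_snd_power_times d z)
  have dd: "(\<lambda>y. snd y ^ (j - 1) * q (fst y)) differentiable (at y)"
    by (rule Ck_on_imp_differentiable[OF Ck_on_snd_power_times_polys[OF q] open_UNIV UNIV_I])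
  have v2: "pderiv_dir (0, 1) (\<lambda>y. real j * (snd y ^ (j - 1) * q (fst y))) y
      = real j * (real (j - 1) * snd y ^ (j - 2) * q (fst y))"
    by (subst pderiv_dir_cmult[OF dd], subst pderiv_dir_snd_power_times[OF d(1)]) (simp add: z numeral_2_eq_2)
  have inj: "inj_on (\<lambda>u::real^'n. (u, 0::real)) Basis" by (auto intro: inj_onI)
  have "laplacian (\<lambda>y. snd y ^ j * q (fst y)) y
     = (\<Sum>b\<in>Basis. pderiv_dir (b, 0) (pderiv_dir (b, 0) (\<lambda>y. snd y ^ j * q (fst y))) y)
       + pderiv_dir (0, 1) (pderiv_dir (0, 1) (\<lambda>y. snd y ^ j * q (fst y))) y"
    unfolding laplacian_def Basis_prod_def
    by (subst sum.union_disjoint) (auto simp: sum.reindex[OF inj])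
  then show ?thesis
    unfolding h1 h2 v1 v2 by (simp add: laplacian_def sum_distrib_left)
qed

lemma laplacian_cmult_sum:
  assumes "\<And>i. i \<in> I \<Longrightarrow> Ck_on 2 (T i) UNIV" "finite I"
  shows "laplacian (\<lambda>y. \<Sum>i\<in>I. c i * T i y) y = (\<Sum>i\<in>I. c i * laplacian (T i) y)"
proof -
  have d: "T i differentiable (at y)" "\<And>b. b \<in> Basis \<Longrightarrow> pderiv_dir b (T i) differentiable (at y)" if "i \<in> I" for i y
    using assms(1)[OF that] by (auto simp: numeral_2_eq_2 differentiable_on_eq_differentiable_at)
  have e: "pderiv_dir b (\<lambda>y. \<Sum>i\<in>I. c i * T i y) = (\<lambda>y. \<Sum>i\<in>I. c i * pderiv_dir b (T i) y)" for b
  proof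
    fix y
    have "pderiv_dir b (\<lambda>y. \<Sum>i\<in>I. c i * T i y) y = (\<Sum>i\<in>I. pderiv_dir b (\<lambda>y. c i * T i y) y)"
      using assms(2) d by (intro pderiv_dir_sum) auto
    then show "pderiv_dir b (\<lambda>y. \<Sum>i\<in>I. c i * T i y) y = (\<Sum>i\<in>I. c i * pderiv_dir b (T i) y)"
      using d by (simp add: pderiv_dir_cmult)
  qed
  have "pderiv_dir b (pderiv_dir b (\<lambda>y. \<Sum>i\<in>I. c i * T i y)) y
      = (\<Sum>i\<in>I. c i * pderiv_dir b (pderiv_dir b (T i)) y)" if b: "b \<in> Basis" for b
  proof -
    have "pderiv_dir b (\<lambda>y. \<Sum>i\<in>I. c i * pderiv_dir b (T i) y) y = (\<Sum>i\<in>I. pderiv_dir b (\<lambda>y. c i * pderiv_dir b (T i) y) y)"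
      using assms(2) d(2)[OF _ b] by (intro pderiv_dir_sum) auto
    then show ?thesis using d(2)[OF _ b] by (simp add: pderiv_dir_cmult e)
  qed
  then show ?thesis
    unfolding laplacian_def by (simp add: sum_distrib_left sum.swap[of _ I])
qed

text \<open>
  The second \<open>t\<close>-derivative of each term cancels the \<open>x\<close>-Laplacian of the preceding term; the last
  term left over contains a power of \<open>\<Delta>\<close> that annihilates \<open>x\<^sup>\<alpha>\<close>.
\<close>

lemma harm_ext_harmonic: "laplacian (harm_ext \<alpha>) y = 0"
proof -
  define A where "A k = (- 1) ^ k / fact (2 * k) * (snd y ^ (2 * k) * lapl_iter \<alpha> (Suc k) (fst y))" for k
  define B where "B k = (- 1) ^ k / fact (2 * k) *
     (real (2 * k) * real (2 * k - 1) * snd y ^ (2 * k - 2) * lapl_iter \<alpha> k (fst y))" for k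
  have BS: "B (Suc k) = - A k" for k
  proof -
    have f: "fact (2 * Suc k) = (2 * real k + 2) * (2 * real k + 1) * (fact (2 * k) :: real)"
      by (simp add: fact_Suc algebra_simps)
    have n: "2 * real k + 2 \<noteq> 0" "2 * real k + 1 \<noteq> 0"
      using of_nat_0_le_iff[where 'a = real, of k] by linarith+
    have aux: "(- 1) ^ Suc k / (p * q * F) * (p * q * s * L) = - ((- 1) ^ k / F * (s * L))"
      if "p \<noteq> 0" "q \<noteq> 0" "F \<noteq> 0" for p q F s L :: real
      using that by (simp add: field_simps)
    have r: "real (2 * Suc k) = 2 * real k + 2" "real (2 * Suc k - 1) = 2 * real k + 1" "2 * Suc k - 2 = 2 * k" by auto
    show ?thesis
      unfolding A_def B_def f r by (rule aux[OF n fact_nonzero])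
  qed
  \<comment> \<open>The summands \<open>B (Suc k)\<close> and \<open>A k\<close> cancel, so the sum telescopes.\<close>
  have tele: "(\<Sum>k\<le>n. A k + B k) = A n" for n
    by (induction n) (auto simp: BS, simp add: B_def)
  have "laplacian (harm_ext \<alpha>) y
    = (\<Sum>k\<le>mdeg \<alpha>. (- 1) ^ k / fact (2 * k) * laplacian (\<lambda>y. snd y ^ (2 * k) * lapl_iter \<alpha> k (fst y)) y)"
    unfolding harm_ext_def[abs_def]
    by (intro laplacian_cmult_sum Ck_on_snd_power_times_polys[OF lapl_iter_in_polys] finite_atMost)
  also have "\<dots> = (\<Sum>k\<le>mdeg \<alpha>. A k + B k)"
    by (intro sum.cong refl)
      (subst laplacian_snd_power_times[OF lapl_iter_in_polys], simp add: A_def B_def lapl_iter_Suc distrib_left)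
  also have "\<dots> = 0" unfolding tele by (simp add: A_def lapl_iter_eq_0)
  finally show ?thesis .
qed

lemma harm_ext_normal_derivative: "pderiv_dir (0, 1) (harm_ext \<alpha>) (x, 0) = 0"
proof -
  have d: "(\<lambda>y. snd y ^ (2 * k) * lapl_iter \<alpha> k (fst y)) differentiable (at y)" for k y
    by (rule Ck_on_imp_differentiable[OF Ck_on_snd_power_times_polys[OF lapl_iter_in_polys] open_UNIV UNIV_I])
  have z: "pderiv_dir 0 (lapl_iter \<alpha> k) x = 0" for k
    using linear_0[OF linear_frechet_derivative[OF polys_differentiable[OF lapl_iter_in_polys]]]
    by (simp add: pderiv_dir_def)
  have "pderiv_dir (0, 1) (harm_ext \<alpha>) (x, 0)
    = (\<Sum>k\<le>mdeg \<alpha>. (- 1) ^ k / fact (2 * k) * pderiv_dir (0, 1) (\<lambda>y. snd y ^ (2 * k) * lapl_iter \<alpha> k (fst y)) (x, 0))"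
    unfolding harm_ext_def[abs_def]
    by (subst pderiv_dir_sum) (simp_all only: pderiv_dir_cmult[OF d] finite_atMost, intro differentiable_mult differentiable_const d)
  also have "\<dots> = 0"
  proof (intro sum.neutral ballI)
    fix k
    have "real (2 * k) * (0::real) ^ (2 * k - 1) = 0" by (cases k) auto
    then show "(- 1) ^ k / fact (2 * k) * pderiv_dir (0, 1) (\<lambda>y. snd y ^ (2 * k) * lapl_iter \<alpha> k (fst y)) (x, 0) = 0"
      by (subst pderiv_dir_snd_power_times)
        (auto simp: z polys_differentiable[OF lapl_iter_in_polys] simp del: of_nat_mult)
  qed
  finally show ?thesis .
qed

lemma norm_sq_in_polys: "(\<lambda>x::real ^ 'n::finite. (norm x)\<^sup>2) \<in> polys 2"
proof -
  have "(norm x)\<^sup>2 = (\<Sum>i\<in>UNIV. (x $ i) ^ 2)" for x :: "real ^ 'n"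
    by (simp add: norm_vec_def L2_set_def sum_nonneg)
  moreover have "(\<lambda>x::real^'n. \<Sum>i\<in>UNIV. (x $ i) ^ 2) \<in> polys 2"
    using polys_power[OF polys_coord, of _ 2] by (intro polys_sum) simp
  ultimately show ?thesis by simp
qed

text \<open>
  On the sphere \<open>t\<^sup>2 = 1 - \<bar>x\<bar>\<^sup>2\<close>, and replacing \<open>t\<^sup>2\<close> in this way does not raise the degree.
\<close>

lemma harm_ext_sphere:
  fixes \<alpha> :: "'n::finite \<Rightarrow> nat"
  shows "\<exists>p\<in>polys (mdeg \<alpha>). \<forall>y\<in>sphere 0 1. harm_ext \<alpha> y = p (fst y)"
proof
  let ?p = "\<lambda>x. \<Sum>k\<le>mdeg \<alpha>. (- 1) ^ k / fact (2 * k) * ((1 + (-1) * (norm x)\<^sup>2) ^ k * lapl_iter \<alpha> k x)"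
  show "?p \<in> polys (mdeg \<alpha>)"
  proof (intro polys_sum polys_scale)
    fix k
    show "(\<lambda>x. (1 + (-1) * (norm x)\<^sup>2) ^ k * lapl_iter \<alpha> k x) \<in> polys (mdeg \<alpha>)"
    proof (cases "mdeg \<alpha> < 2 * k")
      case True
      then show ?thesis by (simp add: lapl_iter_eq_0 polys_zero)
    next
      case False
      have "(\<lambda>x. (1 + (-1) * (norm x)\<^sup>2) ^ k) \<in> polys (2 * k)"
        by (intro polys_power polys_add polys_scale polys_const norm_sq_in_polys)
      from polys_mult[OF this lapl_iter_in_polys[of \<alpha> k]] False show ?thesis by simp
    qed
  qed
  show "\<forall>y\<in>sphere 0 1. harm_ext \<alpha> y = ?p (fst y)"
  proof
    fix y :: "(real ^ 'n) \<times> real" assume "y \<in> sphere 0 1"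
    then have "(norm (fst y))\<^sup>2 + (snd y)\<^sup>2 = 1"
      by (cases y) (simp add: norm_Pair real_sqrt_eq_1_iff)
    then have "(snd y)\<^sup>2 = 1 + (-1) * (norm (fst y))\<^sup>2" by simp
    then show "harm_ext \<alpha> y = ?p (fst y)"
      by (simp only: harm_ext_def power_mult)
  qed
qed

section \<open>Eigenfunctions as homogeneous functions on a half-space\<close>

lemma laplacian_cong:
  assumes "open U" "x \<in> U" "\<And>y. y \<in> U \<Longrightarrow> f y = g y"
  shows "laplacian f x = laplacian g x"
proof -
  have "pderiv_dir b (pderiv_dir b f) x = pderiv_dir b (pderiv_dir b g) x" for b
    by (rule pderiv_dir_cong[OF assms(1,2)]) (rule pderiv_dir_cong[OF assms(1) _ assms(3)])
  then show ?thesis by (simp add: laplacian_def)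
qed

lemma Ck_on_2_differentiable:
  assumes "Ck_on 2 f U" "open U" "x \<in> U"
  shows "f differentiable (at x)" "b \<in> Basis \<Longrightarrow> pderiv_dir b f differentiable (at x)"
  using assms by (auto simp: numeral_2_eq_2 differentiable_on_eq_differentiable_at)

lemma laplacian_lincomb:
  assumes "Ck_on 2 f U" "Ck_on 2 g U" "open U" "x \<in> U"
  shows "laplacian (\<lambda>y. c * f y + g y) x = c * laplacian f x + laplacian g x"
proof -
  note d = Ck_on_2_differentiable[OF assms(1,3)] Ck_on_2_differentiable[OF assms(2,3)]
  have "pderiv_dir b (pderiv_dir b (\<lambda>y. c * f y + g y)) x
      = c * pderiv_dir b (pderiv_dir b f) x + pderiv_dir b (pderiv_dir b g) x" if b: "b \<in> Basis" for b
  proof -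
    have "pderiv_dir b (pderiv_dir b (\<lambda>y. c * f y + g y)) x
        = pderiv_dir b (\<lambda>y. c * pderiv_dir b f y + pderiv_dir b g y) x"
      by (rule pderiv_dir_cong[OF assms(3,4)]) (simp add: pderiv_dir_add pderiv_dir_cmult d differentiable_mult)
    also have "\<dots> = c * pderiv_dir b (pderiv_dir b f) x + pderiv_dir b (pderiv_dir b g) x"
      using assms(4) b by (simp add: pderiv_dir_add pderiv_dir_cmult d differentiable_mult)
    finally show ?thesis .
  qed
  then show ?thesis by (simp add: laplacian_def sum.distrib sum_distrib_left)
qed

text \<open>
  Euler's identity, from differentiating \<open>t \<mapsto> f (t y)\<close> at \<open>t = 1\<close>.
\<close>

lemma euler_homogeneous:
  fixes f :: "'a::euclidean_space \<Rightarrow> real"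
  assumes "f differentiable (at y)" "\<And>c. c > 0 \<Longrightarrow> f (c *\<^sub>R y) = c ^ l * f y"
  shows "(\<Sum>b\<in>Basis. (y \<bullet> b) * pderiv_dir b f y) = real l * f y"
proof -
  have 1: "((\<lambda>t. t *\<^sub>R y) has_derivative (\<lambda>h. h *\<^sub>R y)) (at 1)"
    by (auto intro!: derivative_eq_intros)
  have 2: "(f has_derivative (\<lambda>h. \<Sum>b\<in>Basis. (h \<bullet> b) * pderiv_dir b f y)) (at (1 *\<^sub>R y))"
    using has_derivative_pderiv_dir[OF assms(1)] by simp
  have "((\<lambda>t. f (t *\<^sub>R y)) has_derivative (\<lambda>h. \<Sum>b\<in>Basis. ((h *\<^sub>R y) \<bullet> b) * pderiv_dir b f y)) (at 1)"
    by (rule has_derivative_compose[OF 1 2])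
  moreover have "(\<lambda>h. \<Sum>b\<in>Basis. ((h *\<^sub>R y) \<bullet> b) * pderiv_dir b f y) = (*) (\<Sum>b\<in>Basis. (y \<bullet> b) * pderiv_dir b f y)"
    by (auto simp: fun_eq_iff sum_distrib_right intro!: sum.cong)
  ultimately have A: "((\<lambda>t. f (t *\<^sub>R y)) has_field_derivative (\<Sum>b\<in>Basis. (y \<bullet> b) * pderiv_dir b f y)) (at 1)"
    by (simp add: has_field_derivative_def)
  have "((\<lambda>t. t ^ l * f y) has_field_derivative (real l * f y)) (at 1)"
    by (auto intro!: derivative_eq_intros)
  then have B: "((\<lambda>t. f (t *\<^sub>R y)) has_field_derivative (real l * f y)) (at 1)"
    by (rule has_field_derivative_transform_within_open[of _ _ _ "{0<..}"]) (auto simp: assms(2))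
  show ?thesis by (rule DERIV_unique[OF A B])
qed

text \<open>
  The equations for the extension along rays of a Neumann eigenfunction. They involve only the
  Euclidean Laplacian on a half-space, where integration by parts is available.
\<close>

definition cone_eigenfunction :: "real \<Rightarrow> ((real ^ 'n::finite) \<times> real \<Rightarrow> real) \<Rightarrow> bool" where
  "cone_eigenfunction \<mu> f \<longleftrightarrow>
     (\<exists>\<Omega>. open \<Omega> \<and> {y. y \<noteq> 0 \<and> snd y \<ge> 0} \<subseteq> \<Omega> \<and> Ck_on 2 f \<Omega>) \<and>
     (\<forall>c>0. \<forall>y. f (c *\<^sub>R y) = f y) \<and>
     (\<forall>x. x \<noteq> 0 \<longrightarrow> pderiv_dir (0, 1) f (x, 0) = 0) \<and>
     (\<forall>y. snd y > 0 \<longrightarrow> laplacian f y = - \<mu> * f y / (norm y)\<^sup>2)"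

lemma closed_hemisphere_iff: "y \<in> closed_hemisphere \<longleftrightarrow> norm y = 1 \<and> snd y \<ge> 0"
  by (auto simp: closed_hemisphere_def)

lemma sgn_in_closed_hemisphere: "y \<noteq> 0 \<Longrightarrow> snd y \<ge> 0 \<Longrightarrow> sgn y \<in> closed_hemisphere"
  by (simp add: closed_hemisphere_iff norm_sgn) (simp add: sgn_div_norm)

lemma homogeneous_0_sgn:
  fixes f :: "'a::real_normed_vector \<Rightarrow> real"
  assumes "\<forall>c>0. \<forall>y. f (c *\<^sub>R y) = f y" "y \<noteq> 0"
  shows "f (sgn y) = f y"
  using assms(1)[rule_format, of "inverse (norm y)" y] assms(2) by (simp add: sgn_div_norm)

lemma open_upper: "open {y::'a::real_normed_vector \<times> real. snd y > 0}"
  by (intro open_Collect_less continuous_intros)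

text \<open>
  In the open half-space the ray extension of \<open>u\<close> is \<open>f\<close>, and the Laplacian is local.
\<close>

lemma sphere_laplacian_cone:
  assumes hom: "\<forall>c>0. \<forall>y. f (c *\<^sub>R y) = f y" and u: "\<And>y. y \<in> closed_hemisphere \<Longrightarrow> u y = f y"
    and x: "snd (x::(real ^ 'n::finite) \<times> real) > 0"
  shows "sphere_laplacian u x = laplacian f x"
  unfolding sphere_laplacian_def
proof (rule laplacian_cong[OF open_upper])
  fix y :: "(real ^ 'n) \<times> real" assume "y \<in> {y. snd y > 0}"
  then have "y \<noteq> 0" "snd y \<ge> 0" by auto
  then show "u (sgn y) = f y"
    using u[OF sgn_in_closed_hemisphere] homogeneous_0_sgn[OF hom] by simp
qed (use x in simp)

text \<open>
  The meridian through \<open>x\<close> leaves the equator with velocity \<open>(0, 1)\<close>.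
\<close>

lemma meridian_derivative:
  assumes f: "f differentiable (at x)" and u: "\<And>y. y \<in> closed_hemisphere \<Longrightarrow> u y = f y" and x: "x \<in> equator"
  shows "((\<lambda>t. u (cos t *\<^sub>R x + sin t *\<^sub>R (0, 1))) has_real_derivative pderiv_dir (0, 1) f x) (at_right 0)"
proof -
  let ?\<gamma> = "\<lambda>t. cos t *\<^sub>R x + sin t *\<^sub>R (0, 1)"
  have xe: "norm x = 1" "snd x = 0" using x by (auto simp: equator_def)
  have 1: "(?\<gamma> has_derivative (\<lambda>h. h *\<^sub>R (0, 1))) (at 0)"
    by (auto intro!: derivative_eq_intros)
  have 2: "(f has_derivative frechet_derivative f (at x)) (at (?\<gamma> 0))"
    using f by (simp add: frechet_derivative_works zero_prod_def[symmetric])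
  have "frechet_derivative f (at x) (h *\<^sub>R (0, 1)) = pderiv_dir (0, 1) f x * h" for h
    using linear_cmul[OF linear_frechet_derivative[OF f], of h "(0, 1)"] by (simp add: pderiv_dir_def)
  with has_derivative_compose[OF 1 2]
  have "((\<lambda>t. f (?\<gamma> t)) has_real_derivative pderiv_dir (0, 1) f x) (at 0)"
    by (simp add: has_field_derivative_def)
  then have A: "((\<lambda>t. f (?\<gamma> t)) has_real_derivative pderiv_dir (0, 1) f x) (at 0 within {0..<pi})"
    by (rule has_field_derivative_at_within)
  have in_ch: "?\<gamma> t \<in> closed_hemisphere" if "t \<in> {0..<pi}" for t
  proof -
    have "(norm (?\<gamma> t))\<^sup>2 = (cos t)\<^sup>2 * (norm (fst x))\<^sup>2 + (sin t)\<^sup>2"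
      using xe by (simp add: norm_prod_def power_mult_distrib)
    moreover have "norm (fst x) = 1" using xe by (simp add: norm_prod_def)
    ultimately have "(norm (?\<gamma> t))\<^sup>2 = 1" by simp
    then have "norm (?\<gamma> t) = 1" by (simp add: power2_eq_1_iff) (smt (verit) norm_ge_zero)
    moreover have "snd (?\<gamma> t) \<ge> 0" using xe that by (simp add: sin_ge_zero)
    ultimately show ?thesis by (simp add: closed_hemisphere_iff)
  qed
  have "((\<lambda>t. u (?\<gamma> t)) has_real_derivative pderiv_dir (0, 1) f x) (at 0 within {0..<pi})"
    by (rule has_field_derivative_transform_within[OF A, of 1]) (use u[OF in_ch] in auto)
  moreover have "at 0 within {0..<pi} = at_right 0"
    by (rule at_within_nhd[of _ "{-1<..<pi}"]) auto
  ultimately show ?thesis by simp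
qed

text \<open>
  The Laplacian of a function that is homogeneous of degree \<open>0\<close> has degree \<open>-2\<close>; this carries the
  eigenvalue equation from the sphere to the cone over it.
\<close>

lemma laplacian_homogeneous_0:
  fixes f :: "'a::euclidean_space \<Rightarrow> real"
  assumes Ck: "Ck_on 2 f U" "open U" and hom: "\<forall>c>0. \<forall>y. f (c *\<^sub>R y) = f y"
    and c: "c > 0" and U: "\<And>y. y \<in> U \<Longrightarrow> c *\<^sub>R y \<in> U" and y: "y \<in> U"
  shows "laplacian f y = c\<^sup>2 * laplacian f (c *\<^sub>R y)"
proof -
  have fc: "(\<lambda>x. f (c *\<^sub>R x)) = f" using hom c by auto
  note d = Ck_on_2_differentiable[OF Ck]
  have 1: "pderiv_dir b f z = c * pderiv_dir b f (c *\<^sub>R z)" if "z \<in> U" for b z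
    using pderiv_dir_scaleR_arg[of f c z b] d(1)[OF U[OF that]] fc by simp
  have "pderiv_dir b (pderiv_dir b f) y = c\<^sup>2 * pderiv_dir b (pderiv_dir b f) (c *\<^sub>R y)" if b: "b \<in> Basis" for b
  proof -
    have "pderiv_dir b (pderiv_dir b f) y = pderiv_dir b (\<lambda>z. c * pderiv_dir b f (c *\<^sub>R z)) y"
      by (rule pderiv_dir_cong[OF Ck(2) y 1])
    also have "\<dots> = c * pderiv_dir b (\<lambda>z. pderiv_dir b f (c *\<^sub>R z)) y"
      using d(2)[OF U[OF y] b] differentiable_compose[of "pderiv_dir b f" "\<lambda>x. c *\<^sub>R x" y UNIV]
      by (intro pderiv_dir_cmult) simp
    also have "\<dots> = c\<^sup>2 * pderiv_dir b (pderiv_dir b f) (c *\<^sub>R y)"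
      using d(2)[OF U[OF y] b] by (simp add: pderiv_dir_scaleR_arg power2_eq_square)
    finally show ?thesis .
  qed
  then show ?thesis by (simp add: laplacian_def sum_distrib_left)
qed

text \<open>
  The function is \<open>f = F \<circ> sgn\<close> for a \<open>C\<^sup>2\<close> extension \<open>F\<close> of \<open>u\<close> across the equator.
\<close>

lemma eigenspace_imp_cone:
  fixes u :: "(real ^ 'n::finite) \<times> real \<Rightarrow> real"
  assumes "u \<in> neumann_eigenspace \<mu>"
  obtains f where "cone_eigenfunction \<mu> f" "\<And>y. y \<in> closed_hemisphere \<Longrightarrow> u y = f y"
proof -
  from assms have C2: "C2_closed_hemisphere u" and nc: "neumann_condition u"
    and ev: "\<And>x. x \<in> hemisphere \<Longrightarrow> - sphere_laplacian u x = \<mu> * u x"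
    by (auto simp: neumann_eigenspace_def)
  from C2 obtain U F where U: "open U" "closed_hemisphere \<subseteq> U" "Ck_on 2 F U"
    and F: "\<And>x. x \<in> closed_hemisphere \<Longrightarrow> F x = u x"
    by (auto simp: C2_closed_hemisphere_def)
  define f where "f y = F (sgn y)" for y
  define \<Omega> where "\<Omega> = {y. y \<noteq> 0 \<and> sgn y \<in> U}"
  have o\<Omega>: "open \<Omega>" and Ck: "Ck_on 2 f \<Omega>"
    using Ck_on_compose_sgn[OF U(1,3)] by (simp_all add: \<Omega>_def f_def[abs_def])
  have sub: "{y. y \<noteq> 0 \<and> snd y \<ge> 0} \<subseteq> \<Omega>"
    using U(2) sgn_in_closed_hemisphere by (auto simp: \<Omega>_def)
  have hom: "\<forall>c>0. \<forall>y. f (c *\<^sub>R y) = f y" by (simp add: f_def sgn_scaleR)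
  have uf: "u y = f y" if "y \<in> closed_hemisphere" for y
    using that F[of y] by (simp add: f_def sgn_div_norm closed_hemisphere_iff)
  have Ck': "Ck_on 2 f {y. snd y > 0}" by (rule Ck_on_subset[OF Ck]) (use sub in auto)
  have "laplacian f y = - \<mu> * f y / (norm y)\<^sup>2" if y: "snd y > 0" for y
  proof -
    have y0: "y \<noteq> 0" using y by auto
    have sy: "sgn y \<in> hemisphere" "sgn y \<in> closed_hemisphere" "snd (sgn y) > 0" using y y0
      by (auto simp: hemisphere_def closed_hemisphere_def norm_sgn sgn_div_norm)
    have "laplacian f (sgn y) = - \<mu> * u (sgn y)"
      using ev[OF sy(1)] sphere_laplacian_cone[OF hom uf sy(3)] by simp
    moreover have "u (sgn y) = f y" using uf[OF sy(2)] homogeneous_0_sgn[OF hom y0] by simp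
    moreover have "laplacian f y = (inverse (norm y))\<^sup>2 * laplacian f (inverse (norm y) *\<^sub>R y)"
      by (rule laplacian_homogeneous_0[OF Ck' open_upper hom]) (use y y0 in auto)
    ultimately show ?thesis by (simp add: sgn_div_norm field_simps)
  qed
  moreover have "pderiv_dir (0, 1) f (x, 0) = 0" if x: "x \<noteq> 0" for x
  proof -
    \<comment> \<open>The condition holds at the point of the equator on the same ray; the derivative is homogeneous.\<close>
    let ?s = "sgn (x, 0::real)"
    have x': "(x, 0::real) \<noteq> 0" using x by (simp add: zero_prod_def)
    then have se: "?s \<in> equator" by (simp add: equator_def norm_sgn) (simp add: sgn_div_norm)
    have s\<Omega>: "?s \<in> \<Omega>" using sub se by (auto simp: equator_def)
    have fd: "f differentiable (at y)" if "y \<in> \<Omega>" for y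
      using Ck_on_2_differentiable(1)[OF Ck o\<Omega> that] .
    have "((\<lambda>t. u (cos t *\<^sub>R ?s + sin t *\<^sub>R (0, 1))) has_real_derivative pderiv_dir (0, 1) f ?s) (at_right 0)"
      by (rule meridian_derivative[OF fd[OF s\<Omega>] uf se])
    moreover have "((\<lambda>t. u (cos t *\<^sub>R ?s + sin t *\<^sub>R (0, 1))) has_real_derivative 0) (at_right 0)"
      using nc se by (simp add: neumann_condition_def)
    ultimately have "pderiv_dir (0, 1) f ?s = 0"
      unfolding has_field_derivative_iff using tendsto_unique[OF trivial_limit_at_right_real] by blast
    moreover have "(\<lambda>y. f (inverse (norm (x, 0::real)) *\<^sub>R y)) = f"
      using hom x by (simp add: fun_eq_iff zero_prod_def)
    ultimately show ?thesis
      using pderiv_dir_scaleR_arg[of f "inverse (norm (x, 0::real))" "(x, 0)" "(0, 1)"] fd[OF s\<Omega>]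
      by (simp add: sgn_div_norm)
  qed
  ultimately have "cone_eigenfunction \<mu> f"
    unfolding cone_eigenfunction_def using o\<Omega> sub Ck hom by blast
  then show ?thesis using uf that by blast
qed

lemma cone_imp_eigenspace:
  fixes f :: "(real ^ 'n::finite) \<times> real \<Rightarrow> real"
  assumes "cone_eigenfunction \<mu> f"
  shows "(\<lambda>y. if y \<in> closed_hemisphere then f y else 0) \<in> neumann_eigenspace \<mu>"
proof -
  let ?u = "\<lambda>y. if y \<in> closed_hemisphere then f y else 0"
  from assms obtain \<Omega> where o\<Omega>: "open \<Omega>" and sub: "{y. y \<noteq> 0 \<and> snd y \<ge> 0} \<subseteq> \<Omega>" and Ck: "Ck_on 2 f \<Omega>"
    and hom: "\<forall>c>0. \<forall>y. f (c *\<^sub>R y) = f y"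
    and nb: "\<And>x. x \<noteq> 0 \<Longrightarrow> pderiv_dir (0, 1) f (x, 0) = 0"
    and ev: "\<And>y. snd y > 0 \<Longrightarrow> laplacian f y = - \<mu> * f y / (norm y)\<^sup>2"
    by (auto simp: cone_eigenfunction_def)
  have uf: "?u y = f y" if "y \<in> closed_hemisphere" for y using that by simp
  have ch: "closed_hemisphere \<subseteq> \<Omega>" using sub by (auto simp: closed_hemisphere_iff)
  have "C2_closed_hemisphere ?u"
    unfolding C2_closed_hemisphere_def using o\<Omega> ch Ck by (intro exI[of _ \<Omega>] exI[of _ f]) auto
  moreover have "neumann_condition ?u"
    unfolding neumann_condition_def
  proof
    fix x :: "(real ^ 'n) \<times> real" assume x: "x \<in> equator"
    then have "x \<in> \<Omega>" using ch by (auto simp: equator_def closed_hemisphere_def)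
    from meridian_derivative[OF Ck_on_2_differentiable(1)[OF Ck o\<Omega> this] uf x]
    have "((\<lambda>t. ?u (cos t *\<^sub>R x + sin t *\<^sub>R (0, 1))) has_real_derivative pderiv_dir (0, 1) f x) (at_right 0)" .
    moreover have "pderiv_dir (0, 1) f x = 0"
      using x nb[of "fst x"] by (cases x) (force simp: equator_def)
    ultimately show "((\<lambda>t. ?u (cos t *\<^sub>R x + sin t *\<^sub>R (0, 1))) has_real_derivative 0) (at_right 0)" by simp
  qed
  moreover have "- sphere_laplacian ?u x = \<mu> * ?u x" if "x \<in> hemisphere" for x
  proof -
    have x: "snd x > 0" "norm x = 1" "x \<in> closed_hemisphere"
      using that by (auto simp: hemisphere_def closed_hemisphere_def)
    then show ?thesis using sphere_laplacian_cone[OF hom uf x(1)] ev[OF x(1)] by simp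
  qed
  ultimately show ?thesis by (auto simp: neumann_eigenspace_def)
qed

lemma cone_eigenfunction_lincomb:
  fixes f g :: "(real ^ 'n::finite) \<times> real \<Rightarrow> real"
  assumes "cone_eigenfunction \<mu> f" "cone_eigenfunction \<mu> g"
  shows "cone_eigenfunction \<mu> (\<lambda>y. c * f y + g y)"
proof -
  from assms(1) obtain \<Omega>1 where f: "open \<Omega>1" "{y. y \<noteq> 0 \<and> snd y \<ge> 0} \<subseteq> \<Omega>1" "Ck_on 2 f \<Omega>1"
    "\<forall>c>0. \<forall>y. f (c *\<^sub>R y) = f y"
    "\<And>x. x \<noteq> 0 \<Longrightarrow> pderiv_dir (0, 1) f (x, 0) = 0"
    "\<And>y. snd y > 0 \<Longrightarrow> laplacian f y = - \<mu> * f y / (norm y)\<^sup>2"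
    by (auto simp: cone_eigenfunction_def)
  from assms(2) obtain \<Omega>2 where g: "open \<Omega>2" "{y. y \<noteq> 0 \<and> snd y \<ge> 0} \<subseteq> \<Omega>2" "Ck_on 2 g \<Omega>2"
    "\<forall>c>0. \<forall>y. g (c *\<^sub>R y) = g y"
    "\<And>x. x \<noteq> 0 \<Longrightarrow> pderiv_dir (0, 1) g (x, 0) = 0"
    "\<And>y. snd y > 0 \<Longrightarrow> laplacian g y = - \<mu> * g y / (norm y)\<^sup>2"
    by (auto simp: cone_eigenfunction_def)
  define \<Omega> where "\<Omega> = \<Omega>1 \<inter> \<Omega>2"
  have \<Omega>: "open \<Omega>" "{y. y \<noteq> 0 \<and> snd y \<ge> 0} \<subseteq> \<Omega>" "Ck_on 2 f \<Omega>" "Ck_on 2 g \<Omega>"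
    using f g by (auto simp: \<Omega>_def intro: Ck_on_subset[OF f(3)] Ck_on_subset[OF g(3)])
  have "Ck_on 2 (\<lambda>y. c * f y + g y) \<Omega>"
    by (intro Ck_on_add Ck_on_mult Ck_on_const \<Omega>)
  moreover have "pderiv_dir (0, 1) (\<lambda>y. c * f y + g y) (x, 0) = 0" if "x \<noteq> 0" for x
  proof -
    have "(x, 0) \<in> \<Omega>" using \<Omega>(2) that by (auto simp: zero_prod_def)
    then show ?thesis
      using f(5)[OF that] g(5)[OF that] Ck_on_2_differentiable(1)[OF \<Omega>(3,1)] Ck_on_2_differentiable(1)[OF \<Omega>(4,1)]
      by (simp add: pderiv_dir_add pderiv_dir_cmult differentiable_mult)
  qed
  moreover have "laplacian (\<lambda>y. c * f y + g y) y = - \<mu> * (c * f y + g y) / (norm y)\<^sup>2" if "snd y > 0" for y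
  proof -
    have "y \<in> \<Omega>" using \<Omega>(2) that by auto
    from laplacian_lincomb[OF \<Omega>(3,4,1) this, of c]
    have "laplacian (\<lambda>y. c * f y + g y) y = c * laplacian f y + laplacian g y" .
    then show ?thesis
      unfolding f(6)[OF that] g(6)[OF that]
      by (simp add: add_divide_distrib diff_divide_distrib algebra_simps)
  qed
  ultimately show ?thesis
    unfolding cone_eigenfunction_def using \<Omega> f(4) g(4) by (intro conjI exI[of _ \<Omega>]) auto
qed

lemma subspace_neumann_eigenspace:
  "real_fun.subspace (neumann_eigenspace \<mu> :: ((real ^ 'n::finite) \<times> real \<Rightarrow> real) set)"
proof -
  have lin: "(\<lambda>y. c * u y + v y) \<in> neumann_eigenspace \<mu>"
    if u: "u \<in> neumann_eigenspace \<mu>" and v: "v \<in> neumann_eigenspace \<mu>"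
    for c and u v :: "(real ^ 'n) \<times> real \<Rightarrow> real"
  proof -
    obtain f where f: "cone_eigenfunction \<mu> f" "\<And>y. y \<in> closed_hemisphere \<Longrightarrow> u y = f y"
      using eigenspace_imp_cone[OF u] by blast
    obtain g where g: "cone_eigenfunction \<mu> g" "\<And>y. y \<in> closed_hemisphere \<Longrightarrow> v y = g y"
      using eigenspace_imp_cone[OF v] by blast
    have "(\<lambda>y. c * u y + v y) = (\<lambda>y. if y \<in> closed_hemisphere then c * f y + g y else 0)"
      using u v f(2) g(2) by (auto simp: neumann_eigenspace_def fun_eq_iff)
    then show ?thesis using cone_imp_eigenspace[OF cone_eigenfunction_lincomb[OF f(1) g(1), of c]] by simp
  qed
  have zero: "(\<lambda>y. 0) \<in> (neumann_eigenspace \<mu> :: ((real ^ 'n) \<times> real \<Rightarrow> real) set)"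
  proof -
    have "pderiv_dir b (\<lambda>y. 0) = (\<lambda>y. 0)" for b :: "(real ^ 'n) \<times> real" by (simp add: fun_eq_iff)
    then have "cone_eigenfunction \<mu> (\<lambda>y::(real ^ 'n) \<times> real. 0)"
      by (auto simp: cone_eigenfunction_def laplacian_def Ck_on_const intro!: exI[of _ UNIV])
    from cone_imp_eigenspace[OF this] show ?thesis by simp
  qed
  show ?thesis
    unfolding real_fun.subspace_def
    using zero lin[of _ _ 1] lin[OF _ zero]
    by (auto simp: zero_fun_def plus_fun_def)
qed

lemma pderiv_dir_inverse_norm_power:
  assumes "y \<noteq> 0"
  shows "pderiv_dir b (\<lambda>y. inverse (norm y) ^ l) y = - real l * (y \<bullet> b) * inverse (norm y) ^ (l + 2)"
proof -
  have "((\<lambda>y. inverse (norm y) ^ l) has_derivative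
      (\<lambda>h. real l * (- (y \<bullet> h) * inverse (norm y) ^ 3) * inverse (norm y) ^ (l - 1))) (at y)"
    by (rule has_derivative_power[OF has_derivative_inverse_norm[OF assms]])
  from pderiv_dir_eqI[OF this, of b] show ?thesis
    by (cases l) (simp_all add: eval_nat_numeral algebra_simps)
qed

lemma pderiv_dir_inner: "pderiv_dir b (\<lambda>y. y \<bullet> c) y = b \<bullet> c"
  by (rule pderiv_dir_eqI) (auto intro!: derivative_eq_intros)

text \<open>
  For \<open>n = DIM('a)\<close> the product rule gives \<open>\<Delta> (h r\<^sup>-\<^sup>l) = h \<Delta> r\<^sup>-\<^sup>l + 2 \<nabla>h \<sqdot> \<nabla>r\<^sup>-\<^sup>l\<close>, where
  \<open>\<Delta> r\<^sup>-\<^sup>l = l (l + 2 - n) r\<^sup>-\<^sup>l\<^sup>-\<^sup>2\<close> and, by Euler's identity,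
  \<open>2 \<nabla>h \<sqdot> \<nabla>r\<^sup>-\<^sup>l = - 2 l\<^sup>2 h r\<^sup>-\<^sup>l\<^sup>-\<^sup>2\<close>.
\<close>

lemma laplacian_harmonic_normalized:
  fixes h :: "'a::euclidean_space \<Rightarrow> real"
  assumes Ck: "Ck_on 2 h UNIV" and harm: "\<And>y. laplacian h y = 0"
    and hom: "\<And>c y. h (c *\<^sub>R y) = c ^ l * h y" and y: "y \<noteq> 0"
  shows "laplacian (\<lambda>y. h y * inverse (norm y) ^ l) y
    = - (real l * (real l + real DIM('a) - 2)) * (h y * inverse (norm y) ^ l) / (norm y)\<^sup>2"
proof -
  note d = Ck_on_2_differentiable[OF Ck open_UNIV UNIV_I]
  have dR: "(\<lambda>y::'a. inverse (norm y) ^ k) differentiable (at z)" if "z \<noteq> 0" for z k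
    using has_derivative_power[OF has_derivative_inverse_norm[OF that]] by (auto simp: differentiable_def)
  have di: "(\<lambda>y::'a. - real k * (y \<bullet> b)) differentiable (at z)" for z b k
    by (auto intro!: derivative_eq_intros simp: differentiable_def)
  define R where "R = inverse (norm y)"
  have 1: "pderiv_dir b (\<lambda>y. h y * inverse (norm y) ^ l) z
      = h z * (- real l * (z \<bullet> b) * inverse (norm z) ^ (l + 2)) + pderiv_dir b h z * inverse (norm z) ^ l"
    if "z \<noteq> 0" for z b
    by (simp add: pderiv_dir_mult d(1) dR[OF that] pderiv_dir_inverse_norm_power[OF that])
  have 2: "pderiv_dir b (pderiv_dir b (\<lambda>y. h y * inverse (norm y) ^ l)) y
     = - real l * h y * R ^ (l + 2) * (b \<bullet> b) + real l * (real l + 2) * h y * R ^ (l + 4) * ((y \<bullet> b) * (y \<bullet> b))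
       - 2 * real l * R ^ (l + 2) * ((y \<bullet> b) * pderiv_dir b h y)
       + R ^ l * pderiv_dir b (pderiv_dir b h) y" if b: "b \<in> Basis" for b
  proof -
    have "pderiv_dir b (pderiv_dir b (\<lambda>y. h y * inverse (norm y) ^ l)) y
       = pderiv_dir b (\<lambda>z. h z * (- real l * (z \<bullet> b) * inverse (norm z) ^ (l + 2)) + pderiv_dir b h z * inverse (norm z) ^ l) y"
      by (rule pderiv_dir_cong[of "-{0}"]) (use y 1 in auto)
    also have "\<dots> = h y * pderiv_dir b (\<lambda>z. - real l * (z \<bullet> b) * inverse (norm z) ^ (l + 2)) y
        + pderiv_dir b h y * (- real l * (y \<bullet> b) * R ^ (l + 2))
        + (pderiv_dir b h y * (- real l * (y \<bullet> b) * R ^ (l + 2)) + pderiv_dir b (pderiv_dir b h) y * R ^ l)"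
      by (subst pderiv_dir_add)
        (auto simp only: pderiv_dir_mult d(1) d(2)[OF b] dR[OF y] di differentiable_mult
            pderiv_dir_inverse_norm_power[OF y] R_def)
    also have "pderiv_dir b (\<lambda>z. - real l * (z \<bullet> b) * inverse (norm z) ^ (l + 2)) y
       = - real l * (y \<bullet> b) * (- real (l + 2) * (y \<bullet> b) * R ^ (l + 2 + 2)) + (- real l * (b \<bullet> b)) * R ^ (l + 2)"
    proof -
      have "(\<lambda>y::'a. y \<bullet> b) differentiable (at y)" by (auto intro!: derivative_eq_intros simp: differentiable_def)
      from pderiv_dir_cmult[OF this, of b "- real l"]
      have "pderiv_dir b (\<lambda>z. - real l * (z \<bullet> b)) y = - real l * (b \<bullet> b)"
        by (simp only: pderiv_dir_inner)
      then show ?thesis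
        by (simp only: pderiv_dir_mult[OF di dR[OF y]] pderiv_dir_inverse_norm_power[OF y] R_def)
    qed
    finally show ?thesis by (simp add: algebra_simps power_add eval_nat_numeral)
  qed
  have e: "(\<Sum>b\<in>Basis. (y \<bullet> b) * pderiv_dir b h y) = real l * h y"
    by (rule euler_homogeneous[OF d(1) hom])
  have n: "(\<Sum>b\<in>Basis. (y \<bullet> b) * (y \<bullet> b)) = (norm y)\<^sup>2"
    by (simp add: euclidean_inner[of y y, symmetric] power2_norm_eq_inner)
  have RR: "R ^ (l + 4) * (norm y)\<^sup>2 = R ^ (l + 2)"
    using y by (simp add: R_def power_add field_simps eval_nat_numeral)
  have "laplacian (\<lambda>y. h y * inverse (norm y) ^ l) y
    = - real l * h y * R ^ (l + 2) * (\<Sum>b::'a\<in>Basis. b \<bullet> b)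
      + real l * (real l + 2) * h y * R ^ (l + 4) * (\<Sum>b\<in>Basis. (y \<bullet> b) * (y \<bullet> b))
      - 2 * real l * R ^ (l + 2) * (\<Sum>b\<in>Basis. (y \<bullet> b) * pderiv_dir b h y)
      + R ^ l * (\<Sum>b\<in>Basis. pderiv_dir b (pderiv_dir b h) y)"
    unfolding laplacian_def sum_distrib_left
    by (simp add: 2 sum.distrib sum_subtractf)
  also have "\<dots> = - real l * h y * R ^ (l + 2) * real DIM('a) + real l * (real l + 2) * h y * (R ^ (l + 4) * (norm y)\<^sup>2)
      - 2 * real l * R ^ (l + 2) * (real l * h y)"
    using harm[of y] by (simp add: e n laplacian_def inner_Basis)
  also have "\<dots> = - (real l * (real l + real DIM('a) - 2)) * h y * R ^ (l + 2)"
    unfolding RR by (simp add: algebra_simps)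
  finally show ?thesis using y by (simp add: R_def power_add field_simps power2_eq_square)
qed

definition hemisphere_eigenvalue :: "'n::finite itself \<Rightarrow> nat \<Rightarrow> real" where
  "hemisphere_eigenvalue _ l = real l * (real l + real CARD('n) - 1)"

definition harm_fun :: "('n::finite \<Rightarrow> nat) \<Rightarrow> (real ^ 'n) \<times> real \<Rightarrow> real" where
  "harm_fun \<alpha> y = (if y \<in> closed_hemisphere then harm_ext \<alpha> y else 0)"

lemma harm_fun_eigenfunction:
  fixes \<alpha> :: "'n::finite \<Rightarrow> nat"
  shows "harm_fun \<alpha> \<in> neumann_eigenspace (hemisphere_eigenvalue TYPE('n) (mdeg \<alpha>))"
proof -
  let ?l = "mdeg \<alpha>"
  let ?f = "\<lambda>y. harm_ext \<alpha> y * inverse (norm y) ^ ?l"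
  have "Ck_on 2 ?f (-{0})"
    by (intro Ck_on_mult Ck_on_power Ck_on_inverse_norm Ck_on_subset[OF Ck_on_harm_ext]) auto
  moreover have "?f (c *\<^sub>R y) = ?f y" if "c > 0" for c y
    using that by (simp add: harm_ext_scale power_mult_distrib field_simps)
  moreover have "pderiv_dir (0, 1) ?f (x, 0) = 0" if x: "x \<noteq> 0" for x
  proof -
    have x': "(x, 0::real) \<noteq> 0" using x by (simp add: zero_prod_def)
    have "harm_ext \<alpha> differentiable (at (x, 0))"
      using Ck_on_2_differentiable(1)[OF Ck_on_harm_ext open_UNIV UNIV_I] .
    moreover have "(\<lambda>y. inverse (norm y) ^ ?l) differentiable (at (x, 0::real))"
      using has_derivative_power[OF has_derivative_inverse_norm[OF x']] by (auto simp: differentiable_def)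
    ultimately show ?thesis
      by (simp add: pderiv_dir_mult pderiv_dir_inverse_norm_power[OF x'] harm_ext_normal_derivative)
  qed
  moreover have "laplacian ?f y = - hemisphere_eigenvalue TYPE('n) ?l * ?f y / (norm y)\<^sup>2" if "snd y > 0" for y
  proof -
    have "y \<noteq> 0" using that by auto
    from laplacian_harmonic_normalized[OF Ck_on_harm_ext harm_ext_harmonic harm_ext_scale this]
    show ?thesis by (simp add: hemisphere_eigenvalue_def)
  qed
  ultimately have "cone_eigenfunction (hemisphere_eigenvalue TYPE('n) ?l) ?f"
    unfolding cone_eigenfunction_def by (intro conjI exI[of _ "-{0}"]) auto
  from cone_imp_eigenspace[OF this]
  have "(\<lambda>y. if y \<in> closed_hemisphere then ?f y else 0) \<in> neumann_eigenspace (hemisphere_eigenvalue TYPE('n) ?l)" .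
  moreover have "(\<lambda>y. if y \<in> closed_hemisphere then ?f y else 0) = harm_fun \<alpha>"
    by (auto simp: harm_fun_def fun_eq_iff closed_hemisphere_iff)
  ultimately show ?thesis by simp
qed

section \<open>Green's formula and orthogonality\<close>

text \<open>
  Squaring removes the kink of the positive part, so that \<open>cutoff\<close> below is continuously
  differentiable.
\<close>

lemma has_real_derivative_max_0_squared:
  "((\<lambda>x::real. (max 0 x)\<^sup>2) has_real_derivative 2 * max 0 x) (at x)"
proof -
  consider "x > 0" | "x < 0" | "x = 0" by linarith
  then show ?thesis
  proof cases
    case 1
    have "((\<lambda>x::real. x\<^sup>2) has_real_derivative 2 * x) (at x)" by (auto intro!: derivative_eq_intros)
    then have "((\<lambda>x::real. (max 0 x)\<^sup>2) has_real_derivative 2 * x) (at x)"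
      by (rule has_field_derivative_transform_within_open[of _ _ _ "{0<..}"]) (use 1 in auto)
    then show ?thesis using 1 by simp
  next
    case 2
    have "((\<lambda>x::real. 0) has_real_derivative 0) (at x)" by simp
    then have "((\<lambda>x::real. (max 0 x)\<^sup>2) has_real_derivative 0) (at x)"
      by (rule has_field_derivative_transform_within_open[of _ _ _ "{..<0}"]) (use 2 in auto)
    then show ?thesis using 2 by simp
  next
    case 3
    have "((\<lambda>h::real. (max 0 h)\<^sup>2 / h) \<longlongrightarrow> 0) (at 0)"
    proof (rule Lim_null_comparison)
      show "\<forall>\<^sub>F h in at 0. norm ((max 0 h)\<^sup>2 / h) \<le> \<bar>h\<bar>"
        by (intro always_eventually allI) (auto simp: max_def power2_eq_square)
      show "((\<lambda>h::real. \<bar>h\<bar>) \<longlongrightarrow> 0) (at 0)" by (auto intro!: tendsto_eq_intros)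
    qed
    then show ?thesis using 3 by (simp add: has_field_derivative_iff)
  qed
qed

text \<open>
  A radial \<open>C\<^sup>1\<close> function that is positive exactly for \<open>1 < \<bar>y\<bar> < 2\<close>: away from the origin, where
  ray extensions are singular, and with bounded support.
\<close>

definition cutoff :: "'a::euclidean_space \<Rightarrow> real" where
  "cutoff y = (max 0 (((norm y)\<^sup>2 - 1) * (4 - (norm y)\<^sup>2)))\<^sup>2"

text \<open>
  The gradient of \<open>cutoff\<close> at \<open>y\<close> is \<open>cutoff_slope y *\<^sub>R y\<close>.
\<close>

definition cutoff_slope :: "'a::euclidean_space \<Rightarrow> real" where
  "cutoff_slope y = 4 * max 0 (((norm y)\<^sup>2 - 1) * (4 - (norm y)\<^sup>2)) * (5 - 2 * (norm y)\<^sup>2)"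

lemma has_derivative_cutoff:
  "(cutoff has_derivative (\<lambda>h. cutoff_slope y * (y \<bullet> h))) (at (y::'a::euclidean_space))"
proof -
  have 1: "((\<lambda>y::'a. (y \<bullet> y - 1) * (4 - y \<bullet> y)) has_derivative (\<lambda>h. 2 * (5 - 2 * (y \<bullet> y)) * (y \<bullet> h))) (at y)"
    by (auto intro!: derivative_eq_intros simp: algebra_simps inner_commute)
  note 2 = has_real_derivative_max_0_squared[of "(y \<bullet> y - 1) * (4 - y \<bullet> y)", unfolded has_field_derivative_def]
  have slope: "2 * max 0 q * (2 * r * s) = 4 * max 0 q * r * s" for q r s :: real by simp
  show ?thesis
    using has_derivative_compose[OF 1 2] unfolding slope
    by (simp add: cutoff_def[abs_def] cutoff_slope_def power2_norm_eq_inner)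
qed

lemma pderiv_dir_cutoff: "pderiv_dir b cutoff y = cutoff_slope y * (y \<bullet> b)"
  by (rule pderiv_dir_eqI[OF has_derivative_cutoff])

lemma differentiable_cutoff: "cutoff differentiable (at y)"
  using has_derivative_cutoff differentiable_def by blast

lemma Ck_on_cutoff: "Ck_on 1 (cutoff :: 'a::euclidean_space \<Rightarrow> real) U"
proof -
  have "pderiv_dir b (cutoff :: 'a \<Rightarrow> real) = (\<lambda>y. cutoff_slope y * (y \<bullet> b))" for b
    by (simp add: fun_eq_iff pderiv_dir_cutoff)
  moreover have "continuous_on U (\<lambda>y::'a. cutoff_slope y * (y \<bullet> b))" for b
    unfolding cutoff_slope_def by (intro continuous_intros)
  moreover have "(cutoff :: 'a \<Rightarrow> real) differentiable_on U"
    using differentiable_cutoff by (intro differentiable_at_imp_differentiable_on)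
  ultimately show ?thesis by simp
qed

lemma cutoff_eq_0: "norm y \<le> 1 \<or> norm y \<ge> 2 \<Longrightarrow> cutoff y = 0"
proof -
  assume "norm y \<le> 1 \<or> norm y \<ge> 2"
  then have "(norm y)\<^sup>2 \<le> 1 \<or> (norm y)\<^sup>2 \<ge> 4"
    using power_mono[of "norm y" 1 2] power_mono[of 2 "norm y" 2] by auto
  then have "((norm y)\<^sup>2 - 1) * (4 - (norm y)\<^sup>2) \<le> 0"
    by (auto simp: mult_le_0_iff)
  then show ?thesis by (simp add: cutoff_def max_def)
qed

lemma cutoff_pos: "1 < norm y \<Longrightarrow> norm y < 2 \<Longrightarrow> cutoff y > 0"
proof -
  assume a: "1 < norm y" "norm y < 2"
  have "(norm y)\<^sup>2 > 1" using a power_strict_mono[of 1 "norm y" 2] by simp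
  moreover have "(norm y)\<^sup>2 < 4" using a power_strict_mono[of "norm y" 2 2] by simp
  ultimately have "((norm y)\<^sup>2 - 1) * (4 - (norm y)\<^sup>2) > 0" by simp
  then show ?thesis unfolding cutoff_def by (intro zero_less_power) simp
qed

definition half_space_weight :: "(real ^ 'n::finite) \<times> real \<Rightarrow> real" where
  "half_space_weight y = indicator {y. snd y > 0} y * (cutoff y / (norm y)\<^sup>2)"

text \<open>
  The field \<open>W\<close> is extended by \<open>0\<close> into the unit ball, which contains the singularity at the
  origin. In its divergence the products of first derivatives of \<open>f\<close> and \<open>g\<close> cancel, and the term
  with the derivative of the cutoff vanishes by Euler's identity in degree \<open>0\<close>.
\<close>

lemma green_cone:
  fixes f g :: "(real ^ 'n::finite) \<times> real \<Rightarrow> real"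
  assumes "cone_eigenfunction \<mu> f" "cone_eigenfunction \<nu> g"
  shows "(\<mu> - \<nu>) * (\<integral>y. half_space_weight y * (f y * g y) \<partial>lborel) = 0"
proof -
  from assms(1) obtain \<Omega>1 where f: "open \<Omega>1" "{y. y \<noteq> 0 \<and> snd y \<ge> 0} \<subseteq> \<Omega>1" "Ck_on 2 f \<Omega>1"
    "\<forall>c>0. \<forall>y. f (c *\<^sub>R y) = f y"
    "\<And>x. x \<noteq> 0 \<Longrightarrow> pderiv_dir (0, 1) f (x, 0) = 0"
    "\<And>y. snd y > 0 \<Longrightarrow> laplacian f y = - \<mu> * f y / (norm y)\<^sup>2"
    by (auto simp: cone_eigenfunction_def)
  from assms(2) obtain \<Omega>2 where g: "open \<Omega>2" "{y. y \<noteq> 0 \<and> snd y \<ge> 0} \<subseteq> \<Omega>2" "Ck_on 2 g \<Omega>2"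
    "\<forall>c>0. \<forall>y. g (c *\<^sub>R y) = g y"
    "\<And>x. x \<noteq> 0 \<Longrightarrow> pderiv_dir (0, 1) g (x, 0) = 0"
    "\<And>y. snd y > 0 \<Longrightarrow> laplacian g y = - \<nu> * g y / (norm y)\<^sup>2"
    by (auto simp: cone_eigenfunction_def)
  define \<Omega> where "\<Omega> = \<Omega>1 \<inter> \<Omega>2"
  have \<Omega>: "open \<Omega>" "{y. y \<noteq> 0 \<and> snd y \<ge> 0} \<subseteq> \<Omega>" "Ck_on 2 f \<Omega>" "Ck_on 2 g \<Omega>"
    using f g by (auto simp: \<Omega>_def intro: Ck_on_subset[OF f(3)] Ck_on_subset[OF g(3)])
  note df = Ck_on_2_differentiable[OF \<Omega>(3,1)] and dg = Ck_on_2_differentiable[OF \<Omega>(4,1)]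
  define W where "W b y = cutoff y * (f y * pderiv_dir b g y - g y * pderiv_dir b f y)" for b y
  have W0: "W b y = 0" if "norm y \<le> 1 \<or> norm y \<ge> 2" for b y
    using cutoff_eq_0[OF that] by (simp add: W_def)
  have CkW: "Ck_on 1 (W b) (\<Omega> \<union> ball 0 1)" if b: "b \<in> Basis" for b
  proof (rule Ck_on_Un[OF \<Omega>(1) open_ball])
    have C1: "Ck_on 1 f \<Omega>" "Ck_on 1 g \<Omega>" by (rule Ck_on_mono[OF \<Omega>(3)], simp) (rule Ck_on_mono[OF \<Omega>(4)], simp)
    have C2: "Ck_on 1 (pderiv_dir b f) \<Omega>" "Ck_on 1 (pderiv_dir b g) \<Omega>"
      using \<Omega>(3,4) b by (simp_all add: numeral_2_eq_2)
    show "Ck_on 1 (W b) \<Omega>" unfolding W_def[abs_def]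
      by (intro Ck_on_mult Ck_on_diff \<Omega>(1) C1 C2 Ck_on_cutoff)
    show "Ck_on 1 (W b) (ball 0 1)"
      by (rule Ck_on_cong[OF open_ball _ Ck_on_const[of _ 0]]) (simp add: W0)
  qed
  have sub: "{y. snd y \<ge> 0} \<subseteq> \<Omega> \<union> ball 0 1" using \<Omega>(2) by auto
  \<comment> \<open>The normal component of the field vanishes on the boundary: at the origin by the cutoff, elsewhere by the Neumann condition.\<close>
  have bd: "snd b = 0 \<or> (\<forall>y. snd y = 0 \<longrightarrow> W b y = 0)" if "b \<in> Basis" for b
  proof (cases "snd b = 0")
    case False
    then have b: "b = (0, 1)" using that by (auto simp: Basis_prod_def)
    have "W b (x, 0) = 0" for x
      using f(5)[of x] g(5)[of x] W0[of "(x, 0)" b] b by (cases "x = 0") (auto simp: W_def)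
    then show ?thesis by (auto simp: prod_eq_iff)
  qed simp
  have int: "integrable lborel (\<lambda>y. indicator {y. snd y > 0} y * pderiv_dir b (W b) y)"
      "(\<integral>y. indicator {y. snd y > 0} y * pderiv_dir b (W b) y \<partial>lborel) = 0" if "b \<in> Basis" for b
    using half_space_integral_pderiv_eq_0[of "\<Omega> \<union> ball 0 1" "W b" 2 b] \<Omega>(1) sub CkW[OF that] bd[OF that] that W0
    by auto
  have div: "(\<Sum>b\<in>Basis. pderiv_dir b (W b) y) = (\<mu> - \<nu>) * (cutoff y / (norm y)\<^sup>2 * (f y * g y))" if y: "snd y > 0" for y
  proof -
    have y\<Omega>: "y \<in> \<Omega>" using \<Omega>(2) y by auto
    have "pderiv_dir b (W b) y = cutoff_slope y * (f y * ((y \<bullet> b) * pderiv_dir b g y) - g y * ((y \<bullet> b) * pderiv_dir b f y))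
      + cutoff y * (f y * pderiv_dir b (pderiv_dir b g) y - g y * pderiv_dir b (pderiv_dir b f) y)" if b: "b \<in> Basis" for b
      unfolding W_def[abs_def]
      using df(1)[OF y\<Omega>] dg(1)[OF y\<Omega>] df(2)[OF y\<Omega> b] dg(2)[OF y\<Omega> b]
      by (simp add: pderiv_dir_mult pderiv_dir_diff differentiable_cutoff pderiv_dir_cutoff differentiable_mult differentiable_diff)
        (simp add: algebra_simps)
    then have "(\<Sum>b\<in>Basis. pderiv_dir b (W b) y)
      = cutoff_slope y * (f y * (\<Sum>b\<in>Basis. (y \<bullet> b) * pderiv_dir b g y) - g y * (\<Sum>b\<in>Basis. (y \<bullet> b) * pderiv_dir b f y))
        + cutoff y * (f y * laplacian g y - g y * laplacian f y)"
      by (simp add: laplacian_def sum.distrib sum_subtractf flip: sum_distrib_left)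
    also have "(\<Sum>b\<in>Basis. (y \<bullet> b) * pderiv_dir b g y) = 0"
      using euler_homogeneous[OF dg(1)[OF y\<Omega>], of 0] g(4) by simp
    also have "(\<Sum>b\<in>Basis. (y \<bullet> b) * pderiv_dir b f y) = 0"
      using euler_homogeneous[OF df(1)[OF y\<Omega>], of 0] f(4) by simp
    finally show ?thesis
      unfolding f(6)[OF y] g(6)[OF y] by (simp add: field_simps)
  qed
  have "(\<mu> - \<nu>) * (\<integral>y. half_space_weight y * (f y * g y) \<partial>lborel)
      = (\<integral>y. (\<mu> - \<nu>) * (half_space_weight y * (f y * g y)) \<partial>lborel)" by simp
  also have "\<dots> = (\<integral>y. (\<Sum>b\<in>Basis. indicator {y. snd y > 0} y * pderiv_dir b (W b) y) \<partial>lborel)"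
    by (intro Bochner_Integration.integral_cong refl)
      (auto simp: half_space_weight_def indicator_def div)
  also have "\<dots> = (\<Sum>b\<in>Basis. \<integral>y. indicator {y. snd y > 0} y * pderiv_dir b (W b) y \<partial>lborel)"
    by (rule Bochner_Integration.integral_sum) (rule int(1))
  also have "\<dots> = 0" using int(2) by simp
  finally show ?thesis .
qed

text \<open>
  In polar coordinates this is the \<open>L\<^sup>2\<close> product on the hemisphere times a positive radial integral.
\<close>

definition hprod :: "((real ^ 'n::finite) \<times> real \<Rightarrow> real) \<Rightarrow> ((real ^ 'n) \<times> real \<Rightarrow> real) \<Rightarrow> real" where
  "hprod u v = (\<integral>y. half_space_weight y * (u (sgn y) * v (sgn y)) \<partial>lborel)"

lemma hprod_eigenspace_orthogonal:
  fixes u v :: "(real ^ 'n::finite) \<times> real \<Rightarrow> real"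
  assumes "u \<in> neumann_eigenspace \<mu>" "v \<in> neumann_eigenspace \<nu>" "\<mu> \<noteq> \<nu>"
  shows "hprod u v = 0"
proof -
  obtain f where f: "cone_eigenfunction \<mu> f" "\<And>y. y \<in> closed_hemisphere \<Longrightarrow> u y = f y"
    using eigenspace_imp_cone[OF assms(1)] by blast
  obtain g where g: "cone_eigenfunction \<nu> g" "\<And>y. y \<in> closed_hemisphere \<Longrightarrow> v y = g y"
    using eigenspace_imp_cone[OF assms(2)] by blast
  have eq: "u (sgn y) = f y" "v (sgn y) = g y" if "snd y > 0" for y
  proof -
    have "y \<noteq> 0" using that by auto
    with that have y: "y \<noteq> 0" "sgn y \<in> closed_hemisphere" using sgn_in_closed_hemisphere[of y] by auto
    show "u (sgn y) = f y" "v (sgn y) = g y"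
      using f g y homogeneous_0_sgn[of f y] homogeneous_0_sgn[of g y] by (auto simp: cone_eigenfunction_def)
  qed
  have "hprod u v = (\<integral>y. half_space_weight y * (f y * g y) \<partial>lborel)"
    unfolding hprod_def
    by (intro Bochner_Integration.integral_cong refl) (auto simp: half_space_weight_def indicator_def eq)
  then show ?thesis using green_cone[OF f(1) g(1)] assms(3) by simp
qed

abbreviation half_annulus :: "((real ^ 'n::finite) \<times> real) set" where
  "half_annulus \<equiv> {y. snd y \<ge> 0 \<and> 1 \<le> norm y} \<inter> cball 0 2"

lemma compact_half_annulus: "compact (half_annulus :: ((real ^ 'n::finite) \<times> real) set)"
  by (intro closed_Int_compact compact_cball closed_Collect_conj closed_Collect_le continuous_intros)

lemma continuous_on_sgn_half_annulus:
  fixes u :: "(real ^ 'n::finite) \<times> real \<Rightarrow> real"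
  assumes "continuous_on closed_hemisphere u"
  shows "continuous_on {y. y \<noteq> 0 \<and> snd y \<ge> 0} (\<lambda>y. u (sgn y))"
  by (rule continuous_on_compose2[OF assms]) (auto intro!: continuous_on_sgn continuous_intros sgn_in_closed_hemisphere)

lemma integrable_half_space_weight:
  fixes F :: "(real ^ 'n::finite) \<times> real \<Rightarrow> real"
  assumes "continuous_on {y. y \<noteq> 0 \<and> snd y \<ge> 0} F"
  shows "integrable lborel (\<lambda>y. half_space_weight y * F y)"
proof -
  have "continuous_on half_annulus (\<lambda>y. cutoff y / (norm y)\<^sup>2 * F y)"
    by (intro continuous_intros continuous_on_subset[OF assms] Ck_on_imp_continuous_on[OF Ck_on_cutoff]) auto
  then have "integrable lborel (\<lambda>y. indicator {y. snd y > 0} y *\<^sub>R (indicator half_annulus y *\<^sub>R (cutoff y / (norm y)\<^sup>2 * F y)))"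
    by (intro integrable_mult_indicator borel_integrable_compact compact_half_annulus) (simp add: open_upper)
  moreover have "indicator {y. snd y > 0} y *\<^sub>R (indicator half_annulus y *\<^sub>R (cutoff y / (norm y)\<^sup>2 * F y)) = half_space_weight y * F y" for y
    using cutoff_eq_0[of y] by (cases "norm y \<le> 1 \<or> 2 \<le> norm y") (auto simp: half_space_weight_def indicator_def)
  ultimately show ?thesis by simp
qed

lemma half_space_weight_nonneg: "half_space_weight y \<ge> 0"
  by (simp add: half_space_weight_def cutoff_def)

lemma hprod_integrable:
  fixes u v :: "(real ^ 'n::finite) \<times> real \<Rightarrow> real"
  assumes "continuous_on closed_hemisphere u" "continuous_on closed_hemisphere v"
  shows "integrable lborel (\<lambda>y. half_space_weight y * (u (sgn y) * v (sgn y)))"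
  by (intro integrable_half_space_weight continuous_on_mult continuous_on_sgn_half_annulus assms)

lemma hprod_commute: "hprod u v = hprod v u"
  by (simp add: hprod_def mult.commute)

lemma hprod_cong:
  assumes "\<And>y. y \<in> closed_hemisphere \<Longrightarrow> u y = u' y" "\<And>y. y \<in> closed_hemisphere \<Longrightarrow> v y = v' y"
  shows "hprod u v = hprod u' v'"
  unfolding hprod_def
proof (intro Bochner_Integration.integral_cong refl)
  fix y :: "(real ^ 'a) \<times> real"
  show "half_space_weight y * (u (sgn y) * v (sgn y)) = half_space_weight y * (u' (sgn y) * v' (sgn y))"
  proof (cases "snd y > 0")
    case True
    then have "y \<noteq> 0" by auto
    then have "sgn y \<in> closed_hemisphere" using True sgn_in_closed_hemisphere[of y] by simp
    then show ?thesis by (simp add: assms del: split_paired_All)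
  qed (simp add: half_space_weight_def)
qed

lemma hprod_lincomb:
  fixes u v w :: "(real ^ 'n::finite) \<times> real \<Rightarrow> real"
  assumes "continuous_on closed_hemisphere u" "continuous_on closed_hemisphere v" "continuous_on closed_hemisphere w"
  shows "hprod (\<lambda>y. c * u y + v y) w = c * hprod u w + hprod v w"
proof -
  have "hprod (\<lambda>y. c * u y + v y) w = (\<integral>y. c * (half_space_weight y * (u (sgn y) * w (sgn y)))
      + half_space_weight y * (v (sgn y) * w (sgn y)) \<partial>lborel)"
    unfolding hprod_def by (intro Bochner_Integration.integral_cong refl) (simp add: algebra_simps)
  also have "\<dots> = c * hprod u w + hprod v w"
    unfolding hprod_def
    by (subst Bochner_Integration.integral_add) (auto intro!: hprod_integrable assms integrable_mult_right)
  finally show ?thesis .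
qed

text \<open>
  The weight is positive on an open half-annulus, so \<open>u (sgn y)\<close> vanishes almost everywhere there and
  hence everywhere by continuity. Scaling reaches the open hemisphere, and a limit the equator.
\<close>

lemma hprod_eq_0_imp:
  fixes u :: "(real ^ 'n::finite) \<times> real \<Rightarrow> real"
  assumes u: "continuous_on closed_hemisphere u" and "hprod u u = 0" and y: "y \<in> closed_hemisphere"
  shows "u y = 0"
proof -
  let ?F = "\<lambda>y. half_space_weight y * (u (sgn y) * u (sgn y))"
  let ?A = "{y::(real ^ 'n) \<times> real. snd y > 0} \<inter> {y. 1 < norm y} \<inter> {y. norm y < 2}"
  have oA: "open ?A" by (intro open_Int open_upper open_Collect_less continuous_intros)
  have cu: "continuous_on {y. y \<noteq> 0 \<and> snd y \<ge> 0} (\<lambda>y. u (sgn y))"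
    by (rule continuous_on_sgn_half_annulus[OF u])
  have "AE y in lborel. ?F y = 0"
    using assms(2) hprod_integrable[OF u u]
    by (subst integral_nonneg_eq_0_iff_AE[symmetric])
      (auto simp: hprod_def intro!: AE_I2 mult_nonneg_nonneg[OF half_space_weight_nonneg zero_le_square])
  then obtain Z where Z: "Z \<in> null_sets lborel" "{y. ?F y \<noteq> 0} \<subseteq> Z"
    by (auto simp: eventually_ae_filter)
  then have neg: "negligible Z"
    by (simp add: negligible_iff_null_sets null_sets_completionI)
  have annulus: "u (sgn y) = 0" if "y \<in> ?A" for y
  proof (rule ccontr)
    assume n: "u (sgn y) \<noteq> 0"
    define N where "N = {y \<in> ?A. u (sgn y) \<noteq> 0}"
    have "continuous_on ?A (\<lambda>y. u (sgn y))" by (rule continuous_on_subset[OF cu]) auto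
    then have "open (?A \<inter> (\<lambda>y. u (sgn y)) -` (- {0}))"
      using oA by (intro continuous_open_preimage) auto
    moreover have "?A \<inter> (\<lambda>y. u (sgn y)) -` (- {0}) = N" by (auto simp: N_def)
    ultimately have "open N" by simp
    moreover have "negligible N"
    proof -
      have "?F y \<noteq> 0" if "y \<in> N" for y
        using that cutoff_pos[of y] by (auto simp: N_def half_space_weight_def)
      then have "N \<subseteq> Z" using Z(2) by blast
      with neg show ?thesis by (rule negligible_subset)
    qed
    ultimately have "N = {}" using open_not_negligible by blast
    moreover have "y \<in> N" using n that unfolding N_def by blast
    ultimately show False by blast
  qed
  have pos: "u (sgn y) = 0" if "snd y > 0" for y
  proof -
    have y0: "y \<noteq> 0" using that by auto
    have "u (sgn ((3 / 2 / norm y) *\<^sub>R y)) = 0"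
      by (rule annulus) (use that y0 in auto)
    moreover have "sgn ((3 / 2 / norm y) *\<^sub>R y) = sgn y" using y0 by (simp add: sgn_scaleR)
    ultimately show ?thesis by simp
  qed
  have y1: "norm y = 1" "snd y \<ge> 0" using y by (auto simp: closed_hemisphere_iff)
  have y0: "y \<noteq> 0" using y1 by auto
  \<comment> \<open>The point may lie on the equator, so it is approached from above.\<close>
  let ?z = "\<lambda>n. y + inverse (real (Suc n)) *\<^sub>R (0, 1)"
  have zp: "snd (?z n) > 0" for n using y1 by (simp add: add_nonneg_pos)
  have "?z \<longlonglongrightarrow> y + 0 *\<^sub>R (0, 1)" by (intro tendsto_intros LIMSEQ_inverse_real_of_nat)
  then have "?z \<longlonglongrightarrow> y" by (simp add: zero_prod_def[symmetric])
  moreover have "?z n \<in> {y. y \<noteq> 0 \<and> snd y \<ge> 0}" for n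
    using zp[of n] by (auto simp del: snd_add)
  ultimately have "(\<lambda>n. u (sgn (?z n))) \<longlonglongrightarrow> u (sgn y)"
    using y0 y1 by (intro continuous_on_tendsto_compose[OF cu]) (auto intro!: always_eventually)
  moreover have "u (sgn (?z n)) = 0" for n by (rule pos[OF zp])
  ultimately have "u (sgn y) = 0" by (simp add: LIMSEQ_const_iff)
  then show ?thesis using y1 by (simp add: sgn_div_norm)
qed

section \<open>Completeness and the Neumann spectrum\<close>

text \<open>
  The space of functions on which \<open>hprod\<close> is a positive definite inner product, up to values outside
  the closed hemisphere.
\<close>

definition hemi_cont :: "((real ^ 'n::finite) \<times> real \<Rightarrow> real) \<Rightarrow> bool" where
  "hemi_cont u \<longleftrightarrow> continuous_on closed_hemisphere u"

lemma hemi_cont_lincomb: "hemi_cont u \<Longrightarrow> hemi_cont v \<Longrightarrow> hemi_cont (\<lambda>y. c * u y + v y)"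
  unfolding hemi_cont_def by (intro continuous_intros)

lemma hemi_cont_zero: "hemi_cont (\<lambda>y. 0)"
  by (simp add: hemi_cont_def)

lemma hemi_cont_span:
  assumes "v \<in> real_fun.span S" "\<And>s. s \<in> S \<Longrightarrow> hemi_cont s"
  shows "hemi_cont v"
  using assms(1) by (induction rule: real_fun_span_induct) (auto intro: hemi_cont_zero hemi_cont_lincomb assms(2))

lemma hprod_zero: "hprod (\<lambda>y. 0) w = 0"
  by (simp add: hprod_def)

lemma hprod_span_eq_0:
  assumes "v \<in> real_fun.span S" "\<And>s. s \<in> S \<Longrightarrow> hemi_cont s" "hemi_cont w"
    and "\<And>s. s \<in> S \<Longrightarrow> hprod s w = 0"
  shows "hprod v w = 0"
  using assms(1)
proof (induction rule: real_fun_span_induct)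
  case (step c s q)
  then have "hemi_cont q" "hemi_cont s" using hemi_cont_span assms(2) by auto
  then show ?case using step assms(3,4) by (simp add: hprod_lincomb hemi_cont_def)
qed (rule hprod_zero)

lemma hprod_minus:
  assumes "hemi_cont u" "hemi_cont v" "hemi_cont w"
  shows "hprod (\<lambda>y. u y - v y) w = hprod u w - hprod v w"
  using hprod_lincomb[of v u w "-1"] assms by (simp add: hemi_cont_def)

lemma hemi_cont_minus: "hemi_cont u \<Longrightarrow> hemi_cont v \<Longrightarrow> hemi_cont (\<lambda>y. u y - v y)"
  using hemi_cont_lincomb[of v u "-1"] by simp

text \<open>
  Gram-Schmidt: a new vector \<open>b\<close> is first made orthogonal to \<open>B\<close>. What remains of \<open>b\<close> may vanish on
  the hemisphere; then division by \<open>0\<close> gives the coefficient \<open>0\<close>, which is the correct one.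
\<close>

lemma hprod_projection:
  assumes "finite B" "\<And>b. b \<in> B \<Longrightarrow> hemi_cont b" "hemi_cont u"
  shows "\<exists>v\<in>real_fun.span B. \<forall>b\<in>B. hprod (\<lambda>y. u y - v y) b = 0"
  using assms
proof (induction B arbitrary: u rule: finite_induct)
  case empty
  then show ?case using real_fun_span_zero by blast
next
  case (insert b B)
  have cB: "\<And>b. b \<in> B \<Longrightarrow> hemi_cont b" and cb: "hemi_cont b" using insert.prems by auto
  obtain vb where vb: "vb \<in> real_fun.span B" "\<forall>c\<in>B. hprod (\<lambda>y. b y - vb y) c = 0"
    using insert.IH[OF cB cb] by blast
  obtain vu where vu: "vu \<in> real_fun.span B" "\<forall>c\<in>B. hprod (\<lambda>y. u y - vu y) c = 0"
    using insert.IH[OF cB insert.prems(2)] by blast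
  have cvb: "hemi_cont vb" and cvu: "hemi_cont vu" using vb vu hemi_cont_span cB by auto
  define e where "e y = b y - vb y" for y
  define r where "r y = u y - vu y" for y
  have ce: "hemi_cont e" and cr: "hemi_cont r"
    unfolding e_def[abs_def] r_def[abs_def] using cb cvb cvu insert.prems(2) by (auto intro: hemi_cont_minus)
  define c where "c = hprod r e / hprod e e"
  have ce0: "hprod r e - c * hprod e e = 0"
  proof (cases "hprod e e = 0")
    case True
    then have "e y = 0" if "y \<in> closed_hemisphere" for y
      using hprod_eq_0_imp[of e y] ce that by (simp add: hemi_cont_def)
    then have "hprod r e = hprod r (\<lambda>y. 0)" by (intro hprod_cong) auto
    then show ?thesis using True by (simp add: hprod_commute[of r] hprod_zero)
  qed (simp add: c_def)
  define v where "v y = c * e y + vu y" for y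
  have cv: "hemi_cont v" unfolding v_def[abs_def] by (rule hemi_cont_lincomb[OF ce cvu])
  have res: "(\<lambda>y. u y - v y) = (\<lambda>y. (- c) * e y + r y)" by (simp add: v_def r_def fun_eq_iff)
  have cres: "hemi_cont (\<lambda>y. u y - v y)" using cv insert.prems(2) by (rule hemi_cont_minus[rotated])
  have he: "hprod (\<lambda>y. u y - v y) w = (- c) * hprod e w + hprod r w" if "hemi_cont w" for w
    unfolding res using hprod_lincomb[of e r w "- c"] ce cr that by (simp add: hemi_cont_def)
  have sub: "real_fun.span B \<subseteq> real_fun.span (insert b B)" by (rule real_fun.span_mono) auto
  have orthB: "hprod (\<lambda>y. u y - v y) b' = 0" if "b' \<in> B" for b'
    using that vb(2) vu(2) he[OF cB[OF that]] by (simp add: e_def[abs_def] r_def[abs_def])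
  have "hprod (\<lambda>y. u y - v y) vb = 0"
    using hprod_span_eq_0[OF vb(1) cB cres] orthB by (simp add: hprod_commute)
  moreover have "hprod (\<lambda>y. u y - v y) e = 0" using he[OF ce] ce0 by simp
  moreover have "hprod (\<lambda>y. u y - v y) b = hprod (\<lambda>y. u y - v y) e + hprod (\<lambda>y. u y - v y) vb"
  proof -
    have "hprod e (\<lambda>y. u y - v y) = hprod b (\<lambda>y. u y - v y) - hprod vb (\<lambda>y. u y - v y)"
      unfolding e_def[abs_def] by (rule hprod_minus[OF cb cvb cres])
    then show ?thesis by (simp add: hprod_commute)
  qed
  ultimately have "hprod (\<lambda>y. u y - v y) b = 0" by simp
  moreover have "v \<in> real_fun.span (insert b B)"
  proof -
    have "vb \<in> real_fun.span (insert b B)" "vu \<in> real_fun.span (insert b B)" "b \<in> real_fun.span (insert b B)"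
      using vb vu sub by (auto intro: real_fun.span_base)
    moreover have "v = (\<lambda>y. (c * b y + (- c) * vb y) + vu y)" by (simp add: v_def e_def fun_eq_iff algebra_simps)
    ultimately show ?thesis by (simp only: real_fun_span_add real_fun_span_scale)
  qed
  ultimately show ?case using orthB by blast
qed

lemma hemi_cont_eigenspace:
  fixes u :: "(real ^ 'n::finite) \<times> real \<Rightarrow> real"
  assumes "u \<in> neumann_eigenspace \<mu>"
  shows "hemi_cont u"
proof -
  from assms obtain U F where "closed_hemisphere \<subseteq> U" "Ck_on 2 F U" "\<And>x. x \<in> closed_hemisphere \<Longrightarrow> F x = u x"
    by (auto simp: neumann_eigenspace_def C2_closed_hemisphere_def)
  then show ?thesis
    unfolding hemi_cont_def using Ck_on_imp_continuous_on continuous_on_subset continuous_on_cong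
    by (metis (no_types, lifting))
qed

lemma hemi_cont_harm_fun: "hemi_cont (harm_fun \<alpha>)"
  by (rule hemi_cont_eigenspace[OF harm_fun_eigenfunction])

lemma hemisphere_eigenvalue_strict_mono:
  assumes "l < m"
  shows "hemisphere_eigenvalue TYPE('n::finite) l < hemisphere_eigenvalue TYPE('n) m"
proof -
  have c: "real CARD('n) \<ge> 1" using zero_less_card_finite[where 'a='n] by linarith
  have "real l * (real l + real CARD('n) - 1) \<le> real l * (real m + real CARD('n) - 1)"
    using assms by (intro mult_left_mono) auto
  also have "\<dots> < real m * (real m + real CARD('n) - 1)"
  proof (rule mult_strict_right_mono)
    have "real m \<ge> 1" using assms by simp
    then show "0 < real m + real CARD('n) - 1" using c by linarith
  qed (use assms in simp)
  finally show ?thesis by (simp add: hemisphere_eigenvalue_def)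
qed

lemma hemisphere_eigenvalue_inj: "inj (hemisphere_eigenvalue TYPE('n::finite))"
  by (meson hemisphere_eigenvalue_strict_mono strict_mono_on_imp_inj_on strict_mono_onI)

lemma hprod_harm_fun_orthogonal:
  fixes \<alpha> \<beta> :: "'n::finite \<Rightarrow> nat"
  assumes "mdeg \<alpha> \<noteq> mdeg \<beta>"
  shows "hprod (harm_fun \<alpha>) (harm_fun \<beta>) = 0"
  using hprod_eigenspace_orthogonal[OF harm_fun_eigenfunction harm_fun_eigenfunction] assms
    hemisphere_eigenvalue_inj by (metis injD)

lemma hemi_cont_sum:
  assumes "\<And>i. i \<in> I \<Longrightarrow> hemi_cont (p i)"
  shows "hemi_cont (\<lambda>y. \<Sum>i\<in>I. c i * p i y)"
  using assms unfolding hemi_cont_def by (intro continuous_intros) auto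

lemma hprod_sum:
  assumes "finite I" "\<And>i. i \<in> I \<Longrightarrow> hemi_cont (p i)" "hemi_cont w"
  shows "hprod (\<lambda>y. \<Sum>i\<in>I. c i * p i y) w = (\<Sum>i\<in>I. c i * hprod (p i) w)"
  using assms(1,2)
proof (induction I rule: finite_induct)
  case (insert i I)
  then have "hemi_cont (\<lambda>y. \<Sum>i\<in>I. c i * p i y)" "hemi_cont (p i)" by (auto intro: hemi_cont_sum)
  then show ?case using insert assms(3) by (simp add: hprod_lincomb hemi_cont_def)
qed (simp add: hprod_zero)

text \<open>
  Orthogonality of the levels isolates the part \<open>P\<close> of degree \<open>l\<close>, which is then orthogonal to itself.
  On the equator \<open>P\<close> is a homogeneous polynomial whose coefficients are the given ones.
\<close>

lemma harm_fun_independent_family: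
  fixes X :: "('n::finite \<Rightarrow> nat) set"
  assumes X: "finite X" and 0: "\<And>y. (\<Sum>\<alpha>\<in>X. c \<alpha> * harm_fun \<alpha> y) = 0" and \<alpha>: "\<alpha> \<in> X"
  shows "c \<alpha> = 0"
proof -
  define l where "l = mdeg \<alpha>"
  define Xl where "Xl = {\<beta>\<in>X. mdeg \<beta> = l}"
  define P where "P y = (\<Sum>\<beta>\<in>Xl. c \<beta> * harm_fun \<beta> y)" for y
  have fX: "finite Xl" "Xl \<subseteq> X" using X by (auto simp: Xl_def)
  have cP: "hemi_cont P" unfolding P_def[abs_def] by (intro hemi_cont_sum hemi_cont_harm_fun)
  have orth: "hprod (harm_fun \<beta>) P = 0" if "\<beta> \<in> X - Xl" for \<beta>
  proof -
    have "hprod P (harm_fun \<beta>) = (\<Sum>\<gamma>\<in>Xl. c \<gamma> * hprod (harm_fun \<gamma>) (harm_fun \<beta>))"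
      unfolding P_def[abs_def] by (intro hprod_sum fX hemi_cont_harm_fun)
    also have "\<dots> = 0"
      using that by (intro sum.neutral) (auto simp: Xl_def intro: hprod_harm_fun_orthogonal)
    finally show ?thesis by (simp add: hprod_commute)
  qed
  have "hprod (\<lambda>y. \<Sum>\<beta>\<in>X. c \<beta> * harm_fun \<beta> y) P = (\<Sum>\<beta>\<in>X. c \<beta> * hprod (harm_fun \<beta>) P)"
    by (intro hprod_sum X hemi_cont_harm_fun cP)
  also have "\<dots> = (\<Sum>\<beta>\<in>Xl. c \<beta> * hprod (harm_fun \<beta>) P)"
    using orth by (intro sum.mono_neutral_right X fX(2)) auto
  also have "\<dots> = hprod P P"
    unfolding P_def[abs_def] by (intro hprod_sum[symmetric] fX hemi_cont_harm_fun cP[unfolded P_def[abs_def]])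
  finally have PP: "hprod P P = 0" using 0 by (simp add: hprod_zero)
  have P0: "P y = 0" if "y \<in> closed_hemisphere" for y
    using hprod_eq_0_imp[OF _ PP that] cP by (simp add: hemi_cont_def)
  have unit: "(\<Sum>\<beta>\<in>Xl. c \<beta> * monomial \<beta> v) = 0" if "norm v = 1" for v
  proof -
    have ch: "(v, 0) \<in> closed_hemisphere" using that by (simp add: closed_hemisphere_iff norm_Pair)
    then show ?thesis using P0[OF ch] by (simp add: P_def harm_fun_def harm_ext_equator)
  qed
  have "(\<Sum>\<beta>\<in>Xl. c \<beta> * monomial \<beta> x) = 0" for x :: "real ^ 'n"
  proof -
    \<comment> \<open>Every point, the origin included, is \<open>norm x\<close> times a unit vector.\<close>
    obtain e :: "real ^ 'n" where e: "norm e = 1" using vector_choose_size[of 1] by auto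
    obtain v where v: "norm v = 1" "x = norm x *\<^sub>R v"
    proof (cases "x = 0")
      case True
      then show ?thesis using that[of e] e by simp
    next
      case False
      then show ?thesis using that[of "sgn x"] by (simp add: norm_sgn sgn_div_norm)
    qed
    have "(\<Sum>\<beta>\<in>Xl. c \<beta> * monomial \<beta> x) = (\<Sum>\<beta>\<in>Xl. norm x ^ l * (c \<beta> * monomial \<beta> v))"
      by (subst v(2)) (auto simp: monomial_scale Xl_def intro!: sum.cong)
    also have "\<dots> = 0" using unit[OF v(1)] by (simp flip: sum_distrib_left)
    finally show ?thesis .
  qed
  from monomials_independent[OF fX(1) this] \<alpha> show ?thesis by (simp add: Xl_def l_def)
qed

lemma real_fun_independent_family:
  fixes p :: "'i \<Rightarrow> 'a \<Rightarrow> real"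
  assumes X: "finite X" and ind: "\<And>c \<alpha>. (\<And>y. (\<Sum>\<alpha>\<in>X. c \<alpha> * p \<alpha> y) = 0) \<Longrightarrow> \<alpha> \<in> X \<Longrightarrow> c \<alpha> = 0"
  shows "inj_on p X" "real_fun.independent (p ` X)"
proof -
  show inj: "inj_on p X"
  proof (rule inj_onI, rule ccontr)
    fix a b assume ab: "a \<in> X" "b \<in> X" "p a = p b" "a \<noteq> b"
    \<comment> \<open>If \<open>p a = p b\<close>, then \<open>p a - p b = 0\<close> is a nontrivial relation.\<close>
    define c :: "'i \<Rightarrow> real" where "c i = (if i = a then 1 else if i = b then - 1 else 0)" for i
    have "(\<Sum>\<alpha>\<in>X. c \<alpha> * p \<alpha> y) = 0" for y
    proof -
      have "(\<Sum>\<alpha>\<in>X. c \<alpha> * p \<alpha> y) = (\<Sum>\<alpha>\<in>{a, b}. c \<alpha> * p \<alpha> y)"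
        using ab X by (intro sum.mono_neutral_right) (auto simp: c_def)
      then show ?thesis using ab by (simp add: c_def)
    qed
    from ind[OF this ab(1)] show False by (simp add: c_def)
  qed
  show "real_fun.independent (p ` X)"
  proof (rule real_fun.independent_if_scalars_zero)
    fix c u assume 0: "(\<Sum>v\<in>p ` X. (\<lambda>y. c v * v y)) = 0" and u: "u \<in> p ` X"
    have sa: "(\<Sum>v\<in>V. (\<lambda>y. c v * v y)) y = (\<Sum>v\<in>V. c v * v y)" for V and y :: 'a
      by (induction V rule: infinite_finite_induct) (auto simp: zero_fun_def plus_fun_def)
    have "(\<Sum>v\<in>p ` X. c v * v y) = 0" for y
      using fun_cong[OF 0, of y] unfolding sa by (simp add: zero_fun_def)
    then have "(\<Sum>\<alpha>\<in>X. c (p \<alpha>) * p \<alpha> y) = 0" for y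
      by (simp add: sum.reindex[OF inj])
    from ind[OF this] u show "c u = 0" by auto
  qed (use X in simp)
qed

lemma harm_fun_independent:
  fixes X :: "('n::finite \<Rightarrow> nat) set"
  assumes "finite X"
  shows "inj_on harm_fun X" "real_fun.independent (harm_fun ` X)"
  using real_fun_independent_family[of X harm_fun] harm_fun_independent_family[OF assms] assms
  by blast+

definition hemi_polys :: "nat \<Rightarrow> ((real ^ 'n::finite) \<times> real \<Rightarrow> real) set" where
  "hemi_polys m = real_fun.span ((\<lambda>\<beta> y. if y \<in> closed_hemisphere then monomial \<beta> (fst y) else 0) ` {\<beta>. mdeg \<beta> \<le> m})"

lemma polys_imp_hemi_polys:
  fixes p :: "real ^ 'n::finite \<Rightarrow> real"
  assumes "p \<in> polys m"
  shows "(\<lambda>y. if y \<in> closed_hemisphere then p (fst y) else 0) \<in> hemi_polys m"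
  using assms
proof (induction rule: polys_induct)
  case zero
  then show ?case by (simp add: hemi_polys_def real_fun_span_zero cong: if_cong)
next
  case (step c \<beta> q)
  have "(\<lambda>y. if y \<in> closed_hemisphere then monomial \<beta> (fst y) else 0) \<in> hemi_polys m"
    unfolding hemi_polys_def using step(1) by (auto intro: real_fun.span_base)
  then have "(\<lambda>y. c * (if y \<in> closed_hemisphere then monomial \<beta> (fst y) else 0)
      + (if y \<in> closed_hemisphere then q (fst y) else 0)) \<in> hemi_polys m"
    using step(3) unfolding hemi_polys_def by (intro real_fun_span_add real_fun_span_scale)
  moreover have "(\<lambda>y. c * (if y \<in> closed_hemisphere then monomial \<beta> (fst y) else 0)
      + (if y \<in> closed_hemisphere then q (fst y) else 0))
    = (\<lambda>y. if y \<in> closed_hemisphere then c * monomial \<beta> (fst y) + q (fst y) else 0)" by auto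
  ultimately show ?case by simp
qed

text \<open>
  The functions on the right are independent, lie in the span on the left and are at least as many as
  its generators, so no generator can be missed.
\<close>

lemma hemi_polys_eq_span_harm_fun:
  "hemi_polys m = real_fun.span ((harm_fun :: ('n::finite \<Rightarrow> nat) \<Rightarrow> _) ` {\<alpha>. mdeg \<alpha> \<le> m})"
proof -
  let ?X = "{\<alpha>::'n \<Rightarrow> nat. mdeg \<alpha> \<le> m}"
  let ?M = "(\<lambda>\<beta> y. if y \<in> closed_hemisphere then monomial \<beta> (fst y) else 0) ` ?X"
  note fam = harm_fun_independent[OF finite_multi_index_le[of m, where 'n='n]]
  have sub: "harm_fun ` ?X \<subseteq> real_fun.span ?M"
  proof
    fix u assume "u \<in> harm_fun ` ?X"
    then obtain \<alpha> :: "'n \<Rightarrow> nat" where a: "mdeg \<alpha> \<le> m" "u = harm_fun \<alpha>" by auto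
    obtain p where p: "p \<in> polys (mdeg \<alpha>)" "\<And>y. y \<in> sphere 0 1 \<Longrightarrow> harm_ext \<alpha> y = p (fst y)"
      using harm_ext_sphere[of \<alpha>] by blast
    have "u = (\<lambda>y. if y \<in> closed_hemisphere then p (fst y) else 0)"
      using p(2) by (auto simp: a harm_fun_def fun_eq_iff closed_hemisphere_def)
    then show "u \<in> real_fun.span ?M"
      using polys_imp_hemi_polys[OF polys_mono[OF p(1) a(1)]] by (simp add: hemi_polys_def)
  qed
  show ?thesis
  proof (rule antisym)
    have fM: "finite ?M" using finite_multi_index_le by blast
    have "?M \<subseteq> real_fun.span (harm_fun ` ?X)"
    proof (rule ccontr)
      assume "\<not> ?M \<subseteq> real_fun.span (harm_fun ` ?X)"
      then obtain v where v: "v \<in> ?M" "v \<notin> real_fun.span (harm_fun ` ?X)" by blast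
      have "real_fun.independent (insert v (harm_fun ` ?X))"
        using v(2) fam(2) by (rule real_fun.independent_insertI)
      moreover have "insert v (harm_fun ` ?X) \<subseteq> real_fun.span ?M"
        using sub v(1) by (auto intro: real_fun.span_base)
      ultimately have "card (insert v (harm_fun ` ?X)) \<le> card ?M"
        using real_fun.independent_span_bound[OF fM] by blast
      moreover have "v \<notin> harm_fun ` ?X" using v(2) by (rule contrapos_nn) (rule real_fun.span_base)
      moreover have "card (harm_fun ` ?X) = card ?X" by (rule card_image[OF fam(1)])
      moreover have "card ?M \<le> card ?X" by (rule card_image_le[OF finite_multi_index_le])
      moreover have "finite (harm_fun ` ?X)" by (rule finite_imageI[OF finite_multi_index_le])
      ultimately show False by (simp del: image_iff)
    qed
    then show "hemi_polys m \<subseteq> real_fun.span (harm_fun ` ?X)"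
      unfolding hemi_polys_def by (intro real_fun.span_minimal real_fun.subspace_span)
    show "real_fun.span (harm_fun ` ?X) \<subseteq> hemi_polys m"
      unfolding hemi_polys_def using sub by (intro real_fun.span_minimal real_fun.subspace_span)
  qed
qed

text \<open>
  Projecting to the first factor identifies the closed hemisphere with the unit ball of
  \<open>\<real>\<^sup>d\<close>, where polynomials are dense.
\<close>

lemma harm_fun_dense:
  fixes u :: "(real ^ 'n::finite) \<times> real \<Rightarrow> real"
  assumes u: "hemi_cont u" and e: "e > 0"
  shows "\<exists>m. \<exists>v\<in>real_fun.span ((harm_fun :: ('n \<Rightarrow> nat) \<Rightarrow> _) ` {\<alpha>. mdeg \<alpha> \<le> m}).
    \<forall>y\<in>closed_hemisphere. \<bar>u y - v y\<bar> < e"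
proof -
  let ?\<sigma> = "\<lambda>x::real^'n. (x, sqrt (1 - (norm x)\<^sup>2))"
  have "?\<sigma> ` cball 0 1 \<subseteq> closed_hemisphere"
  proof
    fix y assume "y \<in> ?\<sigma> ` cball 0 1"
    then obtain x where x: "y = ?\<sigma> x" "norm x \<le> 1" by auto
    then have "(norm x)\<^sup>2 \<le> 1" by (simp add: power_le_one)
    then show "y \<in> closed_hemisphere" using x by (simp add: closed_hemisphere_iff norm_Pair)
  qed
  moreover have "continuous_on (cball 0 1) ?\<sigma>" by (intro continuous_intros)
  ultimately have "continuous_on (cball 0 1) (\<lambda>x. u (?\<sigma> x))"
    using u continuous_on_compose2[of closed_hemisphere u "cball 0 1" ?\<sigma>] by (simp add: hemi_cont_def)
  from Stone_Weierstrass_real_polynomial_function[OF compact_cball this e]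
  obtain p where p: "real_polynomial_function p" "\<And>x. x \<in> cball 0 1 \<Longrightarrow> \<bar>u (?\<sigma> x) - p x\<bar> < e"
    by blast
  obtain m where m: "p \<in> polys m" using real_polynomial_function_in_polys[OF p(1)] by blast
  let ?v = "\<lambda>y. if y \<in> closed_hemisphere then p (fst y) else 0"
  have "?v \<in> real_fun.span ((harm_fun :: ('n \<Rightarrow> nat) \<Rightarrow> _) ` {\<alpha>. mdeg \<alpha> \<le> m})"
    using polys_imp_hemi_polys[OF m] by (simp add: hemi_polys_eq_span_harm_fun)
  moreover have "\<bar>u y - ?v y\<bar> < e" if y: "y \<in> closed_hemisphere" for y
  proof -
    have n: "(norm (fst y))\<^sup>2 + (snd y)\<^sup>2 = 1" "snd y \<ge> 0"
      using y by (cases y; simp add: closed_hemisphere_iff norm_Pair real_sqrt_eq_1_iff)+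
    have "sqrt (1 - (norm (fst y))\<^sup>2) = snd y"
      using n by (intro real_sqrt_unique) auto
    then have "?\<sigma> (fst y) = y" by (simp add: prod_eq_iff)
    moreover have "fst y \<in> cball 0 1"
    proof -
      have "(norm (fst y))\<^sup>2 \<le> 1" using n(1) zero_le_power2[of "snd y"] by linarith
      then show ?thesis using power2_le_imp_le[of "norm (fst y)" 1] by simp
    qed
    ultimately show ?thesis using p(2)[of "fst y"] y by simp
  qed
  ultimately show ?thesis by (intro exI[of _ m] bexI[of _ ?v] ballI)
qed

text \<open>
  If \<open>v\<close> is a combination of the \<open>harm_fun \<alpha>\<close> within \<open>e\<close> of \<open>u\<close>, then
  \<open>\<langle>u, u\<rangle> = \<langle>u - v, u\<rangle> \<le> e C\<close> with \<open>C\<close> independent of \<open>e\<close>.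
\<close>

lemma harm_fun_complete:
  fixes u :: "(real ^ 'n::finite) \<times> real \<Rightarrow> real"
  assumes u: "hemi_cont u" and orth: "\<And>\<alpha>. hprod u (harm_fun \<alpha>) = 0" and y: "y \<in> closed_hemisphere"
  shows "u y = 0"
proof -
  define C where "C = (\<integral>y. half_space_weight y * \<bar>u (sgn y)\<bar> \<partial>lborel)"
  have ci: "integrable lborel (\<lambda>y. half_space_weight y * \<bar>u (sgn y)\<bar>)"
    using u by (intro integrable_half_space_weight continuous_on_rabs continuous_on_sgn_half_annulus) (simp add: hemi_cont_def)
  have C0: "C \<ge> 0" unfolding C_def
    by (intro Bochner_Integration.integral_nonneg mult_nonneg_nonneg half_space_weight_nonneg) auto
  have le: "\<bar>hprod u u\<bar> \<le> e * C" if e: "e > 0" for e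
  proof -
    from harm_fun_dense[OF u e] obtain m v
      where v: "v \<in> real_fun.span ((harm_fun :: ('n \<Rightarrow> nat) \<Rightarrow> _) ` {\<alpha>. mdeg \<alpha> \<le> m})"
        and ve: "\<And>y. y \<in> closed_hemisphere \<Longrightarrow> \<bar>u y - v y\<bar> < e" by blast
    have cv: "hemi_cont v" using hemi_cont_span[OF v] hemi_cont_harm_fun by auto
    have cd: "hemi_cont (\<lambda>y. u y - v y)" by (rule hemi_cont_minus[OF u cv])
    have "hprod v u = 0"
      by (rule hprod_span_eq_0[OF v]) (auto simp: hprod_commute[of _ u] orth hemi_cont_harm_fun u)
    then have "hprod u u = hprod (\<lambda>y. u y - v y) u" using hprod_minus[OF u cv u] by simp
    also have "\<bar>\<dots>\<bar> \<le> (\<integral>y. \<bar>half_space_weight y * ((u (sgn y) - v (sgn y)) * u (sgn y))\<bar> \<partial>lborel)"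
      unfolding hprod_def by (rule integral_abs_bound)
    also have "\<dots> \<le> (\<integral>y. e * (half_space_weight y * \<bar>u (sgn y)\<bar>) \<partial>lborel)"
    proof (rule integral_mono)
      show "integrable lborel (\<lambda>y. \<bar>half_space_weight y * ((u (sgn y) - v (sgn y)) * u (sgn y))\<bar>)"
        using hprod_integrable[of "\<lambda>y. u y - v y" u] cd u by (intro integrable_abs) (simp add: hemi_cont_def)
      show "integrable lborel (\<lambda>y. e * (half_space_weight y * \<bar>u (sgn y)\<bar>))"
        by (intro integrable_mult_right ci)
      fix y :: "(real ^ 'n) \<times> real"
      show "\<bar>half_space_weight y * ((u (sgn y) - v (sgn y)) * u (sgn y))\<bar> \<le> e * (half_space_weight y * \<bar>u (sgn y)\<bar>)"
      proof (cases "snd y > 0")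
        case True
        then have "y \<noteq> 0" by auto
        then have "\<bar>u (sgn y) - v (sgn y)\<bar> \<le> e" using True ve sgn_in_closed_hemisphere[of y] by (simp add: less_imp_le)
        then have "half_space_weight y * \<bar>u (sgn y)\<bar> * \<bar>u (sgn y) - v (sgn y)\<bar> \<le> half_space_weight y * \<bar>u (sgn y)\<bar> * e"
          by (intro mult_left_mono mult_nonneg_nonneg half_space_weight_nonneg) auto
        then show ?thesis using half_space_weight_nonneg[of y] by (simp add: abs_mult mult_ac)
      qed (simp add: half_space_weight_def)
    qed
    also have "\<dots> = e * C" by (simp add: C_def)
    finally show ?thesis .
  qed
  have "hprod u u = 0"
  proof (rule ccontr)
    assume n: "hprod u u \<noteq> 0"
    have "\<bar>hprod u u\<bar> \<le> \<bar>hprod u u\<bar> / (2 * (C + 1)) * C" by (rule le) (use n C0 in simp)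
    also have "\<dots> \<le> \<bar>hprod u u\<bar> / 2" using C0 by (simp add: field_simps)
    finally show False using n by simp
  qed
  then show ?thesis using hprod_eq_0_imp[OF _ _ y] u by (simp add: hemi_cont_def)
qed

text \<open>
  The part of \<open>u\<close> left after projection is orthogonal to the functions \<open>harm_fun \<alpha>\<close> of eigenvalue
  \<open>\<mu>\<close> by construction and to all others by Green's formula. For \<open>\<mu>\<close> not of the form
  \<open>l (l + d - 1)\<close> the right-hand side is the zero space.
\<close>

lemma neumann_eigenspace_eq_span:
  "(neumann_eigenspace \<mu> :: ((real ^ 'n::finite) \<times> real \<Rightarrow> real) set)
     = real_fun.span (harm_fun ` {\<alpha>. hemisphere_eigenvalue TYPE('n) (mdeg \<alpha>) = \<mu>})"
proof (rule antisym)
  let ?X = "{\<alpha>::'n \<Rightarrow> nat. hemisphere_eigenvalue TYPE('n) (mdeg \<alpha>) = \<mu>}"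
  show "real_fun.span (harm_fun ` ?X) \<subseteq> neumann_eigenspace \<mu>"
    by (intro real_fun.span_minimal subspace_neumann_eigenspace) (use harm_fun_eigenfunction in blast)
  have fX: "finite ?X"
  proof (cases "?X = {}")
    case False
    then obtain l where "hemisphere_eigenvalue TYPE('n) l = \<mu>" by blast
    then have "?X \<subseteq> {\<alpha>. mdeg \<alpha> = l}" using hemisphere_eigenvalue_inj[where 'n='n] by (auto dest: injD)
    then show ?thesis by (rule finite_subset[OF _ finite_multi_index_eq])
  qed simp
  show "neumann_eigenspace \<mu> \<subseteq> real_fun.span (harm_fun ` ?X)"
  proof
    fix u :: "(real ^ 'n) \<times> real \<Rightarrow> real" assume u: "u \<in> neumann_eigenspace \<mu>"
    have cu: "hemi_cont u" by (rule hemi_cont_eigenspace[OF u])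
    obtain v where v: "v \<in> real_fun.span (harm_fun ` ?X)"
      and vo: "\<And>b. b \<in> harm_fun ` ?X \<Longrightarrow> hprod (\<lambda>y. u y - v y) b = 0"
    proof -
      have "hemi_cont b" if "b \<in> harm_fun ` ?X" for b using that hemi_cont_harm_fun by auto
      from hprod_projection[OF finite_imageI[OF fX] this cu] that show ?thesis by blast
    qed
    have cv: "hemi_cont v" using hemi_cont_span[OF v] hemi_cont_harm_fun by auto
    have cd: "hemi_cont (\<lambda>y. u y - v y)" by (rule hemi_cont_minus[OF cu cv])
    have orth: "hprod (\<lambda>y. u y - v y) (harm_fun \<alpha>) = 0" for \<alpha>
    proof (cases "\<alpha> \<in> ?X")
      case False
      then have "hprod u (harm_fun \<alpha>) = 0"
        by (intro hprod_eigenspace_orthogonal[OF u harm_fun_eigenfunction]) auto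
      moreover have "hprod v (harm_fun \<alpha>) = 0"
        by (rule hprod_span_eq_0[OF v])
          (use False in \<open>auto intro!: hprod_harm_fun_orthogonal hemi_cont_harm_fun\<close>)
      ultimately show ?thesis using hprod_minus[OF cu cv hemi_cont_harm_fun] by simp
    qed (use vo in blast)
    have "u y = v y" for y
    proof (cases "y \<in> closed_hemisphere")
      case True
      then show ?thesis using harm_fun_complete[OF cd orth True] by simp
    next
      case False
      have "v y = 0" using v
        by (induction rule: real_fun_span_induct) (use False in \<open>auto simp: harm_fun_def\<close>)
      moreover have "u y = 0" using u False unfolding neumann_eigenspace_def by blast
      ultimately show ?thesis by simp
    qed
    then show "u \<in> real_fun.span (harm_fun ` ?X)" using v by (metis ext)
  qed
qed

lemma neumann_multiplicity_eigenvalue: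
  "neumann_multiplicity TYPE('n::finite) (hemisphere_eigenvalue TYPE('n) l) = card {\<alpha>::'n \<Rightarrow> nat. mdeg \<alpha> = l}"
proof -
  let ?X = "{\<alpha>::'n \<Rightarrow> nat. mdeg \<alpha> = l}"
  note fam = harm_fun_independent[OF finite_multi_index_eq[of l, where 'n='n]]
  have "{\<alpha>::'n \<Rightarrow> nat. hemisphere_eigenvalue TYPE('n) (mdeg \<alpha>) = hemisphere_eigenvalue TYPE('n) l} = ?X"
    using hemisphere_eigenvalue_inj[where 'n='n] by (auto dest: injD)
  then have "neumann_multiplicity TYPE('n) (hemisphere_eigenvalue TYPE('n) l) = real_fun.dim (harm_fun ` ?X)"
    by (simp add: neumann_multiplicity_def neumann_eigenspace_eq_span)
  also have "\<dots> = card (harm_fun ` ?X)" by (rule real_fun.dim_eq_card_independent[OF fam(2)])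
  also have "\<dots> = card ?X" by (rule card_image[OF fam(1)])
  finally show ?thesis .
qed

lemma neumann_eigenvalues_eq: "neumann_eigenvalues TYPE('n::finite) = range (hemisphere_eigenvalue TYPE('n))"
proof (intro equalityI subsetI)
  fix \<mu> assume "\<mu> \<in> neumann_eigenvalues TYPE('n)"
  then obtain u :: "(real ^ 'n) \<times> real \<Rightarrow> real" where u: "u \<in> neumann_eigenspace \<mu>" "u \<noteq> 0"
    by (auto simp: neumann_eigenvalues_def)
  show "\<mu> \<in> range (hemisphere_eigenvalue TYPE('n))"
  proof (rule ccontr)
    assume "\<mu> \<notin> range (hemisphere_eigenvalue TYPE('n))"
    then have "{\<alpha>::'n \<Rightarrow> nat. hemisphere_eigenvalue TYPE('n) (mdeg \<alpha>) = \<mu>} = {}" by auto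
    then show False using u by (simp add: neumann_eigenspace_eq_span)
  qed
next
  fix \<mu> assume "\<mu> \<in> range (hemisphere_eigenvalue TYPE('n))"
  then obtain l where l: "\<mu> = hemisphere_eigenvalue TYPE('n) l" by auto
  obtain i :: 'n where True by blast
  define \<alpha> :: "'n \<Rightarrow> nat" where "\<alpha> j = (if j = i then l else 0)" for j
  have md: "mdeg \<alpha> = l" by (simp add: mdeg_def \<alpha>_def)
  have "harm_fun \<alpha> \<noteq> 0"
    using harm_fun_independent_family[of "{\<alpha>}" "\<lambda>_. 1" \<alpha>] by (auto simp: zero_fun_def)
  then show "\<mu> \<in> neumann_eigenvalues TYPE('n)"
    using harm_fun_eigenfunction[of \<alpha>] md l by (auto simp: neumann_eigenvalues_def)
qed

text \<open>
  Since \<open>t (t + d - 1)\<close> increases for \<open>t \<ge> 0\<close>, the levels not exceeding \<open>z\<close> are those with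
  \<open>l \<le> w\<close>.
\<close>

lemma neumann_counting_eq:
  assumes w: "w \<ge> 0" "w * (w + real CARD('n::finite) - 1) = z"
  shows "neumann_counting TYPE('n) z = (nat \<lfloor>w\<rfloor> + CARD('n)) choose CARD('n)"
proof -
  let ?ev = "hemisphere_eigenvalue TYPE('n)"
  have c: "real CARD('n) \<ge> 1" using zero_less_card_finite[where 'a='n] by linarith
  have le: "?ev l \<le> z \<longleftrightarrow> l \<le> nat \<lfloor>w\<rfloor>" for l
  proof -
    have "?ev l \<le> z \<longleftrightarrow> real l \<le> w"
    proof
      assume "real l \<le> w"
      then show "?ev l \<le> z" unfolding hemisphere_eigenvalue_def w(2)[symmetric]
        using c w(1) of_nat_0_le_iff[where 'a = real, of l] by (intro mult_mono; linarith)
    next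
      assume a: "?ev l \<le> z"
      show "real l \<le> w"
      proof (rule ccontr)
        assume "\<not> real l \<le> w"
        then have lw: "w < real l" by simp
        have "w * (w + real CARD('n) - 1) \<le> w * (real l + real CARD('n) - 1)"
          using lw w(1) by (intro mult_left_mono) auto
        also have "\<dots> < real l * (real l + real CARD('n) - 1)"
          using lw w(1) c by (intro mult_strict_right_mono; linarith)
        finally show False using a by (simp add: hemisphere_eigenvalue_def w(2))
      qed
    qed
    moreover have "real l \<le> w \<longleftrightarrow> l \<le> nat \<lfloor>w\<rfloor>"
      using w(1) by (simp add: le_nat_iff le_floor_iff)
    ultimately show ?thesis by simp
  qed
  have "{\<mu> \<in> neumann_eigenvalues TYPE('n). \<mu> \<le> z} = ?ev ` {..nat \<lfloor>w\<rfloor>}"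
    unfolding neumann_eigenvalues_eq using le by auto
  then have "neumann_counting TYPE('n) z = (\<Sum>l\<le>nat \<lfloor>w\<rfloor>. neumann_multiplicity TYPE('n) (?ev l))"
    unfolding neumann_counting_def
    by (simp add: sum.reindex inj_on_subset[OF hemisphere_eigenvalue_inj])
  also have "\<dots> = (\<Sum>l\<le>nat \<lfloor>w\<rfloor>. card {\<alpha>::'n \<Rightarrow> nat. mdeg \<alpha> = l})"
    by (simp add: neumann_multiplicity_eigenvalue)
  finally show ?thesis by (simp add: sum_card_multi_index)
qed

section \<open>Expansion of the binomial coefficient\<close>

lemma binomial_mult_fact_eq_prod:
  "real ((L + d) choose d) * fact d = (\<Prod>j<d. real L + 1 + real j)"
proof (induction d)
  case (Suc d)
  have "Suc (L + d) * ((L + d) choose d) = (Suc (L + d) choose Suc d) * Suc d"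
    by (rule Suc_times_binomial_eq)
  then have "real ((L + Suc d) choose Suc d) * real (Suc d) = real (Suc (L + d)) * real ((L + d) choose d)"
    by (metis add_Suc_right of_nat_mult)
  then have "real ((L + Suc d) choose Suc d) * fact (Suc d) = real (Suc (L + d)) * (real ((L + d) choose d) * fact d)"
    by (simp add: fact_Suc del: of_nat_Suc binomial_Suc_Suc)
  then show ?case
    by (simp only: Suc.IH prod.lessThan_Suc) (simp add: algebra_simps)
qed simp

lemma bigo_mult_bounded:
  fixes f g h :: "real \<Rightarrow> real"
  shows "f \<in> O[F](h) \<Longrightarrow> g \<in> O[F](\<lambda>_. 1) \<Longrightarrow> (\<lambda>x. f x * g x) \<in> O[F](h)"
  using landau_o.big.mult[of f F h g "\<lambda>_. 1"] by simp

text \<open>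
  The coefficient of \<open>\<zeta>\<^sup>2\<close> collects one \<open>b\<close> from each factor and the second elementary symmetric
  function of the \<open>a\<^sub>j\<close>, in terms of power sums.
\<close>

lemma prod_second_order_expansion:
  fixes a f :: "'i \<Rightarrow> real \<Rightarrow> real" and \<zeta> :: "real \<Rightarrow> real"
  assumes "finite J" and \<zeta>: "\<zeta> \<in> O[F](\<lambda>_. 1)"
    and "\<And>j. j \<in> J \<Longrightarrow> a j \<in> O[F](\<lambda>_. 1)"
    and "\<And>j. j \<in> J \<Longrightarrow> (\<lambda>z. f j z - (1 + a j z * \<zeta> z + b * \<zeta> z ^ 2)) \<in> O[F](\<lambda>z. \<zeta> z ^ 3)"
  shows "(\<lambda>z. (\<Prod>j\<in>J. f j z) - (1 + (\<Sum>j\<in>J. a j z) * \<zeta> z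
      + (real (card J) * b + ((\<Sum>j\<in>J. a j z)\<^sup>2 - (\<Sum>j\<in>J. (a j z)\<^sup>2)) / 2) * \<zeta> z ^ 2)) \<in> O[F](\<lambda>z. \<zeta> z ^ 3)"
  using assms(1,3,4)
proof (induction J rule: finite_induct)
  case (insert i J)
  define e where "e z = (\<Sum>j\<in>J. a j z)" for z
  define q where "q z = (\<Sum>j\<in>J. (a j z)\<^sup>2)" for z
  define E where "E z = real (card J) * b + ((e z)\<^sup>2 - q z) / 2" for z
  define R where "R z = (\<Prod>j\<in>J. f j z) - (1 + e z * \<zeta> z + E z * \<zeta> z ^ 2)" for z
  define r where "r z = f i z - (1 + a i z * \<zeta> z + b * \<zeta> z ^ 2)" for z
  have R: "R \<in> O[F](\<lambda>z. \<zeta> z ^ 3)"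
    using insert.IH insert.prems by (simp add: R_def[abs_def] e_def E_def q_def)
  have r: "r \<in> O[F](\<lambda>z. \<zeta> z ^ 3)" using insert.prems(2)[of i] by (simp add: r_def[abs_def])
  have ai: "a i \<in> O[F](\<lambda>_. 1)" and aj: "\<And>j. j \<in> J \<Longrightarrow> a j \<in> O[F](\<lambda>_. 1)" using insert.prems by auto
  have mult: "(\<lambda>x. g x * h x) \<in> O[F](\<lambda>_. 1)" if "g \<in> O[F](\<lambda>_. 1)" "h \<in> O[F](\<lambda>_. 1)" for g h :: "real \<Rightarrow> real"
    using that by (rule bigo_mult_bounded)
  have const: "(\<lambda>_. c) \<in> O[F](\<lambda>_. 1)" for c :: real by simp
  have e: "e \<in> O[F](\<lambda>_. 1)" unfolding e_def[abs_def] by (rule big_sum_in_bigo[OF aj])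
  have q: "q \<in> O[F](\<lambda>_. 1)" unfolding q_def[abs_def] power2_eq_square by (intro big_sum_in_bigo mult aj)
  have E: "E \<in> O[F](\<lambda>_. 1)"
  proof -
    have "(\<lambda>z. real (card J) * b + (e z * e z - q z) * (1 / 2)) \<in> O[F](\<lambda>_. 1)"
      by (intro sum_in_bigo mult const e q)
    then show ?thesis by (simp add: E_def[abs_def] power2_eq_square)
  qed
  have z2: "(\<lambda>z. \<zeta> z ^ 2) \<in> O[F](\<lambda>_. 1)" using mult[OF \<zeta> \<zeta>] by (simp add: power2_eq_square)
  have z3: "(\<lambda>z. \<zeta> z ^ 3) \<in> O[F](\<lambda>_. 1)" using mult[OF z2 \<zeta>] by (simp add: power2_eq_square power3_eq_cube)
  have fi: "f i \<in> O[F](\<lambda>_. 1)"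
  proof -
    have "r \<in> O[F](\<lambda>_. 1)" using r z3 by (rule landau_o.big_trans)
    then have "(\<lambda>z. r z + (1 + a i z * \<zeta> z + b * \<zeta> z ^ 2)) \<in> O[F](\<lambda>_. 1)"
      by (intro sum_in_bigo mult const ai \<zeta> z2)
    then show ?thesis by (simp add: r_def)
  qed
  have "(\<lambda>z. \<zeta> z ^ 3 * (e z * b + E z * a i z + E z * b * \<zeta> z) + R z * f i z + r z * (1 + e z * \<zeta> z + E z * \<zeta> z ^ 2))
      \<in> O[F](\<lambda>z. \<zeta> z ^ 3)"
    by (intro sum_in_bigo bigo_mult_bounded[OF R] bigo_mult_bounded[OF r] bigo_mult_bounded[OF landau_o.big_refl] mult const e E ai fi \<zeta> z2)
  moreover have "(\<Prod>j\<in>insert i J. f j z) - (1 + (\<Sum>j\<in>insert i J. a j z) * \<zeta> z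
      + (real (card (insert i J)) * b + ((\<Sum>j\<in>insert i J. a j z)\<^sup>2 - (\<Sum>j\<in>insert i J. (a j z)\<^sup>2)) / 2) * \<zeta> z ^ 2)
    = \<zeta> z ^ 3 * (e z * b + E z * a i z + E z * b * \<zeta> z) + R z * f i z + r z * (1 + e z * \<zeta> z + E z * \<zeta> z ^ 2)" for z
  proof -
    have 1: "(\<Prod>j\<in>insert i J. f j z) = f i z * (R z + 1 + e z * \<zeta> z + E z * \<zeta> z ^ 2)"
      using insert.hyps by (simp add: R_def)
    have 2: "(\<Sum>j\<in>insert i J. a j z) = a i z + e z" "(\<Sum>j\<in>insert i J. (a j z)\<^sup>2) = (a i z)\<^sup>2 + q z"
      "real (card (insert i J)) = real (card J) + 1"
      using insert.hyps by (simp_all add: e_def q_def)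
    have 3: "f i z = r z + 1 + a i z * \<zeta> z + b * \<zeta> z ^ 2" by (simp add: r_def)
    show ?thesis unfolding 1 2 3 E_def by algebra
  qed
  ultimately show ?case by simp
qed simp

lemma sum_arith: "(\<Sum>j<d. real j - (real d - 1) / 2) = 0"
proof -
  have "(\<Sum>j<d. real j) = real d * (real d - 1) / 2"
    by (induction d) (auto simp: field_simps)
  then show ?thesis by (simp add: sum_subtractf)
qed

lemma sum_arith_squares: "(\<Sum>j<d. (real j - (real d - 1) / 2)\<^sup>2) = real d * ((real d)\<^sup>2 - 1) / 12"
proof -
  have 1: "(\<Sum>j<d. real j) = real d * (real d - 1) / 2"
    by (induction d) (auto simp: field_simps)
  have 2: "(\<Sum>j<d. (real j)\<^sup>2) = real d * (real d - 1) * (2 * real d - 1) / 6"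
    by (induction d) (auto simp: field_simps power2_eq_square)
  have "(\<Sum>j<d. (real j - (real d - 1) / 2)\<^sup>2) = (\<Sum>j<d. (real j)\<^sup>2) - (real d - 1) * (\<Sum>j<d. real j) + real d * ((real d - 1) / 2)\<^sup>2"
  proof -
    have "(real j - (real d - 1) / 2)\<^sup>2 = (real j)\<^sup>2 - (real d - 1) * real j + ((real d - 1) / 2)\<^sup>2" for j
      by (simp add: power2_eq_square field_simps)
    then show ?thesis by (simp add: sum.distrib sum_subtractf flip: sum_distrib_left)
  qed
  then show ?thesis unfolding 1 2 by (simp add: field_simps power2_eq_square)
qed

text \<open>
  Dividing each of the \<open>d\<close> factors \<open>L + 1 + j\<close> by \<open>sqrt z\<close> separately leaves the expansion of
  \<open>sqrt (z + c) / sqrt z\<close> as the only analytic input, with \<open>c = (d - 1)\<^sup>2 / 4\<close>; the fractional part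
  of \<open>w\<close> enters only through bounded coefficients. The shifts \<open>j - (d - 1) / 2\<close> are symmetric about
  \<open>0\<close>, so only the sum of their squares contributes.
\<close>

lemma counting_asymptotics:
  fixes d :: nat and w :: "real \<Rightarrow> real"
  assumes w: "\<And>z. z \<ge> 0 \<Longrightarrow> w z \<ge> 0 \<and> w z * (w z + real d - 1) = z" and d: "d \<ge> 1"
  shows "(\<lambda>z. real ((nat \<lfloor>w z\<rfloor> + d) choose d) / (1 / fact d * z powr (real d / 2))
            - (1 + real d * (1 - 2 * fluctuation (w z)) / 2 * z powr (- 1 / 2)
                 + real d * (real d - 1) / 2
                     * ((1 / 2 - fluctuation (w z))\<^sup>2 + (real d - 2) / 6) * z powr (- 1)))
          \<in> O[at_top](\<lambda>z. z powr (- 3 / 2))"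
proof -
  define c where "c = (real d - 1)\<^sup>2 / 4"
  define \<zeta> where "\<zeta> z = z powr (- 1 / 2)" for z :: real
  define g where "g z = 1 / 2 - fluctuation (w z)" for z
  define a where "a j z = g z + (real j - (real d - 1) / 2)" for j :: nat and z
  define f where "f j z = (real (nat \<lfloor>w z\<rfloor>) + 1 + real j) * \<zeta> z" for j :: nat and z
  have c0: "c \<ge> 0" by (simp add: c_def)
  have wz: "w z = sqrt (z + c) - (real d - 1) / 2" if "z \<ge> 0" for z
  proof -
    have "(w z + (real d - 1) / 2)\<^sup>2 = z + c"
      using w[OF that] by (simp add: c_def power2_eq_square field_simps)
    moreover have "w z + (real d - 1) / 2 \<ge> 0" using w[OF that] d by simp
    ultimately have "sqrt (z + c) = w z + (real d - 1) / 2" by (metis real_sqrt_unique)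
    then show ?thesis by simp
  qed
  have \<zeta>1: "\<zeta> \<in> O[at_top](\<lambda>_. 1)" unfolding \<zeta>_def by real_asymp
  have gb: "\<bar>g z\<bar> \<le> 1" for z
    unfolding g_def fluctuation_def by linarith
  have aO: "a j \<in> O[at_top](\<lambda>_. 1)" for j
  proof -
    have "g \<in> O[at_top](\<lambda>_. 1)" by (rule bigoI[of _ 1]) (simp add: gb)
    then show ?thesis unfolding a_def[abs_def] by (intro sum_in_bigo) auto
  qed
  have sq: "(\<lambda>z. sqrt (z + c) * \<zeta> z - (1 + c / 2 * \<zeta> z ^ 2)) \<in> O[at_top](\<lambda>z. \<zeta> z ^ 3)"
    unfolding \<zeta>_def by real_asymp
  have fO: "(\<lambda>z. f j z - (1 + a j z * \<zeta> z + c / 2 * \<zeta> z ^ 2)) \<in> O[at_top](\<lambda>z. \<zeta> z ^ 3)" for j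
  proof (rule iffD2[OF landau_o.big.in_cong sq])
    show "\<forall>\<^sub>F z in at_top. f j z - (1 + a j z * \<zeta> z + c / 2 * \<zeta> z ^ 2) = sqrt (z + c) * \<zeta> z - (1 + c / 2 * \<zeta> z ^ 2)"
      using eventually_ge_at_top[of 0]
    proof eventually_elim
      fix z :: real assume z: "z \<ge> 0"
      have "real (nat \<lfloor>w z\<rfloor>) = w z - fluctuation (w z) - 1 / 2"
        using w[OF z] by (simp add: fluctuation_def)
      then have "real (nat \<lfloor>w z\<rfloor>) + 1 + real j = sqrt (z + c) + a j z"
        unfolding a_def g_def wz[OF z] by (simp add: field_simps)
      then show "f j z - (1 + a j z * \<zeta> z + c / 2 * \<zeta> z ^ 2) = sqrt (z + c) * \<zeta> z - (1 + c / 2 * \<zeta> z ^ 2)"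
        by (simp add: f_def algebra_simps)
    qed
  qed
  have main: "(\<lambda>z. (\<Prod>j<d. f j z) - (1 + (\<Sum>j<d. a j z) * \<zeta> z
      + (real (card {..<d}) * (c / 2) + ((\<Sum>j<d. a j z)\<^sup>2 - (\<Sum>j<d. (a j z)\<^sup>2)) / 2) * \<zeta> z ^ 2)) \<in> O[at_top](\<lambda>z. \<zeta> z ^ 3)"
    by (intro prod_second_order_expansion \<zeta>1 aO fO) auto
  have e1: "(\<Sum>j<d. a j z) = real d * g z" for z
    unfolding a_def by (simp only: sum.distrib sum_arith) simp
  have e2: "(\<Sum>j<d. (a j z)\<^sup>2) = real d * (g z)\<^sup>2 + real d * ((real d)\<^sup>2 - 1) / 12" for z
  proof -
    have "(\<Sum>j<d. (a j z)\<^sup>2) = (\<Sum>j<d. (g z)\<^sup>2 + (real j - (real d - 1) / 2)\<^sup>2 + 2 * g z * (real j - (real d - 1) / 2))"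
      unfolding a_def power2_sum ..
    also have "\<dots> = real d * (g z)\<^sup>2 + (\<Sum>j<d. (real j - (real d - 1) / 2)\<^sup>2) + 2 * g z * (\<Sum>j<d. real j - (real d - 1) / 2)"
      by (simp only: sum.distrib sum_distrib_left) simp
    finally show ?thesis by (simp only: sum_arith sum_arith_squares)
  qed
  have coeff: "real (card {..<d}) * (c / 2) + ((\<Sum>j<d. a j z)\<^sup>2 - (\<Sum>j<d. (a j z)\<^sup>2)) / 2
      = real d * (real d - 1) / 2 * ((g z)\<^sup>2 + (real d - 2) / 6)" for z
    unfolding e1 e2 c_def by (simp add: field_simps power2_eq_square)
  have ev: "\<forall>\<^sub>F z in at_top. real ((nat \<lfloor>w z\<rfloor> + d) choose d) / (1 / fact d * z powr (real d / 2))
            - (1 + real d * (1 - 2 * fluctuation (w z)) / 2 * z powr (- 1 / 2)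
                 + real d * (real d - 1) / 2
                     * ((1 / 2 - fluctuation (w z))\<^sup>2 + (real d - 2) / 6) * z powr (- 1))
     = (\<Prod>j<d. f j z) - (1 + (\<Sum>j<d. a j z) * \<zeta> z
      + (real (card {..<d}) * (c / 2) + ((\<Sum>j<d. a j z)\<^sup>2 - (\<Sum>j<d. (a j z)\<^sup>2)) / 2) * \<zeta> z ^ 2)"
    using eventually_gt_at_top[of 0]
  proof eventually_elim
    fix z :: real assume z: "z > 0"
    have zd: "\<zeta> z ^ k = z powr (- real k / 2)" for k
      using z by (simp add: \<zeta>_def powr_realpow[symmetric] powr_powr)
    have "(\<Prod>j<d. f j z) = (\<Prod>j<d. real (nat \<lfloor>w z\<rfloor>) + 1 + real j) * \<zeta> z ^ d"
      by (simp add: f_def prod.distrib)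
    also have "\<dots> = real ((nat \<lfloor>w z\<rfloor> + d) choose d) * fact d * z powr (- real d / 2)"
      by (simp only: binomial_mult_fact_eq_prod zd)
    also have "\<dots> = real ((nat \<lfloor>w z\<rfloor> + d) choose d) / (1 / fact d * z powr (real d / 2))"
      using z by (simp add: powr_minus field_simps)
    finally have 1: "real ((nat \<lfloor>w z\<rfloor> + d) choose d) / (1 / fact d * z powr (real d / 2)) = (\<Prod>j<d. f j z)" by simp
    have 2: "z powr (- 1) = \<zeta> z ^ 2" using zd[of 2] by simp
    have 3: "real d * (1 - 2 * fluctuation (w z)) / 2 = real d * g z" by (simp add: g_def field_simps)
    show "real ((nat \<lfloor>w z\<rfloor> + d) choose d) / (1 / fact d * z powr (real d / 2))
            - (1 + real d * (1 - 2 * fluctuation (w z)) / 2 * z powr (- 1 / 2)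
                 + real d * (real d - 1) / 2
                     * ((1 / 2 - fluctuation (w z))\<^sup>2 + (real d - 2) / 6) * z powr (- 1))
     = (\<Prod>j<d. f j z) - (1 + (\<Sum>j<d. a j z) * \<zeta> z
      + (real (card {..<d}) * (c / 2) + ((\<Sum>j<d. a j z)\<^sup>2 - (\<Sum>j<d. (a j z)\<^sup>2)) / 2) * \<zeta> z ^ 2)"
      unfolding 1 2 3 g_def[symmetric] \<zeta>_def[symmetric] coeff unfolding e1 ..
  qed
  have \<zeta>3: "\<forall>\<^sub>F z in at_top. \<zeta> z ^ 3 = z powr (- 3 / 2)"
    using eventually_gt_at_top[of 0]
    by eventually_elim (simp add: \<zeta>_def powr_realpow[symmetric] powr_powr)
  show ?thesis
    using iffD2[OF landau_o.big.in_cong[OF ev] main] unfolding landau_o.big.cong[OF \<zeta>3] .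
qed

section \<open>Surface measures and the semiclassical constant\<close>

lemma cone_over_sphere:
  "{r *\<^sub>R x |r x. 0 \<le> r \<and> r \<le> 1 \<and> x \<in> sphere 0 1} = (cball 0 1 :: 'a::euclidean_space set)"
proof (intro equalityI subsetI)
  fix y :: 'a assume y: "y \<in> cball 0 1"
  obtain e :: 'a where e: "norm e = 1" using vector_choose_size[of 1] by auto
  show "y \<in> {r *\<^sub>R x |r x. 0 \<le> r \<and> r \<le> 1 \<and> x \<in> sphere 0 1}"
  proof (cases "y = 0")
    case True
    then have "y = 0 *\<^sub>R e" by simp
    then show ?thesis using e by force
  next
    case False
    then have "y = norm y *\<^sub>R sgn y" "sgn y \<in> sphere 0 1" by (simp_all add: sgn_div_norm norm_sgn)
    then show ?thesis using y by (force simp del: scaleR_eq_iff)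
  qed
qed (auto simp: mult_le_one)

lemma sphere_area_sphere:
  "sphere_area (sphere 0 1 :: 'a::euclidean_space set) = real DIM('a) * unit_ball_vol (real DIM('a))"
  unfolding sphere_area_def cone_over_sphere by (simp add: measure_completion content_cball)

lemma cone_over_hemisphere:
  "{r *\<^sub>R x |r x. 0 \<le> r \<and> r \<le> 1 \<and> x \<in> (hemisphere :: ((real ^ 'n::finite) \<times> real) set)}
     = insert 0 ({y. snd y > 0} \<inter> cball 0 1)"
proof (intro equalityI subsetI)
  fix y :: "(real ^ 'n) \<times> real"
  assume "y \<in> {r *\<^sub>R x |r x. 0 \<le> r \<and> r \<le> 1 \<and> x \<in> hemisphere}"
  then obtain r x where rx: "y = r *\<^sub>R x" "0 \<le> r" "r \<le> 1" "norm x = 1" "snd x > 0"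
    by (auto simp: hemisphere_def)
  then show "y \<in> insert 0 ({y. snd y > 0} \<inter> cball 0 1)"
    by (cases "r = 0") auto
next
  fix y :: "(real ^ 'n) \<times> real"
  assume "y \<in> insert 0 ({y. snd y > 0} \<inter> cball 0 1)"
  then consider "y = 0" | "snd y > 0" "norm y \<le> 1" by auto
  then show "y \<in> {r *\<^sub>R x |r x. 0 \<le> r \<and> r \<le> 1 \<and> x \<in> hemisphere}"
  proof cases
    case 1
    have "(0, 1) \<in> (hemisphere :: ((real ^ 'n) \<times> real) set)" by (simp add: hemisphere_def norm_Pair)
    then have "0 \<le> (0::real) \<and> (0::real) \<le> 1 \<and> (0, 1) \<in> (hemisphere :: ((real ^ 'n) \<times> real) set)" by simp
    moreover have "y = 0 *\<^sub>R (0, 1)" using 1 by (simp add: zero_prod_def)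
    ultimately show ?thesis by blast
  next
    case 2
    then have n: "norm y > 0" by auto
    have "y = norm y *\<^sub>R sgn y" using n by (simp add: sgn_div_norm)
    moreover have "sgn y \<in> hemisphere" using 2 n by (simp add: hemisphere_def norm_sgn) (simp add: sgn_div_norm)
    moreover have "0 \<le> norm y \<and> norm y \<le> 1" using 2 by simp
    ultimately show ?thesis by blast
  qed
qed

text \<open>
  The central reflection exchanges the two open halves, and the equatorial disc is a null set.
\<close>

lemma measure_half_ball:
  "measure lborel ({y::'a::euclidean_space \<times> real. snd y > 0} \<inter> cball 0 1)
     = unit_ball_vol (real DIM('a) + 1) / 2"
proof -
  let ?P = "{y::'a \<times> real. snd y > 0} \<inter> cball 0 1"
  let ?N = "{y::'a \<times> real. snd y < 0} \<inter> cball 0 1"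
  let ?Z = "{y::'a \<times> real. snd y = 0} \<inter> cball 0 1"
  have o: "open {y::'a \<times> real. snd y > 0}" "open {y::'a \<times> real. snd y < 0}"
    by (intro open_Collect_less continuous_intros)+
  have c: "closed {y::'a \<times> real. snd y = 0}" by (intro closed_Collect_eq continuous_intros)
  have s: "?P \<in> sets borel" "?N \<in> sets borel" "?Z \<in> sets borel"
    using o c by (auto intro!: sets.Int)
  have fin: "emeasure lborel A \<noteq> \<infinity>" if "A \<subseteq> cball (0::'a \<times> real) 1" for A
    using emeasure_bounded_finite[of A] bounded_subset[OF bounded_cball that] by simp
  have PN: "measure lborel ?P = measure lborel ?N"
  proof -
    have "?N = (\<lambda>y. (- 1) *\<^sub>R y + 0) ` ?P"
    proof (intro equalityI subsetI)
      fix y assume "y \<in> ?N"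
      then show "y \<in> (\<lambda>y. (- 1) *\<^sub>R y + 0) ` ?P" by (intro image_eqI[of _ _ "- y"]) simp_all
    next
      fix y assume "y \<in> (\<lambda>y. (- 1) *\<^sub>R y + 0) ` ?P"
      then show "y \<in> ?N" by (elim imageE) simp
    qed
    then have "measure lebesgue ?N = measure lebesgue ?P"
      using measure_lebesgue_affine[of "- 1" 0 ?P] by simp
    then show ?thesis using s by (simp add: measure_completion)
  qed
  have Z: "measure lborel ?Z = 0"
  proof -
    have "negligible {y::'a \<times> real. (0, 1) \<bullet> y = 0}" by (rule negligible_hyperplane) (simp add: prod_eq_iff)
    then have "negligible ?Z" by (rule negligible_subset) (auto simp: inner_prod_def)
    then have "?Z \<in> null_sets lborel"
      using s(3) by (simp add: negligible_iff_null_sets null_sets_completion_iff)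
    then show ?thesis by (simp add: measure_eq_0_null_sets)
  qed
  have "cball 0 1 = (?P \<union> ?N) \<union> ?Z" by auto
  then have "measure lborel (cball (0::'a \<times> real) 1) = measure lborel ((?P \<union> ?N) \<union> ?Z)" by simp
  also have "\<dots> = measure lborel (?P \<union> ?N) + measure lborel ?Z"
    using s by (intro measure_Union fin) auto
  also have "measure lborel (?P \<union> ?N) = measure lborel ?P + measure lborel ?N"
    using s by (intro measure_Union fin) auto
  finally show ?thesis using PN Z by (simp add: content_cball add.commute)
qed

lemma sphere_area_hemisphere:
  "sphere_area (hemisphere :: ((real ^ 'n::finite) \<times> real) set)
     = (real CARD('n) + 1) * unit_ball_vol (real CARD('n) + 1) / 2"
proof -
  let ?P = "{y::(real ^ 'n) \<times> real. snd y > 0} \<inter> cball 0 1"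
  have "open {y::(real ^ 'n) \<times> real. snd y > 0}" by (intro open_Collect_less continuous_intros)
  then have s: "?P \<in> sets borel" by (auto intro!: sets.Int)
  have "emeasure lborel ?P \<noteq> \<infinity>"
    using emeasure_bounded_finite[of ?P] bounded_subset[OF bounded_cball, of ?P 0 1] by simp
  then have "measure lborel ({0} \<union> ?P) = measure lborel {0} + measure lborel ?P"
    using s measure_Union[of lborel "{0}" ?P] by simp
  then have "measure lebesgue (insert 0 ?P) = unit_ball_vol (real CARD('n) + 1) / 2"
    using s measure_half_ball[where 'a = "real ^ 'n"] by (simp add: measure_completion)
  then show ?thesis
    unfolding sphere_area_def cone_over_hemisphere by (simp add: add.commute)
qed

text \<open>
  The left-hand side is the area of the hemisphere as the volume of a half-ball gives it.
\<close>

lemma hemisphere_area_Gamma: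
  "(real d + 1) * unit_ball_vol (real d + 1) / 2 = pi powr ((real d + 1) / 2) / Gamma ((real d + 1) / 2)"
proof -
  have "Gamma ((real d + 1) / 2 + 1) = (real d + 1) / 2 * Gamma ((real d + 1) / 2)"
    by (intro Gamma_plus1) (auto elim!: nonpos_Ints_cases)
  then show ?thesis by (simp add: unit_ball_vol_def)
qed

text \<open>
  Legendre duplication at half-integers: from \<open>d\<close> to \<open>d + 1\<close> the two factors change places, and one
  of them has its argument increased by \<open>1\<close>.
\<close>

lemma Gamma_half_integer_product:
  "Gamma ((real d + 1) / 2) * Gamma (1 + real d / 2) = sqrt pi * fact d / 2 ^ d"
proof (induction d)
  case 0
  then show ?case by (simp add: Gamma_one_half_real)
next
  case (Suc d)
  have "Gamma ((real d + 1) / 2 + 1) = (real d + 1) / 2 * Gamma ((real d + 1) / 2)"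
    by (intro Gamma_plus1) (auto elim!: nonpos_Ints_cases)
  moreover have "(real d + 1) / 2 + 1 = 1 + real (Suc d) / 2" "1 + real d / 2 = (real (Suc d) + 1) / 2"
    by (simp_all add: field_simps)
  ultimately have "Gamma ((real (Suc d) + 1) / 2) * Gamma (1 + real (Suc d) / 2)
      = (real d + 1) / 2 * (Gamma ((real d + 1) / 2) * Gamma (1 + real d / 2))"
    by (simp only: mult_ac)
  then show ?case unfolding Suc by (simp add: field_simps)
qed

lemma L_class_hemisphere:
  "L_class 0 d * ((real d + 1) * unit_ball_vol (real d + 1) / 2) = 1 / fact d"
proof -
  have G: "Gamma ((real d + 1) / 2) > 0" "Gamma (1 + real d / 2) > 0" by (auto intro!: Gamma_real_pos)
  have dup: "Gamma ((real d + 1) / 2) * Gamma (1 + real d / 2) = sqrt pi * fact d / 2 ^ d"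
    by (rule Gamma_half_integer_product)
  have p: "(4 * pi) powr (- real d / 2) * pi powr ((real d + 1) / 2) = 2 powr (- real d) * sqrt pi"
  proof -
    have "(4 * pi) powr (- real d / 2) = 4 powr (- real d / 2) * pi powr (- real d / 2)"
      by (simp add: powr_mult)
    also have "(4::real) powr (- real d / 2) = (2 powr 2) powr (- real d / 2)" by simp
    also have "\<dots> = 2 powr (- real d)" by (simp only: powr_powr) simp
    finally show ?thesis
      by (simp add: powr_add[symmetric] powr_half_sqrt[symmetric] mult.assoc field_simps)
  qed
  have "L_class 0 d * ((real d + 1) * unit_ball_vol (real d + 1) / 2)
     = ((4 * pi) powr (- real d / 2) * pi powr ((real d + 1) / 2)) / (Gamma ((real d + 1) / 2) * Gamma (1 + real d / 2))"
    unfolding hemisphere_area_Gamma L_class_def by (simp add: field_simps)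
  also have "\<dots> = 1 / fact d" unfolding p dup by (simp add: powr_minus powr_realpow field_simps)
  finally show ?thesis .
qed

lemma boundary_coefficient:
  assumes "d \<ge> 1"
  shows "1 / 4 * (L_class 0 (d - 1) / L_class 0 d)
      * (real d * unit_ball_vol (real d) / ((real d + 1) * unit_ball_vol (real d + 1) / 2)) = real d / 2"
proof -
  obtain e where d: "d = Suc e" using assms by (cases d) auto
  have d_minus: "d - 1 = e" by (simp add: d)
  have g: "0 + 1 + real e / 2 = (real d + 1) / 2" by (simp add: d field_simps)
  have p1: "(4 * pi) powr (- real e / 2) / (4 * pi) powr (- real d / 2) = 2 * sqrt pi"
  proof -
    have "(4 * pi) powr (- real e / 2) / (4 * pi) powr (- real d / 2) = (4 * pi) powr (- real e / 2 - (- real d / 2))"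
      by (rule powr_diff[symmetric])
    also have "- real e / 2 - (- real d / 2) = 1 / 2" by (simp add: d field_simps)
    finally show ?thesis by (simp add: powr_half_sqrt real_sqrt_mult)
  qed
  have p2: "pi powr (real d / 2) / pi powr ((real d + 1) / 2) = 1 / sqrt pi"
  proof -
    have "pi powr (real d / 2) / pi powr ((real d + 1) / 2) = pi powr (real d / 2 - (real d + 1) / 2)"
      by (rule powr_diff[symmetric])
    also have "real d / 2 - (real d + 1) / 2 = - (1 / 2)" by (simp add: field_simps)
    finally show ?thesis by (simp add: powr_minus powr_half_sqrt field_simps)
  qed
  have G: "Gamma ((1 + real d) / 2) > 0" "Gamma ((real d + 2) / 2) > 0" by (auto intro!: Gamma_real_pos)
  have "1 / 4 * (L_class 0 (d - 1) / L_class 0 d) * (real d * unit_ball_vol (real d) / ((real d + 1) * unit_ball_vol (real d + 1) / 2))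
     = 1 / 4 * ((4 * pi) powr (- real e / 2) / (4 * pi) powr (- real d / 2)) * real d * (pi powr (real d / 2) / pi powr ((real d + 1) / 2))"
    unfolding hemisphere_area_Gamma L_class_def using G
    by (simp only: d_minus g) (simp add: unit_ball_vol_def add.commute field_simps less_imp_neq[THEN not_sym])
  then show ?thesis unfolding p1 p2 by simp
qed

section \<open>Weyl asymptotics on the hemisphere\<close>

theorem theorem4p2p3:
  fixes d :: nat and w :: "real \<Rightarrow> real" and N :: "real \<Rightarrow> real" and \<psi> :: "real \<Rightarrow> real"
    and S B :: real
  assumes d_def: "d = CARD('n::finite)" and d_ge: "d \<ge> 2"
    and N_def: "N = (\<lambda>z. real (neumann_counting TYPE('n) z))"
    and psi_def: "\<psi> = fluctuation"
    and S_def: "S = sphere_area (hemisphere :: ((real ^ 'n) \<times> real) set)"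
    and B_def: "B = sphere_area (sphere 0 1 :: (real ^ 'n) set)"
    and w: "\<And>z. z \<ge> 0 \<Longrightarrow> w z \<ge> 0 \<and> w z * (w z + real d - 1) = z"
  shows "(\<lambda>z. N z / (L_class 0 d * S * z powr (real d / 2))
            - (1 + 1 / 4 * (L_class 0 (d - 1) / L_class 0 d) * (B / S)
                     * (1 - 2 * \<psi> (w z)) * z powr (- 1 / 2)
                 + real d * (real d - 1) / 2
                     * ((1 / 2 - \<psi> (w z))\<^sup>2 + (real d - 2) / 6) * z powr (- 1)))
          \<in> O[at_top](\<lambda>z. z powr (- 3 / 2))
       \<and> (\<lambda>z. N z / (L_class 0 d * S * z powr (real d / 2))
            - (1 + real d * (1 - 2 * \<psi> (w z)) / 2 * z powr (- 1 / 2)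
                 + real d * (real d - 1) / 2
                     * ((1 / 2 - \<psi> (w z))\<^sup>2 + (real d - 2) / 6) * z powr (- 1)))
          \<in> O[at_top](\<lambda>z. z powr (- 3 / 2))"
proof -
  have S: "S = (real d + 1) * unit_ball_vol (real d + 1) / 2"
    by (simp add: S_def d_def sphere_area_hemisphere)
  have B: "B = real d * unit_ball_vol (real d)"
    by (simp add: B_def d_def sphere_area_sphere)
  have LS: "L_class 0 d * S = 1 / fact d"
    unfolding S by (rule L_class_hemisphere)
  have coeff: "1 / 4 * (L_class 0 (d - 1) / L_class 0 d) * (B / S) = real d / 2"
    unfolding S B using d_ge by (intro boundary_coefficient) simp
  have N: "N z = real ((nat \<lfloor>w z\<rfloor> + d) choose d)" if "z \<ge> 0" for z
    using neumann_counting_eq[where 'n = 'n, of "w z" z] w[OF that] by (simp add: N_def d_def)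
  have second: "(\<lambda>z. N z / (L_class 0 d * S * z powr (real d / 2))
            - (1 + real d * (1 - 2 * \<psi> (w z)) / 2 * z powr (- 1 / 2)
                 + real d * (real d - 1) / 2
                     * ((1 / 2 - \<psi> (w z))\<^sup>2 + (real d - 2) / 6) * z powr (- 1)))
          \<in> O[at_top](\<lambda>z. z powr (- 3 / 2))"
    unfolding LS psi_def
  proof (rule iffD2[OF landau_o.big.in_cong counting_asymptotics[OF w]])
    show "\<forall>\<^sub>F z in at_top. N z / (1 / fact d * z powr (real d / 2))
        - (1 + real d * (1 - 2 * fluctuation (w z)) / 2 * z powr (- 1 / 2)
             + real d * (real d - 1) / 2
                 * ((1 / 2 - fluctuation (w z))\<^sup>2 + (real d - 2) / 6) * z powr (- 1))
      = real ((nat \<lfloor>w z\<rfloor> + d) choose d) / (1 / fact d * z powr (real d / 2))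
        - (1 + real d * (1 - 2 * fluctuation (w z)) / 2 * z powr (- 1 / 2)
             + real d * (real d - 1) / 2
                 * ((1 / 2 - fluctuation (w z))\<^sup>2 + (real d - 2) / 6) * z powr (- 1))"
      using eventually_ge_at_top[of 0] by eventually_elim (simp only: N)
  qed (use d_ge in auto)
  then show ?thesis unfolding coeff by simp
qed

end
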